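(* If $d$ is an even positive integer, then $$\frac1{\vartheta(d)}=\int_{S^{d-1}}\left|\xi^*J\left(\tfrac d2,\tfrac d2;1,1\right)\xi\right|d\xi=2I_{\frac12}\left(\tfrac d4,\tfrac d4+1\right)-1=\frac{\Gamma\left(\frac12+\frac d4\right)}{\sqrt\pi\,\Gamma\left(1+\frac d4\right)}.$$ In particular, the minimum over $\{B\in\mathbb S_d:\operatorname{tr}|B|=d\}$ defining $\frac1{\vartheta(d)}$ occurs at a $B=J(s,t;a,b)$ with $s=t=\frac d2$ and $a=b=1$. If $d\ge3$ is odd, then there exist $a,b\ge0$ such that $$\frac1{\vartheta(d)}=\int_{S^{d-1}}\left|\xi^*J\left(\tfrac{d+1}2,\tfrac{d-1}2;a,b\right)\xi\right|d\xi,$$ $$\frac1{\vartheta(d)}=2I_{\frac a{a+b}}\left(\tfrac{d-1}4,\tfrac{d+1}4+1\right)-1=2I_{\frac b{a+b}}\left(\tfrac{d+1}4,\tfrac{d-1}4+1\right)-1,$$ and $a\frac{d+1}2+b\frac{d-1}2=d$. This last equation together with the preceding displayed chain of equalities uniquely determines $a,b$. Furthermore, the minimum over $\{B\in\mathbb S_d:\operatorname{tr}|B|=d\}$ defining $\frac1{\vartheta(d)}$ occurs at a $B=J(s,t;a,b)$ with $s=\frac{d+1}2$ and $t=\frac{d-1}2$.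
   Context: $\mathbb S_d$ is the set of real symmetric $d\times d$ matrices, and $$\frac1{\vartheta(d)}:=\min_{\substack{B\in\mathbb S_d\\ \operatorname{tr}|B|=d}}\int_{S^{d-1}}|\xi^*B\xi|\,d\xi,$$ where $S^{d-1}\subseteq\mathbb R^d$ carries the rotation invariant probability measure. For $s,t\in\mathbb N=\{1,2,\dots\}$ and $a,b\ge0$, $J(s,t;a,b)=aI_s\oplus(-b)I_t$ is the diagonal $(s+t)\times(s+t)$ matrix whose first $s$ diagonal entries are $a$ and last $t$ diagonal entries are $-b$. For $\alpha,\beta>0$ and $p\in[0,1]$: $B_p(\alpha,\beta)=\int_0^px^{\alpha-1}(1-x)^{\beta-1}dx$, $B(\alpha,\beta)=B_1(\alpha,\beta)$, and $I_p(\alpha,\beta)=B_p(\alpha,\beta)/B(\alpha,\beta)$ (regularized incomplete beta function). $\Gamma$ is the Euler gamma function. *)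

theory Defs
  imports "HOL-Probability.Probability"
begin

(* Invariance is required under all of O(n): for n >= 2 this is the same as invariance under SO(n),
   and for n = 1, where SO(n) is trivial, it is what makes the measure on S^0 unique. *)
definition rotation_invariant_sphere :: "(real^'n) measure \<Rightarrow> bool" where
  "rotation_invariant_sphere M \<longleftrightarrow>
     prob_space M \<and> sets M = sets (restrict_space borel (sphere 0 1)) \<and>
     (\<forall>f. orthogonal_transformation f \<longrightarrow> distr M M f = M)"

definition sphere_measure :: "(real^'n) measure" where
  "sphere_measure = (THE M. rotation_invariant_sphere M)"

lemma rotation_invariant_sphereD:
  assumes "rotation_invariant_sphere M"
  shows "prob_space M" "sets M = sets (restrict_space borel (sphere 0 1))"
    "space M = sphere 0 1"
    "orthogonal_transformation f \<Longrightarrow> distr M M f = M"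
proof -
  show "prob_space M" and s: "sets M = sets (restrict_space borel (sphere 0 1))"
    and "orthogonal_transformation f \<Longrightarrow> distr M M f = M"
    using assms by (auto simp: rotation_invariant_sphere_def)
  show "space M = sphere 0 1"
    using sets_eq_imp_space_eq[OF s] by (simp add: space_restrict_space)
qed

lemma emeasure_lborel_orthogonal_image:
  fixes f :: "real^'n::{finite,wellorder} \<Rightarrow> real^'n::_"
  assumes f: "orthogonal_transformation f" and S: "S \<in> sets borel" "S \<subseteq> ball 0 1"
    and fS: "f ` S \<in> sets borel"
  shows "emeasure lborel (f ` S) = emeasure lborel S"
proof -
  have fin: "emeasure lborel T < \<infinity>" if "T \<subseteq> ball 0 1" for T :: "(real^'n::_) set"
    using emeasure_mono[OF that, of lborel] emeasure_lborel_ball_finite[of "0::real^'n::_" 1]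
    by (auto intro: le_less_trans)
  have S': "S \<in> lmeasurable"
    using S fin[of S] by (auto simp: fmeasurable_def)
  have *: "f ` S \<subseteq> ball 0 1"
    using S f by (auto simp: orthogonal_transformation)
  have "measure lborel (f ` S) = measure lborel S"
    using measure_orthogonal_image[OF f S'] S fS by simp
  moreover have "emeasure lborel (f ` S) = ennreal (measure lborel (f ` S))"
    using fin[OF *] by (intro emeasure_eq_ennreal_measure) auto
  moreover have "emeasure lborel S = ennreal (measure lborel S)"
    using fin[OF S(2)] by (intro emeasure_eq_ennreal_measure) auto
  ultimately show ?thesis by simp
qed

lemma orthogonal_transformation_measurable:
  fixes f :: "real^'n \<Rightarrow> real^'n"
  assumes "orthogonal_transformation f"
  shows "f \<in> borel_measurable borel"
proof -
  have "linear f" using assms by (simp add: orthogonal_transformation)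
  then show ?thesis
    by (intro borel_measurable_continuous_onI linear_continuous_on)
      (simp add: linear_conv_bounded_linear)
qed

lemma orthogonal_transformation_measurable_sphere:
  fixes f :: "real^'n \<Rightarrow> real^'n"
  assumes "orthogonal_transformation f"
  shows "f \<in> measurable (restrict_space borel (sphere 0 1)) (restrict_space borel (sphere 0 1))"
  using assms orthogonal_transformation_measurable[OF assms]
  by (intro measurable_restrict_space3) (auto simp: orthogonal_transformation)

lemma rotation_invariant_sphere_exists:
  "\<exists>M :: (real^'n::{finite,wellorder}) measure. rotation_invariant_sphere M"
proof -
  define D where "D = ball (0::real^'n::_) 1 - {0}"
  define S where "S = restrict_space borel (sphere (0::real^'n::_) 1)"
  define U where "U = restrict_space (uniform_measure lborel D) D"
  define M where "M = distr U S sgn"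
  have D: "D \<in> sets borel" "D \<subseteq> ball 0 1" by (auto simp: D_def)
  have eD: "emeasure lborel D = emeasure lborel (ball (0::real^'n::_) 1)"
    unfolding D_def by (subst emeasure_Diff) auto
  have eD1: "emeasure lborel D \<noteq> 0" "emeasure lborel D \<noteq> \<infinity>"
    unfolding eD using emeasure_lborel_ball_finite[of "0::real^'n::_" 1]
    using content_ball_pos[of 1 "0::real^'n::_"] by (auto simp: measure_def)
  have U: "emeasure U A = emeasure lborel A / emeasure lborel D" if "A \<in> sets borel" "A \<subseteq> D" for A
    unfolding U_def using that D
    by (subst emeasure_restrict_space) (auto simp: Int_absorb1 divide_ennreal_def)
  have sU: "space U = D" by (simp add: U_def space_restrict_space)
  have "prob_space U"
    by standard (use U[of D] D eD1 sU in \<open>auto simp: ennreal_divide_self less_top\<close>)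
  have sgnU: "sgn \<in> measurable U S"
    unfolding U_def S_def by (intro measurable_restrict_space3) (auto simp: D_def norm_sgn)
  have "prob_space M"
    unfolding M_def by (intro prob_space.prob_space_distr \<open>prob_space U\<close> sgnU)
  moreover have setsM: "sets M = sets S" by (simp add: M_def)
  moreover have "distr M M f = M" if f: "orthogonal_transformation f" for f
  proof (rule measure_eqI)
    show "sets (distr M M f) = sets M" by simp
    fix A assume "A \<in> sets (distr M M f)"
    then have A: "A \<in> sets S" by (simp add: setsM)
    have fm: "f \<in> measurable S S"
      unfolding S_def by (rule orthogonal_transformation_measurable_sphere[OF f])
    have fM: "f \<in> measurable M M"
      using fm by (simp add: measurable_cong_sets[OF setsM setsM])
    have lin: "linear f" and nf: "\<And>x. norm (f x) = norm x"
      using f by (auto simp: orthogonal_transformation)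
    define X where "X = sgn -` A \<inter> D"
    define Y where "Y = sgn -` (f -` A \<inter> space S) \<inter> D"
    have subU: "E \<in> sets borel" if "E \<in> sets U" for E
      using that D by (auto simp: U_def sets_restrict_space)
    have X: "X \<in> sets borel" 
      unfolding X_def using measurable_sets[OF sgnU A] by (intro subU) (simp add: sU)
    have Y: "Y \<in> sets borel"
      unfolding Y_def using measurable_sets[OF sgnU measurable_sets[OF fm A]]
      by (intro subU) (simp add: sU)
    have sgnf: "sgn (f x) = f (sgn x)" for x
      using lin by (simp add: sgn_div_norm nf linear_scale)
    have "f ` Y = X"
    proof safe
      fix x assume "x \<in> Y" then show "f x \<in> X"
        using nf[of x] by (auto simp: X_def Y_def D_def sgnf)
    next
      fix x assume x: "x \<in> X"
      obtain y where y: "x = f y" using orthogonal_transformation_surj[OF f] by blast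
      then have "y \<in> Y" using x nf[of y] linear_0[OF lin]
        by (auto simp: X_def Y_def D_def sgnf S_def space_restrict_space norm_sgn)
      then show "x \<in> f ` Y" using y by blast
    qed
    then have eq: "emeasure lborel X = emeasure lborel Y"
      using emeasure_lborel_orthogonal_image[OF f, of Y] X Y D by (auto simp: Y_def)
    have "emeasure (distr M M f) A = emeasure M (f -` A \<inter> space M)"
      using A fM by (subst emeasure_distr) (auto simp: setsM)
    also have "\<dots> = emeasure U Y"
      unfolding M_def using sgnU measurable_sets[OF fm A]
      by (subst emeasure_distr) (auto simp: Y_def sU)
    also have "\<dots> = emeasure U X"
      using U[OF X] U[OF Y] eq by (auto simp: X_def Y_def)
    also have "\<dots> = emeasure M A"
      unfolding M_def using sgnU A by (subst emeasure_distr) (auto simp: X_def sU)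
    finally show "emeasure (distr M M f) A = emeasure M A" .
  qed
  ultimately have "rotation_invariant_sphere M"
    by (simp add: rotation_invariant_sphere_def S_def)
  then show ?thesis by blast
qed

lemma rotation_invariant_sphere_ball:
  fixes M :: "(real^'n) measure"
  assumes M: "rotation_invariant_sphere M" and x: "norm x = 1" and y: "norm y = 1"
  shows "emeasure M (ball x r \<inter> sphere 0 1) = emeasure M (ball y r \<inter> sphere 0 1)"
proof -
  note R = rotation_invariant_sphereD[OF M]
  obtain f where f: "orthogonal_transformation f" "f x = y"
    using orthogonal_transformation_exists[of x y] unfolding x y by blast
  have fM: "f \<in> measurable M M"
    using orthogonal_transformation_measurable_sphere[OF f(1)]
    by (simp add: measurable_cong_sets[OF R(2) R(2)])
  have B: "ball y r \<inter> sphere 0 1 \<in> sets M"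
    unfolding R by (auto simp: sets_restrict_space)
  have "emeasure M (ball y r \<inter> sphere 0 1) = emeasure (distr M M f) (ball y r \<inter> sphere 0 1)"
    unfolding R(4)[OF f(1)] ..
  also have "\<dots> = emeasure M (f -` (ball y r \<inter> sphere 0 1) \<inter> space M)"
    by (rule emeasure_distr[OF fM B])
  also have "f -` (ball y r \<inter> sphere 0 1) \<inter> space M = ball x r \<inter> sphere 0 1"
  proof -
    have "norm (f z) = norm z" for z using f(1) by (simp add: orthogonal_transformation)
    moreover have "dist y (f z) = dist x z" for z
      using f(1) unfolding f(2)[symmetric] orthogonal_transformation_isometry by blast
    ultimately show ?thesis unfolding R(3) by (simp add: set_eq_iff)
  qed
  finally show ?thesis by simp
qed

lemma rotation_invariant_sphere_ball_pos:
  fixes M :: "(real^'n) measure"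
  assumes M: "rotation_invariant_sphere M" and x: "norm x = 1" and r: "r > 0"
  shows "emeasure M (ball x r \<inter> sphere 0 1) > 0"
proof (rule ccontr)
  note R = rotation_invariant_sphereD[OF M]
  assume "\<not> ?thesis"
  then have "emeasure M (ball x r \<inter> sphere 0 1) = 0" by (simp only: not_gr_zero)
  then have 0: "emeasure M (ball y r \<inter> sphere 0 1) = 0" if "norm y = 1" for y
    unfolding rotation_invariant_sphere_ball[OF M x that, of r] .
  have "compact (sphere (0::real^'n) 1)" by simp
  then obtain C where C: "C \<subseteq> sphere 0 1" "finite C" "sphere (0::real^'n) 1 \<subseteq> (\<Union>c\<in>C. ball c r)"
  proof (rule compactE_image[where C = "sphere 0 1" and f = "\<lambda>c. ball c r"])
    show "sphere (0::real^'n) 1 \<subseteq> (\<Union>c\<in>sphere 0 1. ball c r)" using r by (meson UN_I centre_in_ball subsetI)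
  qed auto
  have "(\<Union>c\<in>C. ball c r \<inter> sphere 0 1) \<in> null_sets M"
    using C 0 by (intro null_sets_UN' countable_finite)
      (auto simp: null_sets_def R(2) sets_restrict_space)
  moreover have "(\<Union>c\<in>C. ball c r \<inter> sphere 0 1) = space M"
    using C unfolding R(3) by auto
  ultimately have "emeasure M (space M) = 0" by auto
  then show False using prob_space.emeasure_space_1[OF R(1)] by simp
qed

lemma rotation_invariant_sphere_ratio:
  fixes M N :: "(real^'n) measure"
  assumes M: "rotation_invariant_sphere M" and N: "rotation_invariant_sphere N"
    and e: "norm e = 1" and U: "open U"
  shows "emeasure M (U \<inter> sphere 0 1) \<le>
    liminf (\<lambda>n. emeasure M (ball e (1/Suc n) \<inter> sphere 0 1) / emeasure N (ball e (1/Suc n) \<inter> sphere 0 1))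
     * emeasure N (U \<inter> sphere 0 1)"
proof -
  let ?S = "sphere (0::real^'n) 1"
  note RM = rotation_invariant_sphereD[OF M] and RN = rotation_invariant_sphereD[OF N]
  interpret M: prob_space M by (rule RM)
  interpret N: prob_space N by (rule RN)
  interpret pair_sigma_finite M N ..
  define h where "h = (\<lambda>n. emeasure N (ball e (1/Suc n) \<inter> ?S))"
  define g where "g = (\<lambda>n. emeasure M (ball e (1/Suc n) \<inter> ?S))"
  have h0: "h n \<noteq> 0" "h n \<noteq> \<infinity>" for n
    using rotation_invariant_sphere_ball_pos[OF N e, of "1/Suc n"] by (auto simp: h_def N.emeasure_eq_measure)
  define K where "K = (\<lambda>n p. indicator {p. dist (fst p) (snd p) < 1/Suc n \<and> fst p \<in> U \<and> snd p \<in> U} p :: ennreal)"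
  have sM: "sets M = sets (restrict_space borel ?S)" and sN: "sets N = sets (restrict_space borel ?S)"
    using RM RN by auto
  have BM: "A \<inter> ?S \<in> sets M" and BN: "A \<inter> ?S \<in> sets N" if "A \<in> sets borel" for A
    using that by (auto simp: sM sN sets_restrict_space)
  have Kb: "K n \<in> borel_measurable (borel \<Otimes>\<^sub>M borel)" for n
  proof -
    have "{p. dist (fst p) (snd p) < 1/Suc n \<and> fst p \<in> U \<and> snd p \<in> U}
        = {p. dist (fst p) (snd p) < 1/Suc n} \<inter> U \<times> U" by auto
    moreover have "open ({p :: (real^'n) \<times> (real^'n). dist (fst p) (snd p) < 1/Suc n} \<inter> U \<times> U)"
      using U by (intro open_Int open_Times open_Collect_less continuous_intros)
    ultimately show ?thesis
      unfolding K_def borel_prod by (intro borel_measurable_indicator) simp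
  qed
  have Km: "K n \<in> borel_measurable (M \<Otimes>\<^sub>M N)" for n
  proof -
    have "(\<lambda>p. K n (fst p, snd p)) \<in> borel_measurable (M \<Otimes>\<^sub>M N)"
    proof (rule measurable_compose[OF _ Kb])
      have "(\<lambda>x. x) \<in> measurable M borel" "(\<lambda>x. x) \<in> measurable N borel"
        unfolding measurable_cong_sets[OF sM refl] measurable_cong_sets[OF sN refl]
        by (auto intro: measurable_restrict_space1)
      then show "(\<lambda>p. (fst p, snd p)) \<in> measurable (M \<Otimes>\<^sub>M N) (borel \<Otimes>\<^sub>M borel)"
        by (intro measurable_Pair measurable_compose[OF measurable_fst] measurable_compose[OF measurable_snd])
    qed
    then show ?thesis by simp
  qed
  have KM: "(\<lambda>x. \<integral>\<^sup>+y. K n (x, y) \<partial>N) \<in> borel_measurable M" for n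
    using Km by (intro N.borel_measurable_nn_integral) (simp add: case_prod_beta')
  have KN: "(\<integral>\<^sup>+y. K n (x, y) \<partial>N) \<le> h n" if "x \<in> ?S" for x n
  proof -
    have "(\<integral>\<^sup>+y. K n (x, y) \<partial>N) \<le> (\<integral>\<^sup>+y. indicator (ball x (1/Suc n) \<inter> ?S) y \<partial>N)"
      by (intro nn_integral_mono) (auto simp: K_def indicator_def RN(3))
    also have "\<dots> = h n"
      using rotation_invariant_sphere_ball[OF N, of x e] that e
      by (simp add: h_def BN)
    finally show ?thesis .
  qed
  have lim: "indicator (U \<inter> ?S) x \<le> liminf (\<lambda>n. (\<integral>\<^sup>+y. K n (x, y) \<partial>N) / h n)"
    if x: "x \<in> space M" for x
  proof (cases "x \<in> U")
    case True
    then obtain r where r: "r > 0" "ball x r \<subseteq> U" using U by (auto simp: open_contains_ball)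
    have "\<forall>\<^sub>F n in sequentially. 1/Suc n < r"
      using r(1) by real_asymp
    then have "\<forall>\<^sub>F n in sequentially. 1 \<le> (\<integral>\<^sup>+y. K n (x, y) \<partial>N) / h n"
    proof eventually_elim
      case (elim n)
      have "h n = (\<integral>\<^sup>+y. indicator (ball x (1/Suc n) \<inter> ?S) y \<partial>N)"
        using rotation_invariant_sphere_ball[OF N, of x e] x e RM(3)
        by (simp add: h_def BN)
      also have "\<dots> \<le> (\<integral>\<^sup>+y. K n (x, y) \<partial>N)"
        using elim r(2) True by (intro nn_integral_mono) (auto simp: K_def indicator_def dist_commute subset_iff)
      finally have "h n / h n \<le> (\<integral>\<^sup>+y. K n (x, y) \<partial>N) / h n"
        by (rule divide_right_mono_ennreal)
      moreover have "h n / h n = 1" using h0[of n] by (simp add: ennreal_divide_self less_top)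
      ultimately show ?case by simp
    qed
    then have "1 \<le> liminf (\<lambda>n. (\<integral>\<^sup>+y. K n (x, y) \<partial>N) / h n)"
      by (rule Liminf_bounded)
    then show ?thesis by (auto simp: indicator_def)
  qed auto
  have "emeasure M (U \<inter> ?S) = (\<integral>\<^sup>+x. indicator (U \<inter> ?S) x \<partial>M)"
    using U by (simp add: BM)
  also have "\<dots> \<le> (\<integral>\<^sup>+x. liminf (\<lambda>n. (\<integral>\<^sup>+y. K n (x, y) \<partial>N) / h n) \<partial>M)"
    by (intro nn_integral_mono lim)
  also have "\<dots> \<le> liminf (\<lambda>n. \<integral>\<^sup>+x. ((\<integral>\<^sup>+y. K n (x, y) \<partial>N) / h n) \<partial>M)"
    using KM by (intro nn_integral_liminf) auto
  also have "\<dots> \<le> liminf (\<lambda>n. g n / h n * emeasure N (U \<inter> ?S))"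
  proof (intro Liminf_mono always_eventually allI)
    fix n
    have 1: "(\<integral>\<^sup>+x. ((\<integral>\<^sup>+y. K n (x, y) \<partial>N) / h n) \<partial>M) = (\<integral>\<^sup>+x. (\<integral>\<^sup>+y. K n (x, y) \<partial>N) \<partial>M) / h n"
      by (intro nn_integral_divide KM)
    have "(\<integral>\<^sup>+x. (\<integral>\<^sup>+y. K n (x, y) \<partial>N) \<partial>M) = (\<integral>\<^sup>+y. (\<integral>\<^sup>+x. K n (x, y) \<partial>M) \<partial>N)"
      using Km by (intro Fubini'[symmetric]) (simp add: case_prod_beta')
    also have "\<dots> \<le> (\<integral>\<^sup>+y. g n * indicator (U \<inter> ?S) y \<partial>N)"
    proof (intro nn_integral_mono)
      fix y assume y: "y \<in> space N"
      show "(\<integral>\<^sup>+x. K n (x, y) \<partial>M) \<le> g n * indicator (U \<inter> ?S) y"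
      proof (cases "y \<in> U")
        case True
        have "(\<integral>\<^sup>+x. K n (x, y) \<partial>M) \<le> (\<integral>\<^sup>+x. indicator (ball y (1/Suc n) \<inter> ?S) x \<partial>M)"
          by (intro nn_integral_mono) (auto simp: K_def indicator_def RM(3) dist_commute)
        also have "\<dots> = g n"
          using rotation_invariant_sphere_ball[OF M, of y e] y e RN(3)
          by (simp add: g_def BM)
        finally show ?thesis using True y RN(3) by (simp add: indicator_def)
      qed (simp add: K_def)
    qed
    also have "\<dots> = g n * emeasure N (U \<inter> ?S)"
      using U by (intro nn_integral_cmult_indicator) (simp add: BN)
    finally have "(\<integral>\<^sup>+x. (\<integral>\<^sup>+y. K n (x, y) \<partial>N) \<partial>M) / h n \<le> g n * emeasure N (U \<inter> ?S) / h n"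
      by (rule divide_right_mono_ennreal)
    then show "(\<integral>\<^sup>+x. ((\<integral>\<^sup>+y. K n (x, y) \<partial>N) / h n) \<partial>M) \<le> g n / h n * emeasure N (U \<inter> ?S)"
      unfolding 1 by (simp add: divide_ennreal_def mult_ac)
  qed
  also have "\<dots> = liminf (\<lambda>n. g n / h n) * emeasure N (U \<inter> ?S)"
    unfolding mult.commute[of _ "emeasure N (U \<inter> ?S)"]
    by (rule Liminf_compose_continuous_mono[where f = "\<lambda>x. emeasure N (U \<inter> ?S) * x"])
      (auto simp: mono_def mult_left_mono N.emeasure_eq_measure
        intro!: ennreal_continuous_on_cmult continuous_on_id)
  finally show ?thesis by (simp add: g_def h_def)
qed

lemma rotation_invariant_sphere_le:
  fixes M N :: "(real^'n) measure"
  assumes M: "rotation_invariant_sphere M" and N: "rotation_invariant_sphere N" and U: "open U"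
  shows "emeasure M (U \<inter> sphere 0 1) \<le> emeasure N (U \<inter> sphere 0 1)"
proof -
  let ?S = "sphere (0::real^'n) 1"
  note RM = rotation_invariant_sphereD[OF M] and RN = rotation_invariant_sphereD[OF N]
  interpret M: prob_space M by (rule RM)
  interpret N: prob_space N by (rule RN)
  define e where "e = (axis undefined 1 :: real^'n)"
  have e: "norm e = 1" by (simp add: e_def)
  define h where "h = (\<lambda>n. emeasure N (ball e (1/Suc n) \<inter> ?S))"
  define g where "g = (\<lambda>n. emeasure M (ball e (1/Suc n) \<inter> ?S))"
  have h0: "h n > 0" "h n \<noteq> \<infinity>" "g n > 0" "g n \<noteq> \<infinity>" for n
    using rotation_invariant_sphere_ball_pos[OF N e, of "1/Suc n"]
      rotation_invariant_sphere_ball_pos[OF M e, of "1/Suc n"]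
    by (auto simp: h_def g_def N.emeasure_eq_measure M.emeasure_eq_measure)
  define q where "q = (\<lambda>n. g n / h n)"
  have "1 \<le> liminf (\<lambda>n. h n / g n)"
    using rotation_invariant_sphere_ratio[OF N M e open_UNIV]
      M.emeasure_space_1 N.emeasure_space_1 by (simp add: h_def g_def RM(3) RN(3))
  moreover have "h n / g n = inverse (q n)" for n
    using h0[of n] by (cases "h n"; cases "g n")
      (auto simp: q_def divide_ennreal inverse_ennreal ennreal_less_zero_iff)
  ultimately have "1 \<le> liminf (\<lambda>n. inverse (q n))" by simp
  have antimono: "inverse b \<le> inverse a" if "a < b" for a b :: ennreal
    using that by (cases a; cases b; cases "a = 0")
      (auto simp: inverse_ennreal ennreal_less_iff ennreal_less_zero_iff intro!: ennreal_leI)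
  have "liminf q \<le> 1"
  proof (rule ccontr)
    assume "\<not> liminf q \<le> 1"
    then obtain c where c: "1 < c" "c < liminf q" using dense by (auto simp: not_le)
    have "\<forall>\<^sub>F n in sequentially. c < q n" using less_LiminfD[OF c(2)] .
    then have "\<forall>\<^sub>F n in sequentially. inverse (q n) \<le> inverse c"
      by eventually_elim (simp add: antimono)
    then have "liminf (\<lambda>n. inverse (q n)) \<le> liminf (\<lambda>n. inverse c)"
      by (rule Liminf_mono)
    then have "1 \<le> inverse c" using \<open>1 \<le> liminf (\<lambda>n. inverse (q n))\<close> by (simp add: Liminf_const)
    moreover obtain x where x: "c = ennreal x" "1 < x"
      using c by (cases c) (auto simp: ennreal_1[symmetric] ennreal_less_iff simp del: ennreal_1)
    ultimately have "ennreal 1 \<le> ennreal (inverse x)" by (simp add: inverse_ennreal)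
    then show False using x(2) by (simp add: ennreal_le_iff field_simps del: ennreal_1)
  qed
  then have "liminf q * emeasure N (U \<inter> ?S) \<le> 1 * emeasure N (U \<inter> ?S)"
    by (rule mult_right_mono) simp
  with rotation_invariant_sphere_ratio[OF M N e U] show ?thesis
    by (simp add: q_def g_def h_def)
qed

lemma rotation_invariant_sphere_unique:
  fixes M N :: "(real^'n) measure"
  assumes M: "rotation_invariant_sphere M" and N: "rotation_invariant_sphere N"
  shows "M = N"
proof -
  let ?S = "sphere (0::real^'n) 1"
  let ?E = "(\<lambda>U. U \<inter> ?S) ` {U. open U}"
  note RM = rotation_invariant_sphereD[OF M] and RN = rotation_invariant_sphereD[OF N]
  have *: "sets (restrict_space borel ?S) = sigma_sets ?S ?E"
  proof -
    have b: "sets borel = sigma_sets UNIV {U :: (real^'n) set. open U}"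
      unfolding borel_def by (rule sets_measure_of) simp
    have "?S \<in> sigma_sets UNIV {U. open U}" unfolding b[symmetric] by (intro borel_closed closed_sphere)
    then have "(\<inter>) ?S ` sigma_sets UNIV {U. open U} = sigma_sets ?S ((\<inter>) ?S ` {U. open U})"
      by (rule sigma_sets_Int) simp
    moreover have "(\<inter>) ?S ` {U. open U} = ?E" by (rule image_cong) (rule refl, rule Int_commute)
    ultimately show ?thesis unfolding sets_restrict_space b by simp
  qed
  show ?thesis
  proof (rule measure_eqI_generator_eq[where \<Omega> = ?S and E = ?E and A = "\<lambda>i. ?S"])
    show "Int_stable ?E"
    proof (rule Int_stableI)
      fix A B assume "A \<in> ?E" "B \<in> ?E"
      then obtain U V where "open U" "open V" "A = U \<inter> ?S" "B = V \<inter> ?S" by (elim imageE) simp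
      then have "A \<inter> B = (U \<inter> V) \<inter> ?S" "open (U \<inter> V)" by auto
      then show "A \<inter> B \<in> ?E" by (intro image_eqI[of _ _ "U \<inter> V"]) auto
    qed
    show "?E \<subseteq> Pow ?S" by auto
    show "sets M = sigma_sets ?S ?E" "sets N = sigma_sets ?S ?E" by (rule RM(2)[unfolded *], rule RN(2)[unfolded *])
    show "emeasure M X = emeasure N X" if "X \<in> ?E" for X
    proof -
      obtain U where U: "open U" "X = U \<inter> ?S" using \<open>X \<in> ?E\<close> by (elim imageE) simp
      show ?thesis unfolding U(2)
        by (rule antisym[OF rotation_invariant_sphere_le[OF M N U(1)] rotation_invariant_sphere_le[OF N M U(1)]])
    qed
    have "?S = UNIV \<inter> ?S" by simp
    then have "?S \<in> ?E" by (rule image_eqI) simp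
    then show "range (\<lambda>i::nat. ?S) \<subseteq> ?E" by (simp add: image_constant_conv)
    show "(\<Union>i::nat. ?S) = ?S" by auto
    show "emeasure M ?S \<noteq> \<infinity>" for i :: nat
      using prob_space.emeasure_space_1[OF RM(1)] unfolding RM(3) by simp
  qed
qed

lemma rotation_invariant_sphere_iff:
  "rotation_invariant_sphere (M :: (real^'n::{finite,wellorder}) measure) \<longleftrightarrow> M = sphere_measure"
proof -
  obtain N :: "(real^'n::_) measure" where N: "rotation_invariant_sphere N"
    using rotation_invariant_sphere_exists by blast
  then have "sphere_measure = N"
    unfolding sphere_measure_def by (rule the_equality) (rule rotation_invariant_sphere_unique[OF _ N])
  then show ?thesis using N rotation_invariant_sphere_unique[OF _ N, of M] by blast
qed

definition quad_mean :: "real^'n^'n \<Rightarrow> real" where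
  "quad_mean B = (\<integral>\<xi>. \<bar>\<xi> \<bullet> (B *v \<xi>)\<bar> \<partial>sphere_measure)"

definition pos_semidef :: "real^'n^'n \<Rightarrow> bool" where
  "pos_semidef P \<longleftrightarrow> transpose P = P \<and> (\<forall>x. 0 \<le> x \<bullet> (P *v x))"

(* the unique positive semidefinite square root of (transpose B) B *)
definition matrix_abs :: "real^'n^'n \<Rightarrow> real^'n^'n" where
  "matrix_abs B = (THE P. pos_semidef P \<and> P ** P = transpose B ** B)"

definition admissible :: "real^'n^'n \<Rightarrow> bool" where
  "admissible B \<longleftrightarrow> transpose B = B \<and> trace (matrix_abs B) = real CARD('n)"

(* LEAST is the minimum of the set of values; that it is attained is part of the theorem. *)
definition vartheta :: "'n::finite itself \<Rightarrow> real" where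
  "vartheta _ = 1 / (LEAST r. \<exists>B::real^'n^'n. admissible B \<and> r = quad_mean B)"

(* The rows and columns are numbered along the linear order of the index type, so
   card {k. k < i} is the 0-based position of i. Only used for s + t = CARD('n). *)
definition J_matrix :: "nat \<Rightarrow> nat \<Rightarrow> real \<Rightarrow> real \<Rightarrow> real^'n::{finite,linorder}^'n::_" where
  "J_matrix s t a b = (\<chi> i j.
     if i \<noteq> j then 0
     else if card {k. k < i} < s then a
     else if card {k. k < i} < s + t then - b
     else 0)"

definition incomplete_Beta :: "real \<Rightarrow> real \<Rightarrow> real \<Rightarrow> real" where
  "incomplete_Beta p \<alpha> \<beta> = integral {0..p} (\<lambda>x. x powr (\<alpha> - 1) * (1 - x) powr (\<beta> - 1))"

definition regularized_Beta :: "real \<Rightarrow> real \<Rightarrow> real \<Rightarrow> real" where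
  "regularized_Beta p \<alpha> \<beta> = incomplete_Beta p \<alpha> \<beta> / incomplete_Beta 1 \<alpha> \<beta>"

lemma incomplete_Beta_1:
  assumes "\<alpha> > 0" "\<beta> > 0"
  shows "incomplete_Beta 1 \<alpha> \<beta> = Beta \<alpha> \<beta>"
  unfolding incomplete_Beta_def using has_integral_Beta_real[OF assms] by (rule integral_unique)

end

theory Submission
  imports Defs
begin

text \<open>
Let \<open>B\<close> be symmetric with eigenvalues \<open>c i\<close>. Rotation invariance makes \<open>quad_mean B\<close> the mean of
\<open>\<bar>\<Sum>i. c i * (\<xi> $ i)\<^sup>2\<bar>\<close> over the sphere, and the trace of the absolute value is \<open>\<Sum>i. \<bar>c i\<bar>\<close>. Suppose that \<open>s\<close>
eigenvalues, indexed by \<open>S\<close>, are nonnegative and the other \<open>t\<close> are negative, and put \<open>\<alpha> = s / 2\<close>, \<open>\<beta> = t / 2\<close>.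
The sum \<open>X\<close> of the squares of the coordinates in \<open>S\<close> has a beta distribution on the sphere. Test the
quadratic form against the sign \<open>g\<close> of \<open>X - p\<close>. The mean of \<open>g * (\<xi> $ i)\<^sup>2\<close> is
\<open>(1 - 2 * regularized_Beta p (\<alpha> + 1) \<beta>) / d\<close> for \<open>i \<in> S\<close> and \<open>(1 - 2 * regularized_Beta p \<alpha> (\<beta> + 1)) / d\<close> otherwise
(\<open>integral_cone_sign_in\<close>, \<open>integral_cone_sign_out\<close>). Exactly one \<open>p\<close>, the equipoint, makes these two numbers
opposite, say \<open>V / d\<close> and \<open>- V / d\<close> with \<open>V = equi_value \<alpha> \<beta>\<close>. Since \<open>\<bar>q\<bar> \<ge> g * q\<close>, the mean is at least
\<open>V / d * (\<Sum>i. \<bar>c i\<bar>)\<close>, which is \<open>V\<close> for admissible \<open>B\<close> (\<open>diag_mean_ge_mixed\<close>); and equality holds when the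
eigenvalues are \<open>a\<close> and \<open>- b\<close> with \<open>b / (a + b) = p\<close> (\<open>diag_mean_two_values\<close>). Semidefinite matrices give the
value \<open>1\<close>, and \<open>V \<le> 1\<close>. So the minimum is the least \<open>equi_value (s / 2) (t / 2)\<close> with \<open>s + t = d\<close>, and the
theorem says that the most balanced splitting is the best one.

To compare these values, write \<open>n = \<alpha> + \<beta>\<close>. The contiguity relations of the beta function turn \<open>V\<close> into the
generalized binomial weight \<open>Gamma (n + 1) / (Gamma (\<alpha> + 1) * Gamma (\<beta> + 1)) * p powr \<alpha> * (1 - p) powr \<beta>\<close> at the
equipoint \<open>p\<close>. For \<open>\<alpha> \<ge> \<beta>\<close> the equipoint lies between the mean \<open>(\<alpha> + 1/2) / (n + 1)\<close> of a certain density, of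
which it is the median, and the mode \<open>\<alpha> / n\<close> of the weight (\<open>mean_le_equipoint\<close>, \<open>equipoint_le_mode\<close>). Both bounds
come from a single criterion comparing mean and median (\<open>center_below_median\<close>), for the mode after a change
of variables that turns it into a mean. Thus \<open>V\<close> is at most the weight at the mode and at least the weight
at the mean, and these bounds are sharp enough: if the parameters move by whole units, the Gamma factors
cancel up to a rational factor, and \<open>equi_value \<alpha> \<beta> \<le> equi_value (\<alpha> + 1) (\<beta> - 1)\<close> becomes an elementary
inequality for \<open>\<beta> \<le> \<alpha> + 1/2\<close> (\<open>equi_value_step\<close>). Together with the symmetry of \<open>V\<close> this leads from every
splitting to one with \<open>s - t\<close> equal to \<open>0\<close>, \<open>1\<close> or \<open>2\<close>. The difference \<open>2\<close> occurs for even \<open>d\<close> and is compared with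
\<open>s = t\<close> by a half step, where log-convexity of Gamma controls the Gamma factors
(\<open>equi_value_central_step\<close>). For \<open>s = t\<close> the equipoint is \<open>1/2\<close> by symmetry, which gives the closed form.
\<close>

section \<open>The incomplete beta function\<close>

lemma incomplete_Beta_0 [simp]: "incomplete_Beta 0 \<alpha> \<beta> = 0"
  by (simp add: incomplete_Beta_def)

lemma Beta_integrand_integrable:
  fixes \<alpha> \<beta> :: real
  assumes "\<alpha> > 0" "\<beta> > 0"
  shows "(\<lambda>x. x powr (\<alpha> - 1) * (1 - x) powr (\<beta> - 1)) integrable_on {0..1}"
  using has_integral_Beta_real[OF assms] by (rule has_integral_integrable)

lemma continuous_on_incomplete_Beta:
  assumes "\<alpha> > 0" "\<beta> > 0"
  shows "continuous_on {0..1} (\<lambda>p. incomplete_Beta p \<alpha> \<beta>)"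
  unfolding incomplete_Beta_def
  by (rule indefinite_integral_continuous_1[OF Beta_integrand_integrable[OF assms]])

lemma has_real_derivative_incomplete_Beta:
  assumes "\<alpha> > 0" "\<beta> > 0" "0 < p" "p < 1"
  shows "((\<lambda>p. incomplete_Beta p \<alpha> \<beta>) has_real_derivative p powr (\<alpha> - 1) * (1 - p) powr (\<beta> - 1)) (at p)"
proof -
  let ?f = "\<lambda>x. x powr (\<alpha> - 1) * (1 - x) powr (\<beta> - 1)"
  have "isCont ?f p"
    using assms by (intro continuous_intros) auto
  then have "continuous (at p within {0..1} - {}) ?f"
    by (rule continuous_at_imp_continuous_at_within)
  from integral_has_vector_derivative_continuous_at[OF Beta_integrand_integrable[OF assms(1,2)] _ _ this]
  have "((\<lambda>p. incomplete_Beta p \<alpha> \<beta>) has_vector_derivative ?f p) (at p within {0..1})"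
    using assms by (simp add: incomplete_Beta_def)
  moreover have "at p within {0..1} = at p"
    using assms by (intro at_within_interior) (simp add: interior_atLeastAtMost_real)
  ultimately show ?thesis by (simp add: has_real_derivative_iff_has_vector_derivative)
qed

lemma eq_if_same_derivative:
  fixes f g :: "real \<Rightarrow> real"
  assumes "continuous_on {a..b} f" "continuous_on {a..b} g"
    and "\<And>x. a < x \<Longrightarrow> x < b \<Longrightarrow> (f has_real_derivative f' x) (at x)"
    and "\<And>x. a < x \<Longrightarrow> x < b \<Longrightarrow> (g has_real_derivative f' x) (at x)"
    and "f a = g a" "x \<in> {a..b}"
  shows "f x = g x"
proof (cases "a = b")
  case False
  have "continuous_on {a..b} (\<lambda>x. f x - g x)"
    using assms by (intro continuous_intros)
  moreover have "((\<lambda>x. f x - g x) has_real_derivative 0) (at y)" if "a < y" "y < b" for y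
    using DERIV_diff[OF assms(3,4)[OF that]] by simp
  ultimately have "f x - g x = f a - g a"
    using False assms(6) DERIV_isconst2[of a b "\<lambda>x. f x - g x" x] by simp
  with assms(5) show ?thesis by simp
qed (use assms in auto)

lemma continuous_on_powr_times:
  assumes "\<alpha> > 0" "\<beta> > 0"
  shows "continuous_on {0..1} (\<lambda>x::real. x powr \<alpha> * (1 - x) powr \<beta>)"
  using assms by (intro continuous_on_mult continuous_on_powr' continuous_intros) auto

lemma has_real_derivative_powr_times:
  assumes "0 < x" "x < (1::real)"
  shows "((\<lambda>x. x powr \<alpha> * (1 - x) powr \<beta>) has_real_derivative
           x powr (\<alpha> - 1) * (1 - x) powr (\<beta> - 1) * (\<alpha> - (\<alpha> + \<beta>) * x)) (at x)"
proof -
  have eqs: "x powr \<alpha> = x * x powr (\<alpha> - 1)" "(1 - x) powr \<beta> = (1 - x) * (1 - x) powr (\<beta> - 1)"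
    using assms by (simp_all add: powr_diff)
  show ?thesis
    using assms by (auto intro!: derivative_eq_intros simp: eqs algebra_simps)
qed

lemma incomplete_Beta_sub:
  assumes "\<alpha> > 0" "\<beta> > 0" "p \<in> {0..1}"
  shows "\<alpha> * incomplete_Beta p \<alpha> (\<beta> + 1) - \<beta> * incomplete_Beta p (\<alpha> + 1) \<beta> = p powr \<alpha> * (1 - p) powr \<beta>"
proof (rule eq_if_same_derivative[where a = 0 and b = 1 and x = p and g = "\<lambda>p. p powr \<alpha> * (1 - p) powr \<beta>"
      and f = "\<lambda>p. \<alpha> * incomplete_Beta p \<alpha> (\<beta> + 1) - \<beta> * incomplete_Beta p (\<alpha> + 1) \<beta>"])
  fix x :: real assume x: "0 < x" "x < 1"
  have eqs: "x powr \<alpha> = x * x powr (\<alpha> - 1)" "(1 - x) powr \<beta> = (1 - x) * (1 - x) powr (\<beta> - 1)"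
    using x by (simp_all add: powr_diff)
  show "((\<lambda>p. \<alpha> * incomplete_Beta p \<alpha> (\<beta> + 1) - \<beta> * incomplete_Beta p (\<alpha> + 1) \<beta>) has_real_derivative
     x powr (\<alpha> - 1) * (1 - x) powr (\<beta> - 1) * (\<alpha> - (\<alpha> + \<beta>) * x)) (at x)"
    using assms x by (auto intro!: derivative_eq_intros has_real_derivative_incomplete_Beta simp: eqs algebra_simps)
qed (use assms has_real_derivative_powr_times in \<open>auto intro!: continuous_intros continuous_on_incomplete_Beta continuous_on_powr_times\<close>)

lemma incomplete_Beta_add:
  assumes "\<alpha> > 0" "\<beta> > 0" "p \<in> {0..1}"
  shows "incomplete_Beta p \<alpha> (\<beta> + 1) + incomplete_Beta p (\<alpha> + 1) \<beta> = incomplete_Beta p \<alpha> \<beta>"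
proof (rule eq_if_same_derivative[where a = 0 and b = 1 and x = p and g = "\<lambda>p. incomplete_Beta p \<alpha> \<beta>"
      and f = "\<lambda>p. incomplete_Beta p \<alpha> (\<beta> + 1) + incomplete_Beta p (\<alpha> + 1) \<beta>"])
  fix x :: real assume x: "0 < x" "x < 1"
  have eqs: "x powr \<alpha> = x * x powr (\<alpha> - 1)" "(1 - x) powr \<beta> = (1 - x) * (1 - x) powr (\<beta> - 1)"
    using x by (simp_all add: powr_diff)
  show "((\<lambda>p. incomplete_Beta p \<alpha> (\<beta> + 1) + incomplete_Beta p (\<alpha> + 1) \<beta>) has_real_derivative
     x powr (\<alpha> - 1) * (1 - x) powr (\<beta> - 1)) (at x)"
    using assms x by (auto intro!: derivative_eq_intros has_real_derivative_incomplete_Beta simp: eqs algebra_simps)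
qed (use assms has_real_derivative_incomplete_Beta in \<open>auto intro!: continuous_intros continuous_on_incomplete_Beta\<close>)

lemma incomplete_Beta_reflect:
  assumes "\<alpha> > 0" "\<beta> > 0" "p \<in> {0..1}"
  shows "incomplete_Beta p \<alpha> \<beta> = Beta \<alpha> \<beta> - incomplete_Beta (1 - p) \<beta> \<alpha>"
proof (rule eq_if_same_derivative[where a = 0 and b = 1 and x = p and f = "\<lambda>p. incomplete_Beta p \<alpha> \<beta>"
      and g = "\<lambda>p. Beta \<alpha> \<beta> - incomplete_Beta (1 - p) \<beta> \<alpha>"])
  show "continuous_on {0..1} (\<lambda>p. Beta \<alpha> \<beta> - incomplete_Beta (1 - p) \<beta> \<alpha>)"
    by (intro continuous_intros continuous_on_compose2[OF continuous_on_incomplete_Beta[OF assms(2,1)]]) auto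
  fix x :: real assume x: "0 < x" "x < 1"
  show "((\<lambda>p. Beta \<alpha> \<beta> - incomplete_Beta (1 - p) \<beta> \<alpha>) has_real_derivative
     x powr (\<alpha> - 1) * (1 - x) powr (\<beta> - 1)) (at x)"
    using assms x has_real_derivative_incomplete_Beta[of \<beta> \<alpha> "1 - x"]
    by (auto intro!: derivative_eq_intros DERIV_chain2[where g = "\<lambda>p. 1 - p" and f = "\<lambda>p. incomplete_Beta p \<beta> \<alpha>"] simp: algebra_simps)
qed (use assms has_real_derivative_incomplete_Beta in \<open>auto intro!: continuous_intros continuous_on_incomplete_Beta
   simp: incomplete_Beta_1 Beta_commute\<close>)

section \<open>Mean and median\<close>

text \<open>Let \<open>\<rho>\<close> be a density with primitive \<open>R\<close>. As \<open>h\<close> is the primitive of \<open>(c - x) * \<rho> x\<close> that vanishes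
at \<open>0\<close>, the condition \<open>h 1 = 0\<close> says that \<open>c\<close> is the mean of \<open>\<rho>\<close>. Writing \<open>\<rho>\<close> as \<open>h' / (c - x)\<close> and
integrating by parts on both sides of \<open>c\<close>, the mass above \<open>c\<close> minus the mass below \<open>c\<close> becomes the
integral of \<open>(h (c - z) - h (c + z)) / z\<^sup>2\<close>, up to a contribution of the longer left tail that has the
favourable sign. So the mean is at most the median as soon as \<open>h\<close> is larger on the left of \<open>c\<close> than
on the right. Only derivatives of \<open>R\<close> are used, because the densities of interest may be unbounded at
the end points.\<close>

lemma center_below_median:
  fixes R h \<rho> :: "real \<Rightarrow> real"
  assumes c: "1/2 \<le> c" "c < 1"
    and R: "continuous_on {0..1} R" and h: "continuous_on {0..1} h"
    and R': "\<And>x. 0 < x \<Longrightarrow> x < 1 \<Longrightarrow> (R has_real_derivative \<rho> x) (at x)"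
    and h': "\<And>x. 0 < x \<Longrightarrow> x < 1 \<Longrightarrow> (h has_real_derivative (c - x) * \<rho> x) (at x)"
    and \<rho>: "\<And>x. 0 < x \<Longrightarrow> x < 1 \<Longrightarrow> 0 \<le> \<rho> x"
    and h01: "h 0 = 0" "h 1 = 0"
    and sym: "\<And>z. 0 < z \<Longrightarrow> z < 1 - c \<Longrightarrow> h (c + z) \<le> h (c - z)"
  shows "R c - R 0 \<le> R 1 - R c"
proof -
  \<comment> \<open>The mass in \<open>[c, c + z]\<close> minus the mass in \<open>[c - z, c]\<close>, plus the boundary term of the
  integration by parts; its derivative is the integrand named above.\<close>
  define \<Psi> where "\<Psi> = (\<lambda>z. R (c + z) + R (c - z) - 2 * R c + (h (c + z) - h (c - z)) / z)"
  have d\<Psi>: "\<exists>y. (\<Psi> has_real_derivative y) (at z) \<and> 0 \<le> y" if z: "0 < z" "z < 1 - c" for z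
  proof (intro exI conjI)
    have [simp]: "z < c" "0 < c + z" "c + z < 1" "0 < c - z" "c - z < 1" using c z by linarith+
    have 1: "((\<lambda>z. R (c + z)) has_real_derivative \<rho> (c + z)) (at z)"
      by (rule DERIV_cong[OF DERIV_chain2[OF R']]) (auto intro!: derivative_eq_intros)
    have 2: "((\<lambda>z. R (c - z)) has_real_derivative - \<rho> (c - z)) (at z)"
      by (rule DERIV_cong[OF DERIV_chain2[OF R']]) (auto intro!: derivative_eq_intros)
    have 3: "((\<lambda>z. h (c + z)) has_real_derivative - z * \<rho> (c + z)) (at z)"
      by (rule DERIV_cong[OF DERIV_chain2[OF h']]) (auto intro!: derivative_eq_intros)
    have 4: "((\<lambda>z. h (c - z)) has_real_derivative - z * \<rho> (c - z)) (at z)"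
      by (rule DERIV_cong[OF DERIV_chain2[OF h']]) (auto intro!: derivative_eq_intros)
    show "(\<Psi> has_real_derivative (h (c - z) - h (c + z)) / z\<^sup>2) (at z)"
      unfolding \<Psi>_def using z
      by (intro DERIV_cong[OF DERIV_add[OF DERIV_diff[OF DERIV_add[OF 1 2] DERIV_const]
            DERIV_divide[OF DERIV_diff[OF 3 4] DERIV_ident]]]) (auto simp: field_simps power2_eq_square)
    show "0 \<le> (h (c - z) - h (c + z)) / z\<^sup>2" using sym[OF z] by simp
  qed
  have le: "\<Psi> z \<le> \<Psi> (1 - c)" if z: "0 < z" "z < 1 - c" for z
  proof (rule DERIV_nonneg_imp_increasing_open[where f = \<Psi> and a = z and b = "1 - c"])
    show "continuous_on {z..1 - c} \<Psi>"
      unfolding \<Psi>_def using z c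
      by (intro continuous_intros continuous_on_compose2[OF R] continuous_on_compose2[OF h]) auto
  qed (use z d\<Psi> in auto)
  have "(\<Psi> \<longlongrightarrow> R c + R c - 2 * R c + (0 + 0)) (at_right 0)"
  proof -
    have "isCont R c" using R'[of c] c by (auto intro: DERIV_isCont)
    then have R1: "((\<lambda>z. R (c + z)) \<longlongrightarrow> R c) (at_right 0)" "((\<lambda>z. R (c - z)) \<longlongrightarrow> R c) (at_right 0)"
      by (auto intro!: isCont_tendsto_compose[of c R] tendsto_eq_intros)
    have "((\<lambda>z. (h (c + z) - h c) / z) \<longlongrightarrow> 0) (at 0)"
      using h'[of c] c by (simp add: DERIV_def)
    then have h1: "((\<lambda>z. (h (c + z) - h c) / z) \<longlongrightarrow> 0) (at_right 0)"
      by (rule filterlim_mono) (auto simp: at_le)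
    have "((\<lambda>z. h (c - z)) has_real_derivative 0) (at 0)"
    proof -
      have "(h has_real_derivative 0) (at (c - 0))" using h'[of c] c by simp
      moreover have "((\<lambda>z. c - z) has_real_derivative - 1) (at 0)" by (auto intro!: derivative_eq_intros)
      ultimately show ?thesis using DERIV_chain2[of h 0 "\<lambda>z. c - z" 0 "-1" UNIV] by simp
    qed
    then have "((\<lambda>z. (h (c - z) - h c) / z) \<longlongrightarrow> 0) (at 0)"
      by (simp add: DERIV_def)
    then have "((\<lambda>z. (h (c - z) - h c) / z) \<longlongrightarrow> 0) (at_right 0)"
      by (rule filterlim_mono) (auto simp: at_le)
    from tendsto_diff[OF h1 this]
    have h2: "((\<lambda>z. (h (c + z) - h (c - z)) / z) \<longlongrightarrow> 0 + 0) (at_right 0)"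
      by (simp add: diff_divide_distrib)
    show ?thesis unfolding \<Psi>_def by (intro tendsto_add tendsto_diff tendsto_const R1 h2)
  qed
  then have lim: "(\<Psi> \<longlongrightarrow> 0) (at_right 0)" by simp
  have "eventually (\<lambda>z. \<Psi> z \<le> \<Psi> (1 - c)) (at_right 0)"
    unfolding eventually_at_right_field using c le by (auto intro!: exI[of _ "1 - c"])
  then have "0 \<le> \<Psi> (1 - c)"
    by (rule tendsto_upperbound[OF lim]) simp
  then have a: "h (2 * c - 1) / (1 - c) \<le> R 1 + R (2 * c - 1) - 2 * R c"
    by (simp add: \<Psi>_def h01 field_simps)
  \<comment> \<open>The left tail \<open>[0, 2 * c - 1]\<close> has no mirror image in the unit interval; on it \<open>c - x\<close> is at
  least \<open>1 - c\<close>.\<close>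
  have "h 0 - (1 - c) * R 0 \<le> h (2 * c - 1) - (1 - c) * R (2 * c - 1)"
  proof (rule DERIV_nonneg_imp_increasing_open[where f = "\<lambda>x. h x - (1 - c) * R x"])
    show "continuous_on {0..2 * c - 1} (\<lambda>x. h x - (1 - c) * R x)"
      using c by (intro continuous_intros continuous_on_subset[OF R] continuous_on_subset[OF h]) auto
    show "\<exists>y. ((\<lambda>x. h x - (1 - c) * R x) has_real_derivative y) (at x) \<and> 0 \<le> y"
      if "0 < x" "x < 2 * c - 1" for x
    proof -
      have x: "0 < x" "x < 1" using that c by auto
      have "0 \<le> (2 * c - 1 - x) * \<rho> x" using that \<rho>[OF x] by simp
      moreover have "((\<lambda>x. h x - (1 - c) * R x) has_real_derivative (2 * c - 1 - x) * \<rho> x) (at x)"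
        by (rule DERIV_cong[OF DERIV_diff[OF h'[OF x] DERIV_cmult[OF R'[OF x]]]]) (simp add: algebra_simps)
      ultimately show ?thesis by blast
    qed
  qed (use c in auto)
  then have "R (2 * c - 1) - R 0 \<le> h (2 * c - 1) / (1 - c)"
    using c by (simp add: field_simps h01)
  with a show ?thesis by linarith
qed

section \<open>Equipoints\<close>

definition gen_binomial :: "real \<Rightarrow> real \<Rightarrow> real" where
  "gen_binomial \<alpha> \<beta> = Gamma (\<alpha> + \<beta> + 1) / (Gamma (\<alpha> + 1) * Gamma (\<beta> + 1))"

text \<open>For natural numbers this is the probability of \<open>\<alpha>\<close> successes in \<open>\<alpha> + \<beta>\<close> independent trials with success
probability \<open>p\<close>.\<close>

definition binomial_weight :: "real \<Rightarrow> real \<Rightarrow> real \<Rightarrow> real" where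
  "binomial_weight \<alpha> \<beta> p = gen_binomial \<alpha> \<beta> * (p powr \<alpha> * (1 - p) powr \<beta>)"

text \<open>For natural numbers \<open>\<alpha>\<close>, \<open>\<beta>\<close> and a binomial variable with parameters \<open>\<alpha> + \<beta>\<close> and \<open>p\<close>, the two summands
are the probabilities of more than \<open>\<alpha>\<close> and of at least \<open>\<alpha>\<close> successes. Their sum is \<open>1\<close> at the \<open>p\<close> for which
more than \<open>\<alpha>\<close> and fewer than \<open>\<alpha>\<close> successes are equally likely; this \<open>p\<close> is called the equipoint.\<close>

definition Beta_pair :: "real \<Rightarrow> real \<Rightarrow> real \<Rightarrow> real" where
  "Beta_pair \<alpha> \<beta> p = regularized_Beta p (\<alpha> + 1) \<beta> + regularized_Beta p \<alpha> (\<beta> + 1)"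

definition equipoint :: "real \<Rightarrow> real \<Rightarrow> real" where
  "equipoint \<alpha> \<beta> = (THE p. p \<in> {0..1} \<and> Beta_pair \<alpha> \<beta> p = 1)"

definition equi_value :: "real \<Rightarrow> real \<Rightarrow> real" where
  "equi_value \<alpha> \<beta> = binomial_weight \<alpha> \<beta> (equipoint \<alpha> \<beta>)"

lemma gen_binomial_pos: "\<alpha> > 0 \<Longrightarrow> \<beta> > 0 \<Longrightarrow> gen_binomial \<alpha> \<beta> > 0"
  by (simp add: gen_binomial_def Gamma_real_pos)

lemma gen_binomial_commute: "gen_binomial \<alpha> \<beta> = gen_binomial \<beta> \<alpha>"
  by (simp add: gen_binomial_def add.commute mult.commute)

lemma regularized_Beta_left:
  assumes "\<alpha> > 0" "\<beta> > 0"
  shows "regularized_Beta p (\<alpha> + 1) \<beta> = \<beta> * gen_binomial \<alpha> \<beta> * incomplete_Beta p (\<alpha> + 1) \<beta>"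
proof -
  have "Gamma (\<beta> + 1) = \<beta> * Gamma \<beta>" 
    using assms by (intro Gamma_plus1) (auto dest: nonpos_Ints_nonpos)
  moreover have "Gamma (\<alpha> + 1) > 0" "Gamma \<beta> > 0" "Gamma (\<alpha> + \<beta> + 1) > 0"
    using assms by (auto intro!: Gamma_real_pos)
  ultimately show ?thesis
    using assms by (simp add: regularized_Beta_def incomplete_Beta_1 Beta_def gen_binomial_def add_ac field_simps)
qed

lemma regularized_Beta_right:
  assumes "\<alpha> > 0" "\<beta> > 0"
  shows "regularized_Beta p \<alpha> (\<beta> + 1) = \<alpha> * gen_binomial \<alpha> \<beta> * incomplete_Beta p \<alpha> (\<beta> + 1)"
proof -
  have "Gamma (\<alpha> + 1) = \<alpha> * Gamma \<alpha>" 
    using assms by (intro Gamma_plus1) (auto dest: nonpos_Ints_nonpos)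
  moreover have "Gamma (\<beta> + 1) > 0" "Gamma \<alpha> > 0" "Gamma (\<alpha> + \<beta> + 1) > 0"
    using assms by (auto intro!: Gamma_real_pos)
  ultimately show ?thesis
    using assms by (simp add: regularized_Beta_def incomplete_Beta_1 Beta_def gen_binomial_def add_ac field_simps)
qed

text \<open>The two neighbours of \<open>regularized_Beta p \<alpha> \<beta>\<close> differ by one binomial weight. This is what turns the
value at the equipoint, an integral, into an explicit expression.\<close>

lemma regularized_Beta_diff:
  assumes "\<alpha> > 0" "\<beta> > 0" "p \<in> {0..1}"
  shows "regularized_Beta p \<alpha> (\<beta> + 1) - regularized_Beta p (\<alpha> + 1) \<beta> = binomial_weight \<alpha> \<beta> p"
  unfolding regularized_Beta_left[OF assms(1,2)] regularized_Beta_right[OF assms(1,2)] binomial_weight_def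
    incomplete_Beta_sub[OF assms, symmetric]
  by (simp add: algebra_simps)

lemma regularized_Beta_0 [simp]: "regularized_Beta 0 \<alpha> \<beta> = 0"
  by (simp add: regularized_Beta_def)

lemma Beta_real_pos: "\<alpha> > 0 \<Longrightarrow> \<beta> > 0 \<Longrightarrow> Beta \<alpha> \<beta> > (0::real)"
  by (simp add: Beta_def Gamma_real_pos)

lemma regularized_Beta_1:
  assumes "\<alpha> > 0" "\<beta> > 0"
  shows "regularized_Beta 1 \<alpha> \<beta> = 1"
  using Beta_real_pos[OF assms] assms by (simp add: regularized_Beta_def incomplete_Beta_1)

lemma regularized_Beta_reflect:
  assumes "\<alpha> > 0" "\<beta> > 0" "p \<in> {0..1}"
  shows "regularized_Beta (1 - p) \<beta> \<alpha> = 1 - regularized_Beta p \<alpha> \<beta>"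
  using incomplete_Beta_reflect[OF assms] Beta_real_pos[OF assms(1,2)] assms
  by (simp add: regularized_Beta_def incomplete_Beta_1 Beta_commute[of \<beta> \<alpha>] field_simps)

lemma incomplete_Beta_nonneg: "0 \<le> incomplete_Beta p \<alpha> \<beta>"
  unfolding incomplete_Beta_def
  by (cases "(\<lambda>x. x powr (\<alpha> - 1) * (1 - x) powr (\<beta> - 1)) integrable_on {0..p}")
    (auto intro!: integral_nonneg simp: not_integrable_integral)

lemma regularized_Beta_nonneg: "0 \<le> regularized_Beta p \<alpha> \<beta>"
  by (simp add: regularized_Beta_def incomplete_Beta_nonneg)

lemma Beta_pair_0: "Beta_pair \<alpha> \<beta> 0 = 0"
  by (simp add: Beta_pair_def)

lemma Beta_pair_1: "\<alpha> > 0 \<Longrightarrow> \<beta> > 0 \<Longrightarrow> Beta_pair \<alpha> \<beta> 1 = 2"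
  by (simp add: Beta_pair_def regularized_Beta_1)

lemma Beta_pair_reflect:
  assumes "\<alpha> > 0" "\<beta> > 0" "p \<in> {0..1}"
  shows "Beta_pair \<beta> \<alpha> (1 - p) = 2 - Beta_pair \<alpha> \<beta> p"
  using assms by (simp add: Beta_pair_def regularized_Beta_reflect)

lemma continuous_on_Beta_pair:
  assumes "\<alpha> > 0" "\<beta> > 0"
  shows "continuous_on {0..1} (Beta_pair \<alpha> \<beta>)"
  unfolding Beta_pair_def regularized_Beta_left[OF assms] regularized_Beta_right[OF assms]
  using assms by (intro continuous_intros continuous_on_incomplete_Beta) auto

definition Beta_pair_density :: "real \<Rightarrow> real \<Rightarrow> real \<Rightarrow> real" where
  "Beta_pair_density \<alpha> \<beta> x = gen_binomial \<alpha> \<beta> * (x powr (\<alpha> - 1) * (1 - x) powr (\<beta> - 1)) * (\<beta> * x + \<alpha> * (1 - x))"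

lemma has_real_derivative_Beta_pair:
  assumes "\<alpha> > 0" "\<beta> > 0" "0 < x" "x < 1"
  shows "(Beta_pair \<alpha> \<beta> has_real_derivative Beta_pair_density \<alpha> \<beta> x) (at x)"
proof -
  have eqs: "x powr \<alpha> = x * x powr (\<alpha> - 1)" "(1 - x) powr \<beta> = (1 - x) * (1 - x) powr (\<beta> - 1)"
    using assms by (simp_all add: powr_diff)
  show ?thesis
  unfolding Beta_pair_def regularized_Beta_left[OF assms(1,2)] regularized_Beta_right[OF assms(1,2)] Beta_pair_density_def
  using assms by (auto intro!: derivative_eq_intros has_real_derivative_incomplete_Beta simp: eqs algebra_simps)
qed

lemma Beta_pair_density_pos:
  assumes "\<alpha> > 0" "\<beta> > 0" "0 < x" "x < 1"
  shows "Beta_pair_density \<alpha> \<beta> x > 0"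
  unfolding Beta_pair_density_def using assms gen_binomial_pos[OF assms(1,2)]
  by (intro mult_pos_pos add_pos_pos) auto

lemma Beta_pair_strict_mono:
  assumes "\<alpha> > 0" "\<beta> > 0" "0 \<le> p" "p < q" "q \<le> 1"
  shows "Beta_pair \<alpha> \<beta> p < Beta_pair \<alpha> \<beta> q"
proof (rule DERIV_pos_imp_increasing_open[OF assms(4)])
  show "\<exists>y. (Beta_pair \<alpha> \<beta> has_real_derivative y) (at x) \<and> 0 < y" if "p < x" "x < q" for x
    using that assms by (intro exI[of _ "Beta_pair_density \<alpha> \<beta> x"])
      (auto intro!: has_real_derivative_Beta_pair Beta_pair_density_pos)
  show "continuous_on {p..q} (Beta_pair \<alpha> \<beta>)"
    using assms by (intro continuous_on_subset[OF continuous_on_Beta_pair]) auto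
qed

lemma equipoint_unique_exists:
  assumes "\<alpha> > 0" "\<beta> > 0"
  shows "\<exists>!p. p \<in> {0..1} \<and> Beta_pair \<alpha> \<beta> p = 1"
proof -
  have "\<exists>p\<ge>0. p \<le> 1 \<and> Beta_pair \<alpha> \<beta> p = 1"
    by (rule IVT') (use continuous_on_Beta_pair[OF assms] in \<open>auto simp: Beta_pair_0 Beta_pair_1[OF assms]\<close>)
  then show ?thesis
  proof (elim exE conjE, intro ex1I)
    fix p q assume "0 \<le> p" "p \<le> 1" "Beta_pair \<alpha> \<beta> p = 1" "q \<in> {0..1} \<and> Beta_pair \<alpha> \<beta> q = 1"
    then show "q = p"
      using Beta_pair_strict_mono[OF assms, of p q] Beta_pair_strict_mono[OF assms, of q p]
      by (cases p q rule: linorder_cases) auto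
  qed auto
qed

lemma equipoint_eqI:
  assumes "\<alpha> > 0" "\<beta> > 0" "p \<in> {0..1}" "Beta_pair \<alpha> \<beta> p = 1"
  shows "equipoint \<alpha> \<beta> = p"
  unfolding equipoint_def using equipoint_unique_exists[OF assms(1,2)] assms(3,4) by (intro the1_equality) auto

lemma
  assumes "\<alpha> > 0" "\<beta> > 0"
  shows equipoint_in: "0 < equipoint \<alpha> \<beta>" "equipoint \<alpha> \<beta> < 1"
    and Beta_pair_equipoint: "Beta_pair \<alpha> \<beta> (equipoint \<alpha> \<beta>) = 1"
proof -
  let ?p = "equipoint \<alpha> \<beta>"
  have *: "?p \<in> {0..1} \<and> Beta_pair \<alpha> \<beta> ?p = 1"
    unfolding equipoint_def by (rule theI'[OF equipoint_unique_exists[OF assms]])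
  then have "?p \<noteq> 0" "?p \<noteq> 1" using Beta_pair_0 Beta_pair_1[OF assms] by force+
  with * show "0 < ?p" "?p < 1" "Beta_pair \<alpha> \<beta> ?p = 1" by auto
qed

lemma equipoint_geI:
  assumes "\<alpha> > 0" "\<beta> > 0" "p \<in> {0..1}" "Beta_pair \<alpha> \<beta> p \<le> 1"
  shows "p \<le> equipoint \<alpha> \<beta>"
  using Beta_pair_strict_mono[OF assms(1,2), of "equipoint \<alpha> \<beta>" p] equipoint_in[OF assms(1,2)]
    Beta_pair_equipoint[OF assms(1,2)] assms(3,4) by force

lemma equipoint_commute:
  assumes "\<alpha> > 0" "\<beta> > 0"
  shows "equipoint \<beta> \<alpha> = 1 - equipoint \<alpha> \<beta>"
  using assms equipoint_in[OF assms] Beta_pair_equipoint[OF assms]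
  by (intro equipoint_eqI) (auto simp: Beta_pair_reflect)

lemma equi_value_commute:
  assumes "\<alpha> > 0" "\<beta> > 0"
  shows "equi_value \<beta> \<alpha> = equi_value \<alpha> \<beta>"
  unfolding equi_value_def equipoint_commute[OF assms]
  by (simp add: binomial_weight_def gen_binomial_commute[of \<beta> \<alpha>] mult_ac)

lemma
  assumes "\<alpha> > 0" "\<beta> > 0"
  shows equi_value_left: "1 - 2 * regularized_Beta (equipoint \<alpha> \<beta>) (\<alpha> + 1) \<beta> = equi_value \<alpha> \<beta>"
    and equi_value_right: "2 * regularized_Beta (equipoint \<alpha> \<beta>) \<alpha> (\<beta> + 1) - 1 = equi_value \<alpha> \<beta>"
  using regularized_Beta_diff[OF assms, of "equipoint \<alpha> \<beta>"] Beta_pair_equipoint[OF assms] equipoint_in[OF assms]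
  unfolding equi_value_def Beta_pair_def by auto

lemma equi_value_le_1: "\<alpha> > 0 \<Longrightarrow> \<beta> > 0 \<Longrightarrow> equi_value \<alpha> \<beta> \<le> 1"
  using equi_value_left[of \<alpha> \<beta>] regularized_Beta_nonneg[of "equipoint \<alpha> \<beta>" "\<alpha> + 1" \<beta>] by simp

lemma equipoint_same: "\<alpha> > 0 \<Longrightarrow> equipoint \<alpha> \<alpha> = 1 / 2"
  using equipoint_commute[of \<alpha> \<alpha>] by simp

lemma binomial_weight_mono:
  assumes "\<alpha> > 0" "\<beta> > 0" "0 \<le> p" "p \<le> q" "q \<le> \<alpha> / (\<alpha> + \<beta>)"
  shows "binomial_weight \<alpha> \<beta> p \<le> binomial_weight \<alpha> \<beta> q"
proof -
  have q1: "q \<le> 1" using assms by (intro order.trans[OF assms(5)]) (simp add: field_simps)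
  have "p powr \<alpha> * (1 - p) powr \<beta> \<le> q powr \<alpha> * (1 - q) powr \<beta>"
  proof (rule DERIV_nonneg_imp_increasing_open[OF assms(4)])
    show "continuous_on {p..q} (\<lambda>x. x powr \<alpha> * (1 - x) powr \<beta>)"
      using assms q1 by (intro continuous_on_subset[OF continuous_on_powr_times]) auto
    fix x assume x: "p < x" "x < q"
    have "x * (\<alpha> + \<beta>) \<le> q * (\<alpha> + \<beta>)" using assms x by (intro mult_right_mono) auto
    also have "\<dots> \<le> \<alpha>" using assms by (simp add: field_simps)
    finally have "0 \<le> x powr (\<alpha> - 1) * (1 - x) powr (\<beta> - 1) * (\<alpha> - (\<alpha> + \<beta>) * x)"
      by (simp add: mult.commute)
    moreover have "0 < x" "x < 1" using x assms q1 by auto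
    ultimately show "\<exists>y. ((\<lambda>x. x powr \<alpha> * (1 - x) powr \<beta>) has_real_derivative y) (at x) \<and> 0 \<le> y"
      by (blast intro: has_real_derivative_powr_times)
  qed
  then show ?thesis
    unfolding binomial_weight_def using gen_binomial_pos[OF assms(1,2)] by (intro mult_left_mono) auto
qed

text \<open>The derivative of \<open>p powr \<alpha> * (1 - p) powr \<beta>\<close> changes its sign only at \<open>\<alpha> / (\<alpha> + \<beta>)\<close>; beyond that point
the claim follows from \<open>binomial_weight_mono\<close> by exchanging \<open>\<alpha>\<close> and \<open>\<beta>\<close>.\<close>

lemma binomial_weight_max:
  assumes "\<alpha> > 0" "\<beta> > 0" "0 \<le> p" "p \<le> 1"
  shows "binomial_weight \<alpha> \<beta> p \<le> binomial_weight \<alpha> \<beta> (\<alpha> / (\<alpha> + \<beta>))"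
proof (cases "p \<le> \<alpha> / (\<alpha> + \<beta>)")
  case True
  then show ?thesis using assms by (intro binomial_weight_mono) auto
next
  case False
  have le: "binomial_weight \<beta> \<alpha> (1 - p) \<le> binomial_weight \<beta> \<alpha> (\<beta> / (\<beta> + \<alpha>))"
    using assms False by (intro binomial_weight_mono) (auto simp: field_simps)
  have eq: "1 - \<beta> / (\<beta> + \<alpha>) = \<alpha> / (\<alpha> + \<beta>)" using assms by (simp add: field_simps)
  have "binomial_weight \<beta> \<alpha> (1 - q) = binomial_weight \<alpha> \<beta> q" for q
    by (simp add: binomial_weight_def gen_binomial_commute[of \<beta> \<alpha>] mult_ac)
  from this[of p] this[of "\<alpha> / (\<alpha> + \<beta>)"] show ?thesis
    using le by (simp add: eq[symmetric])
qed

section \<open>Localization of the equipoint\<close>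

text \<open>The equipoint is the median of \<open>Beta_pair_density \<alpha> \<beta>\<close>, and \<open>\<mu> = (\<alpha> + 1/2) / (\<alpha> + \<beta> + 1)\<close> is its mean; for
\<open>\<alpha> \<ge> \<beta>\<close> the density is skewed to the left. The function \<open>h\<close> of \<open>center_below_median\<close> is here
\<open>x powr \<alpha> * (1 - x) powr \<beta>\<close> times an affine factor \<open>r\<close>, so that its exponents are positive even where the
density has a pole. Its logarithmic derivative is \<open>(\<mu> - x) * L x\<close> with an explicit rational function \<open>L\<close>,
and it suffices that \<open>L (\<mu> - x) \<le> L (\<mu> + x)\<close>. After clearing denominators this is an inequality that is
affine in \<open>x\<^sup>2\<close>, and it is checked at the two ends of the range of \<open>x\<close>.\<close>

lemma mean_le_equipoint:
  assumes "\<beta> \<ge> 1/2" "\<beta> \<le> \<alpha>"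
  shows "(\<alpha> + 1/2) / (\<alpha> + \<beta> + 1) \<le> equipoint \<alpha> \<beta>"
proof -
  define n where "n = \<alpha> + \<beta>"
  define \<kappa> where "\<kappa> = \<alpha> - \<beta>"
  define \<mu> where "\<mu> = (\<alpha> + 1/2) / (n + 1)"
  define \<nu> where "\<nu> = (\<beta> + 1/2) / (n + 1)"
  define k where "k = \<kappa> / (n + 1)"
  define r where "r = (\<lambda>x. \<mu> - k * x)"
  define K where "K = gen_binomial \<alpha> \<beta>"
  define h where "h = (\<lambda>x. K * (x powr \<alpha> * (1 - x) powr \<beta> * r x))"
  have pos: "\<alpha> > 0" "\<beta> > 0" "n > 0" "\<kappa> \<ge> 0" "K > 0" using assms by (auto simp: n_def \<kappa>_def K_def gen_binomial_pos)
  have \<mu>\<nu>: "\<mu> + \<nu> = 1"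
    unfolding \<mu>_def \<nu>_def add_divide_distrib[symmetric] using pos by (simp add: n_def)
  have "\<nu> > 0" "\<nu> \<le> \<mu>"
    unfolding \<mu>_def \<nu>_def using pos assms by (auto intro!: divide_pos_pos divide_right_mono)
  then have \<mu>: "1/2 \<le> \<mu>" "\<mu> < 1" "\<nu> > 0" "\<nu> \<le> \<mu>" using \<mu>\<nu> by auto
  have r_pos: "r x > 0" if "0 \<le> x" "x \<le> 1" for x
  proof -
    have "\<kappa> * x \<le> \<kappa>" using pos that by (intro mult_left_le) auto
    then have "0 < (\<alpha> + 1/2 - \<kappa> * x) / (n + 1)" using pos \<kappa>_def by (intro divide_pos_pos) auto
    then show ?thesis by (simp add: r_def k_def \<mu>_def diff_divide_distrib)
  qed
  have key: "(\<alpha> - n * x) * r x - k * x * (1 - x) = (\<mu> - x) * (\<alpha> - \<kappa> * x)" for x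
  proof -
    have k: "(n + 1) * k = \<kappa>" and m: "(n + 1) * \<mu> = \<alpha> + 1/2" using pos by (auto simp: k_def \<mu>_def)
    have nr: "(n + 1) * r x = (\<alpha> + 1/2) - \<kappa> * x"
      unfolding m[symmetric] k[symmetric] by (simp add: r_def right_diff_distrib)
    have "(n + 1) * ((\<alpha> - n * x) * r x - k * x * (1 - x))
        = (\<alpha> - n * x) * ((n + 1) * r x) - (n + 1) * k * x * (1 - x)"
      by (simp add: algebra_simps)
    also have "\<dots> = (\<alpha> - n * x) * ((\<alpha> + 1/2) - \<kappa> * x) - \<kappa> * x * (1 - x)"
      unfolding nr k ..
    also have "\<dots> = ((\<alpha> + 1/2) - (n + 1) * x) * (\<alpha> - \<kappa> * x)"
      unfolding n_def \<kappa>_def by (simp add: field_simps)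
    also have "\<dots> = (n + 1) * ((\<mu> - x) * (\<alpha> - \<kappa> * x))"
      unfolding m[symmetric] by (simp add: algebra_simps)
    finally show ?thesis using pos by simp
  qed
  have "Beta_pair \<alpha> \<beta> \<mu> - Beta_pair \<alpha> \<beta> 0 \<le> Beta_pair \<alpha> \<beta> 1 - Beta_pair \<alpha> \<beta> \<mu>"
  proof (rule center_below_median[where h = h and \<rho> = "Beta_pair_density \<alpha> \<beta>"])
    show "continuous_on {0..1} h"
      unfolding h_def r_def using pos by (intro continuous_intros continuous_on_powr_times) auto
    fix x :: real assume x: "0 < x" "x < 1"
    have eqs: "x powr \<alpha> = x * x powr (\<alpha> - 1)" "(1 - x) powr \<beta> = (1 - x) * (1 - x) powr (\<beta> - 1)"
      using x by (simp_all add: powr_diff)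
    have dr: "(r has_real_derivative - k) (at x)" unfolding r_def by (auto intro!: derivative_eq_intros)
    have "(h has_real_derivative K * (x powr (\<alpha> - 1) * (1 - x) powr (\<beta> - 1) *
        ((\<alpha> - n * x) * r x - k * x * (1 - x)))) (at x)"
      unfolding h_def
      by (rule DERIV_cong[OF DERIV_cmult[OF DERIV_mult[OF has_real_derivative_powr_times[OF x] dr]]])
        (simp add: eqs n_def algebra_simps)
    then show "(h has_real_derivative (\<mu> - x) * Beta_pair_density \<alpha> \<beta> x) (at x)"
      unfolding key by (rule DERIV_cong) (simp add: Beta_pair_density_def K_def \<kappa>_def algebra_simps)
  next
    fix z assume z: "0 < z" "z < 1 - \<mu>"
    define S where "S = (\<lambda>z. \<alpha> * ln (\<mu> - z) + \<beta> * ln (\<nu> + z) + ln (r (\<mu> - z))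
       - (\<alpha> * ln (\<mu> + z) + \<beta> * ln (\<nu> - z) + ln (r (\<mu> + z))))"
    have hS: "h (\<mu> - z) = K * exp (\<alpha> * ln (\<mu> - z) + \<beta> * ln (\<nu> + z) + ln (r (\<mu> - z)))"
       "h (\<mu> + z) = K * exp (\<alpha> * ln (\<mu> + z) + \<beta> * ln (\<nu> - z) + ln (r (\<mu> + z)))"
      using z \<mu> \<mu>\<nu> r_pos[of "\<mu> - z"] r_pos[of "\<mu> + z"]
      by (auto simp: h_def exp_add powr_def algebra_simps)
    have "S 0 \<le> S z"
    proof (rule DERIV_nonneg_imp_nondecreasing[of 0 z])
      fix x assume x: "0 \<le> x" "x \<le> z"
      define L where "L = (\<lambda>y. (\<alpha> - \<kappa> * y) / (y * (1 - y) * r y))"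
      have p: "0 < \<mu> - x" "0 < \<nu> - x" "0 < \<mu> + x" "0 < \<nu> + x" "0 < r (\<mu> - x)" "0 < r (\<mu> + x)"
        using x z \<mu> \<mu>\<nu> by (auto intro!: r_pos)
      have ident: "\<alpha> / y - \<beta> / (1 - y) - k / r y = (\<mu> - y) * L y"
        if "0 < y" "y < 1" for y
      proof -
        have "0 < r y" using that by (intro r_pos) auto
        then have "\<alpha> / y - \<beta> / (1 - y) - k / r y
           = ((\<alpha> - n * y) * r y - k * y * (1 - y)) / (y * (1 - y) * r y)"
          using that pos(3) by (simp add: divide_simps) (simp add: n_def algebra_simps)
        then show ?thesis by (simp add: key L_def)
      qed
      have "(S has_real_derivative - (\<alpha> / (\<mu> - x) - \<beta> / (\<nu> + x) - k / r (\<mu> - x))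
          - (\<alpha> / (\<mu> + x) - \<beta> / (\<nu> - x) - k / r (\<mu> + x))) (at x)"
      proof -
        have l: "((\<lambda>z. ln (\<mu> - z)) has_real_derivative - (1 / (\<mu> - x))) (at x)"
          "((\<lambda>z. ln (\<nu> - z)) has_real_derivative - (1 / (\<nu> - x))) (at x)"
          "((\<lambda>z. ln (\<mu> + z)) has_real_derivative 1 / (\<mu> + x)) (at x)"
          "((\<lambda>z. ln (\<nu> + z)) has_real_derivative 1 / (\<nu> + x)) (at x)"
          using p by (auto intro!: derivative_eq_intros)
        have lr: "((\<lambda>z. ln (r (\<mu> - z))) has_real_derivative k / r (\<mu> - x)) (at x)"
          "((\<lambda>z. ln (r (\<mu> + z))) has_real_derivative - (k / r (\<mu> + x))) (at x)"
          using p unfolding r_def by (auto intro!: derivative_eq_intros)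
        show ?thesis
          unfolding S_def
          by (rule DERIV_cong[OF DERIV_diff[OF DERIV_add[OF DERIV_add[OF DERIV_cmult DERIV_cmult]]
                DERIV_add[OF DERIV_add[OF DERIV_cmult DERIV_cmult]]], OF l(1) l(4) lr(1) l(3) l(2) lr(2)])
            simp
      qed
      note dS = this
      have eq: "\<nu> + x = 1 - (\<mu> - x)" "\<nu> - x = 1 - (\<mu> + x)" using \<mu>\<nu> by auto
      have i: "\<alpha> / (\<mu> - x) - \<beta> / (\<nu> + x) - k / r (\<mu> - x) = x * L (\<mu> - x)"
        "\<alpha> / (\<mu> + x) - \<beta> / (\<nu> - x) - k / r (\<mu> + x) = - x * L (\<mu> + x)"
        using ident[of "\<mu> - x", folded eq] ident[of "\<mu> + x", folded eq] p \<mu>\<nu> by simp_all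
      have dS': "(S has_real_derivative x * (L (\<mu> + x) - L (\<mu> - x))) (at x)"
        using dS unfolding i by (simp add: algebra_simps)
      have "L (\<mu> - x) \<le> L (\<mu> + x)"
      proof -
        define A where "A = \<alpha> - \<kappa> * \<mu>"
        define Q where "Q = A * (A + 1/2) - \<kappa>\<^sup>2 * x\<^sup>2"
        define P where "P = \<mu> * \<nu> - x\<^sup>2"
        define g where "g = (\<lambda>y. 2 * (A * (A + 1/2) - \<kappa>\<^sup>2 * y) - (n + 1) * (\<mu> * \<nu> - y))"
        have N1: "(n + 1) * \<mu> = \<alpha> + 1/2" "(n + 1) * \<nu> = \<beta> + 1/2" "(n + 1) * k = \<kappa>"
          using pos by (simp_all add: \<mu>_def \<nu>_def k_def)
        have "(n + 1) * (\<mu> - \<nu>) = (n + 1) * \<mu> - (n + 1) * \<nu>" by (rule right_diff_distrib)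
        then have "(n + 1) * (\<mu> - \<nu>) = \<kappa>" unfolding N1 by (simp add: \<kappa>_def)
        note N = N1(1,2) this N1(3)
        have "(n + 1) * A = (n + 1) * \<alpha> - \<kappa> * ((n + 1) * \<mu>)" by (simp add: A_def algebra_simps)
        then have NA: "(n + 1) * A = 2 * (\<alpha> * \<beta>) + n / 2"
          unfolding N by (simp add: n_def \<kappa>_def field_simps)
        have "(n + 1)\<^sup>2 * g 0 = ((n + 1) * A) * (2 * ((n + 1) * A) + (n + 1)) - (n + 1) * (((n + 1) * \<mu>) * ((n + 1) * \<nu>))"
          by (simp add: g_def power2_eq_square algebra_simps)
        also have "\<dots> = (2 * (\<alpha> * \<beta>) + n + 1/2) * (4 * (\<alpha> * \<beta>) + (n - 1) / 2)"
          unfolding NA N by (simp add: n_def field_simps)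
        also have "\<dots> \<ge> 0"
          using pos assms by (intro mult_nonneg_nonneg add_nonneg_nonneg) (auto simp: n_def)
        finally have g0: "g 0 \<ge> 0" using pos by (simp add: zero_le_mult_iff)
        have "g (\<nu>\<^sup>2) = 2 * (A - \<kappa> * \<nu>) * (A + 1/2 + \<kappa> * \<nu>) + \<kappa> * \<nu> - ((n + 1) * (\<mu> - \<nu>)) * \<nu>"
          by (simp add: g_def power2_eq_square algebra_simps)
        also have "\<dots> = 2 * (A - \<kappa> * \<nu>) * (A + 1/2 + \<kappa> * \<nu>)" unfolding N by simp
        also have "A - \<kappa> * \<nu> = \<beta>"
          proof -
          have "A - \<kappa> * \<nu> = \<alpha> - \<kappa> * (\<mu> + \<nu>)" by (simp add: A_def algebra_simps)
          then show ?thesis unfolding \<mu>\<nu> by (simp add: \<kappa>_def)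
        qed
        also have "2 * \<beta> * (A + 1/2 + \<kappa> * \<nu>) \<ge> 0"
        proof -
          have "(n + 1) * A > 0" unfolding NA using pos by (intro add_pos_pos mult_pos_pos) auto
          then have "A > 0" using pos by (simp add: zero_less_mult_iff)
          then show ?thesis using pos \<mu> by (intro mult_nonneg_nonneg add_nonneg_nonneg) auto
        qed
        finally have g1: "g (\<nu>\<^sup>2) \<ge> 0" .
        have xx: "0 \<le> x\<^sup>2" "x\<^sup>2 \<le> \<nu>\<^sup>2" using x p by (auto intro!: power_mono)
        \<comment> \<open>An affine function that is nonnegative at both ends is nonnegative.\<close>
        have "0 \<le> g (x\<^sup>2)"
        proof (cases "2 * \<kappa>\<^sup>2 \<le> n + 1")
          case True
          then have "0 \<le> (n + 1 - 2 * \<kappa>\<^sup>2) * x\<^sup>2" using xx by (intro mult_nonneg_nonneg) auto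
          moreover have "g (x\<^sup>2) = g 0 + (n + 1 - 2 * \<kappa>\<^sup>2) * x\<^sup>2" by (simp add: g_def algebra_simps)
          ultimately show ?thesis using g0 by simp
        next
          case False
          then have "0 \<le> (2 * \<kappa>\<^sup>2 - (n + 1)) * (\<nu>\<^sup>2 - x\<^sup>2)" using xx by (intro mult_nonneg_nonneg) auto
          moreover have "g (x\<^sup>2) = g (\<nu>\<^sup>2) + (2 * \<kappa>\<^sup>2 - (n + 1)) * (\<nu>\<^sup>2 - x\<^sup>2)" by (simp add: g_def algebra_simps)
          ultimately show ?thesis using g1 by simp
        qed
        then have "(n + 1) * P \<le> 2 * Q" by (simp add: g_def P_def Q_def)
        then have "P \<le> 2 * Q / (n + 1)" using pos by (simp add: pos_le_divide_eq mult.commute)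
        then have PQ: "0 \<le> \<kappa> * x * (2 * Q / (n + 1) - P)"
          using pos x by (intro mult_nonneg_nonneg) auto
        have \<delta>: "\<mu> - \<nu> = \<kappa> / (n + 1)" using N(3) pos by (simp add: field_simps)
        have nr: "(n + 1) * r (\<mu> - x) = A + 1/2 + \<kappa> * x" "(n + 1) * r (\<mu> + x) = A + 1/2 - \<kappa> * x"
        proof -
          have "(n + 1) * r (\<mu> - x) = (n + 1) * \<mu> - ((n + 1) * k) * (\<mu> - x)"
            "(n + 1) * r (\<mu> + x) = (n + 1) * \<mu> - ((n + 1) * k) * (\<mu> + x)"
            by (simp_all only: r_def right_diff_distrib mult.assoc)
          then show "(n + 1) * r (\<mu> - x) = A + 1/2 + \<kappa> * x" "(n + 1) * r (\<mu> + x) = A + 1/2 - \<kappa> * x"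
            unfolding N by (simp_all add: A_def algebra_simps)
        qed
        have "(\<alpha> - \<kappa> * (\<mu> - x)) * ((\<mu> + x) * (1 - (\<mu> + x)) * ((n + 1) * r (\<mu> + x)))
           \<le> (\<alpha> - \<kappa> * (\<mu> + x)) * ((\<mu> - x) * (1 - (\<mu> - x)) * ((n + 1) * r (\<mu> - x)))"
        proof -
          have e: "1 - (\<mu> + x) = \<nu> - x" "1 - (\<mu> - x) = \<nu> + x" "\<alpha> - \<kappa> * (\<mu> - x) = A + \<kappa> * x" "\<alpha> - \<kappa> * (\<mu> + x) = A - \<kappa> * x"
            using \<mu>\<nu> by (auto simp: A_def algebra_simps)
          have "(A - \<kappa> * x) * ((\<mu> - x) * (\<nu> + x) * (A + 1/2 + \<kappa> * x))
             - (A + \<kappa> * x) * ((\<mu> + x) * (\<nu> - x) * (A + 1/2 - \<kappa> * x))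
            = 2 * Q * x * (\<mu> - \<nu>) - \<kappa> * x * P"
            unfolding Q_def P_def by (simp add: power2_eq_square field_simps)
          also have "\<dots> = \<kappa> * x * (2 * Q / (n + 1) - P)"
            unfolding \<delta> by (simp add: field_simps)
          also note PQ
          finally show ?thesis unfolding e nr diff_ge_0_iff_ge .
        qed
        moreover have "u * (v * w * ((n + 1) * y)) = (n + 1) * (u * (v * w * y))" for u v w y :: real
          by simp
        ultimately have "(n + 1) * ((\<alpha> - \<kappa> * (\<mu> - x)) * ((\<mu> + x) * (1 - (\<mu> + x)) * r (\<mu> + x)))
           \<le> (n + 1) * ((\<alpha> - \<kappa> * (\<mu> + x)) * ((\<mu> - x) * (1 - (\<mu> - x)) * r (\<mu> - x)))"
          by (simp only:)
        then have "(\<alpha> - \<kappa> * (\<mu> - x)) * ((\<mu> + x) * (1 - (\<mu> + x)) * r (\<mu> + x))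
           \<le> (\<alpha> - \<kappa> * (\<mu> + x)) * ((\<mu> - x) * (1 - (\<mu> - x)) * r (\<mu> - x))"
          using pos(3) by (rule_tac mult_left_le_imp_le) auto
        moreover have "0 < (\<mu> + x) * (1 - (\<mu> + x)) * r (\<mu> + x)" "0 < (\<mu> - x) * (1 - (\<mu> - x)) * r (\<mu> - x)"
          using p \<mu>\<nu> by (auto intro!: mult_pos_pos)
        moreover have "u / d \<le> v / e" if "u * e \<le> v * d" "0 < e" "0 < d" for u v d e :: real
          using that by (simp add: divide_simps mult.commute)
        ultimately show ?thesis unfolding L_def by blast
      qed
      then have "0 \<le> x * (L (\<mu> + x) - L (\<mu> - x))" using x by simp
      with dS' show "\<exists>y. (S has_real_derivative y) (at x) \<and> 0 \<le> y" by blast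
    qed (use z in auto)
    then have "0 \<le> S z" using \<mu>\<nu> by (simp add: S_def algebra_simps)
    then show "h (\<mu> + z) \<le> h (\<mu> - z)" 
      unfolding hS using pos by (simp add: S_def)
  qed (use \<mu> pos in \<open>auto simp: h_def less_imp_le[OF Beta_pair_density_pos] has_real_derivative_Beta_pair continuous_on_Beta_pair\<close>)
  then have "Beta_pair \<alpha> \<beta> \<mu> \<le> 1" using pos by (simp add: Beta_pair_0 Beta_pair_1)
  then have "\<mu> \<le> equipoint \<alpha> \<beta>" using pos \<mu> by (intro equipoint_geI) auto
  then show ?thesis by (simp add: \<mu>_def n_def)
qed

text \<open>The substitution \<open>x = \<xi> y\<close> with \<open>\<xi> y = \<alpha> * y / (\<alpha> * y + \<beta> * (1 - y))\<close> multiplies the odds of \<open>y\<close> by \<open>\<alpha> / \<beta>\<close>. It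
moves the mode \<open>\<alpha> / (\<alpha> + \<beta>)\<close> of \<open>x powr \<alpha> * (1 - x) powr \<beta>\<close> to \<open>y = 1/2\<close>, and in the new coordinate \<open>1/2\<close> is the
mean of the density: the function \<open>h\<close> of \<open>center_below_median\<close> is a multiple of \<open>x powr \<alpha> * (1 - x) powr \<beta>\<close>.
The comparison of \<open>h (1/2 - z)\<close> with \<open>h (1/2 + z)\<close> then needs only \<open>\<beta> - \<alpha> \<le> \<alpha> + \<beta>\<close>.\<close>

lemma equipoint_ge_mode:
  assumes "\<alpha> > 0" "\<alpha> \<le> \<beta>"
  shows "\<alpha> / (\<alpha> + \<beta>) \<le> equipoint \<alpha> \<beta>"
proof -
  define n where "n = \<alpha> + \<beta>"
  define \<kappa> where "\<kappa> = \<beta> - \<alpha>"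
  define K where "K = gen_binomial \<alpha> \<beta>"
  define D where "D = (\<lambda>y. \<alpha> * y + \<beta> * (1 - y))"
  define \<xi> where "\<xi> = (\<lambda>y. \<alpha> * y / D y)"
  have pos: "\<alpha> > 0" "\<beta> > 0" "n > 0" "\<kappa> \<ge> 0" "K > 0" "\<kappa> \<le> n" 
    using assms by (auto simp: n_def \<kappa>_def K_def gen_binomial_pos)
  have D: "D y > 0" if "0 \<le> y" "y \<le> 1" for y
  proof -
    have "\<alpha> * (y + (1 - y)) \<le> D y" unfolding D_def ring_distribs(1) using that pos assms
      by (intro add_mono mult_right_mono) auto
    then show ?thesis using pos by simp
  qed
  have \<xi>1: "1 - \<xi> y = \<beta> * (1 - y) / D y" if "0 \<le> y" "y \<le> 1" for y
    using D[OF that] by (simp add: \<xi>_def field_simps) (simp add: D_def algebra_simps)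
  have \<xi>_in: "0 < \<xi> y" "\<xi> y < 1" if "0 < y" "y < 1" for y
  proof -
    have "0 < D y" using that D by simp
    then have "0 < \<xi> y" "0 < 1 - \<xi> y" unfolding \<xi>1[OF less_imp_le[OF that(1)] less_imp_le[OF that(2)]]
      using that pos by (simp_all add: \<xi>_def)
    then show "0 < \<xi> y" "\<xi> y < 1" by simp_all
  qed
  have \<xi>_in': "\<xi> y \<in> {0..1}" if "y \<in> {0..1}" for y
  proof -
    have y: "0 \<le> y" "y \<le> 1" using that by auto
    have "0 < D y" using y D by simp
    then have "0 \<le> \<xi> y" "0 \<le> 1 - \<xi> y" unfolding \<xi>1[OF y]
      using y pos by (simp_all add: \<xi>_def)
    then show ?thesis by simp
  qed
  have cont\<xi>: "continuous_on {0..1} \<xi>"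
    unfolding \<xi>_def using D unfolding D_def by (intro continuous_intros) force
  define \<xi>' where "\<xi>' = (\<lambda>y. \<alpha> * \<beta> / (D y)\<^sup>2)"
  have d\<xi>: "(\<xi> has_real_derivative \<xi>' y) (at y)" if "0 < y" "y < 1" for y
  proof -
    have "D y \<noteq> 0" using D[of y] that by simp
    then show ?thesis unfolding \<xi>_def \<xi>'_def D_def
      by (auto intro!: derivative_eq_intros simp: power2_eq_square divide_simps) (simp add: algebra_simps)?
  qed
  define h where "h = (\<lambda>y. K / 2 * (\<xi> y powr \<alpha> * (1 - \<xi> y) powr \<beta>))"
  have "Beta_pair \<alpha> \<beta> (\<xi> (1/2)) - Beta_pair \<alpha> \<beta> (\<xi> 0) \<le> Beta_pair \<alpha> \<beta> (\<xi> 1) - Beta_pair \<alpha> \<beta> (\<xi> (1/2))"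
  proof (rule center_below_median[where R = "\<lambda>y. Beta_pair \<alpha> \<beta> (\<xi> y)" and h = h
        and \<rho> = "\<lambda>y. Beta_pair_density \<alpha> \<beta> (\<xi> y) * \<xi>' y"])
    show "continuous_on {0..1} (\<lambda>y. Beta_pair \<alpha> \<beta> (\<xi> y))"
      using pos \<xi>_in' by (intro continuous_on_compose2[OF continuous_on_Beta_pair cont\<xi>]) auto
    show "continuous_on {0..1} h"
      unfolding h_def using \<xi>_in' pos
      by (intro continuous_on_mult_left continuous_on_compose2[OF continuous_on_powr_times cont\<xi>]) auto
    fix y :: real assume y: "0 < y" "y < 1"
    show "((\<lambda>y. Beta_pair \<alpha> \<beta> (\<xi> y)) has_real_derivative Beta_pair_density \<alpha> \<beta> (\<xi> y) * \<xi>' y) (at y)"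
      using pos y \<xi>_in[OF y] by (intro DERIV_chain2[OF has_real_derivative_Beta_pair] d\<xi>) auto
    show "0 \<le> Beta_pair_density \<alpha> \<beta> (\<xi> y) * \<xi>' y"
      using pos \<xi>_in[OF y] by (intro mult_nonneg_nonneg less_imp_le[OF Beta_pair_density_pos]) (auto simp: \<xi>'_def)
    have Dy: "D y > 0" using y D by simp
    have 1: "\<alpha> - n * \<xi> y = \<alpha> * \<beta> * (1 - 2 * y) / D y"
      using Dy by (simp add: \<xi>_def field_simps) (simp add: D_def n_def algebra_simps)
    have 2: "\<beta> * \<xi> y + \<alpha> * (1 - \<xi> y) = \<alpha> * \<beta> / D y"
      using Dy y by (subst \<xi>1) (simp_all add: \<xi>_def field_simps)
    have "(h has_real_derivative K / 2 * (\<xi> y powr (\<alpha> - 1) * (1 - \<xi> y) powr (\<beta> - 1) * (\<alpha> - n * \<xi> y) * \<xi>' y)) (at y)"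
      unfolding h_def n_def by (intro DERIV_cmult DERIV_chain2[OF has_real_derivative_powr_times] d\<xi> \<xi>_in y)
    then show "(h has_real_derivative (1/2 - y) * (Beta_pair_density \<alpha> \<beta> (\<xi> y) * \<xi>' y)) (at y)"
      unfolding 1 Beta_pair_density_def 2 by (rule DERIV_cong) (simp add: K_def field_simps)
  next
    fix z :: real assume z: "0 < z" "z < 1 - 1/2"
    define S where "S = (\<lambda>z. \<kappa> * (ln (1/2 + z) - ln (1/2 - z)) - n * (ln (n/2 + \<kappa> * z) - ln (n/2 - \<kappa> * z)))"
    have \<kappa>z: "n/2 - \<kappa> * x > 0" "n/2 + \<kappa> * x > 0" if "0 \<le> x" "x \<le> z" for x
    proof -
      have "\<kappa> * x \<le> n * x" using pos that by (intro mult_right_mono) auto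
      also have "n * x < n * (1/2)" using pos that z by (intro mult_strict_left_mono) auto
      finally show "n/2 - \<kappa> * x > 0" by simp
      show "n/2 + \<kappa> * x > 0" using pos that by (intro add_pos_nonneg) auto
    qed
    have "S 0 \<le> S z"
    proof (rule DERIV_nonneg_imp_nondecreasing[of 0 z])
      fix x assume x: "0 \<le> x" "x \<le> z"
      have xp: "1/2 - x > 0" using x z by simp
      have "(S has_real_derivative \<kappa> * (1 / (1/2 + x) + 1 / (1/2 - x)) - n * (\<kappa> / (n/2 + \<kappa> * x) + \<kappa> / (n/2 - \<kappa> * x))) (at x)"
        unfolding S_def using \<kappa>z[OF x] xp x by (auto intro!: derivative_eq_intros)
      moreover have "1 / (1/2 + x) + 1 / (1/2 - x) = n\<^sup>2 / (n\<^sup>2 * (1/4 - x\<^sup>2))"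
      proof -
        have "1/4 - x\<^sup>2 = (1/2 - x) * (1/2 + x)" by (simp add: power2_eq_square algebra_simps)
        moreover have "1 / (1/2 + x) + 1 / (1/2 - x) = 1 / ((1/2 - x) * (1/2 + x))"
          using xp x by (subst add_frac_eq) auto
        ultimately show ?thesis using pos by simp
      qed
      moreover have "n * (\<kappa> / (n/2 + \<kappa> * x) + \<kappa> / (n/2 - \<kappa> * x)) = \<kappa> * (n\<^sup>2 / ((n/2 - \<kappa> * x) * (n/2 + \<kappa> * x)))"
        using \<kappa>z[OF x] by (simp add: divide_simps) (simp add: power2_eq_square algebra_simps)
      moreover have "n\<^sup>2 / ((n/2 - \<kappa> * x) * (n/2 + \<kappa> * x)) \<le> n\<^sup>2 / (n\<^sup>2 * (1/4 - x\<^sup>2))"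
      proof (rule divide_left_mono)
        have "\<kappa>\<^sup>2 * x\<^sup>2 \<le> n\<^sup>2 * x\<^sup>2" using pos by (intro mult_right_mono power_mono) auto
        then show "n\<^sup>2 * (1/4 - x\<^sup>2) \<le> (n/2 - \<kappa> * x) * (n/2 + \<kappa> * x)"
          by (simp add: power2_eq_square algebra_simps)
        have "1/4 - x\<^sup>2 = (1/2 - x) * (1/2 + x)" by (simp add: power2_eq_square algebra_simps)
        then have "1/4 - x\<^sup>2 > 0" using xp x by simp
        then show "0 < (n/2 - \<kappa> * x) * (n/2 + \<kappa> * x) * (n\<^sup>2 * (1/4 - x\<^sup>2))"
          using \<kappa>z[OF x] pos by simp
      qed simp
      ultimately have "(S has_real_derivative \<kappa> * (n\<^sup>2 / (n\<^sup>2 * (1/4 - x\<^sup>2)) - n\<^sup>2 / ((n/2 - \<kappa> * x) * (n/2 + \<kappa> * x)))) (at x)"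
        and "0 \<le> n\<^sup>2 / (n\<^sup>2 * (1/4 - x\<^sup>2)) - n\<^sup>2 / ((n/2 - \<kappa> * x) * (n/2 + \<kappa> * x))"
        by (simp_all only: right_diff_distrib diff_ge_0_iff_ge)
      then show "\<exists>y. (S has_real_derivative y) (at x) \<and> 0 \<le> y"
        using pos by (blast intro: mult_nonneg_nonneg)
    qed (use z in auto)
    then have S: "0 \<le> S z" by (simp add: S_def)
    have D12: "D (1/2 - z) = n/2 + \<kappa> * z" "D (1/2 + z) = n/2 - \<kappa> * z"
      by (auto simp: D_def n_def \<kappa>_def field_simps)
    have pz: "1/2 - z > 0" using z by simp
    have hS: "h y = K / 2 * exp (\<alpha> * (ln \<alpha> + ln y - ln (D y)) + \<beta> * (ln \<beta> + ln (1 - y) - ln (D y)))"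
      if "0 < y" "y < 1" for y
      using that pos D[of y] \<xi>_in[of y] \<xi>1[of y]
      by (auto simp: h_def powr_def exp_add \<xi>_def ln_div ln_mult)
    have "h (1/2 + z) \<le> h (1/2 - z) \<longleftrightarrow> 0 \<le> S z"
      using z pos by (simp add: hS D12 S_def) (simp add: n_def \<kappa>_def algebra_simps)
    with S show "h (1/2 + z) \<le> h (1/2 - z)" by simp
  qed (use pos in \<open>auto simp: h_def \<xi>_def D_def\<close>)
  moreover have "\<xi> 0 = 0" "\<xi> 1 = 1" "\<xi> (1/2) = \<alpha> / (\<alpha> + \<beta>)"
    using pos by (auto simp: \<xi>_def D_def field_simps)
  ultimately have "Beta_pair \<alpha> \<beta> (\<alpha> / (\<alpha> + \<beta>)) \<le> 1" using pos by (simp add: Beta_pair_0 Beta_pair_1)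
  then show ?thesis using pos by (intro equipoint_geI) auto
qed

lemma equipoint_le_mode:
  assumes "\<beta> > 0" "\<beta> \<le> \<alpha>"
  shows "equipoint \<alpha> \<beta> \<le> \<alpha> / (\<alpha> + \<beta>)"
  using equipoint_ge_mode[OF assms] equipoint_commute[of \<alpha> \<beta>] assms by (simp add: field_simps)

text \<open>By the two previous localizations the mean lies below the equipoint and the equipoint below the mode, and
the weight increases up to its mode.\<close>

lemma equi_value_ge:
  assumes "\<beta> \<ge> 1/2" "\<beta> \<le> \<alpha>"
  shows "binomial_weight \<alpha> \<beta> ((\<alpha> + 1/2) / (\<alpha> + \<beta> + 1)) \<le> equi_value \<alpha> \<beta>"
  unfolding equi_value_def using assms
  by (intro binomial_weight_mono mean_le_equipoint equipoint_le_mode) auto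

lemma equi_value_le:
  assumes "\<alpha> > 0" "\<beta> > 0"
  shows "equi_value \<alpha> \<beta> \<le> binomial_weight \<alpha> \<beta> (\<alpha> / (\<alpha> + \<beta>))"
  unfolding equi_value_def using equipoint_in[OF assms] assms by (intro binomial_weight_max) auto

section \<open>Elementary inequalities\<close>

lemma nonneg_if_decreasing_to_0:
  fixes f :: "real \<Rightarrow> real"
  assumes f': "\<And>x. a \<le> x \<Longrightarrow> (f has_real_derivative f' x) (at x)"
    and neg: "\<And>x. a \<le> x \<Longrightarrow> f' x \<le> 0"
    and lim: "(f \<longlongrightarrow> 0) at_top" and x: "a \<le> x"
  shows "0 \<le> f x"
proof (rule tendsto_upperbound[OF lim])
  have "f y \<le> f x" if "x \<le> y" for y
    using that x f' neg by (intro DERIV_nonpos_imp_nonincreasing[of x y f]) (auto intro: order.trans)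
  then show "eventually (\<lambda>y. f y \<le> f x) at_top"
    by (intro eventually_mono[OF eventually_ge_at_top[of x]]) auto
qed simp

text \<open>The three rational inequalities below say that derivatives of the logarithmic expressions in the later
lemmas have constant sign. With \<open>x = 1 + y\<close> each becomes a statement about a polynomial in \<open>y\<close> whose
coefficients all have the same sign.\<close>

lemma step_slope_rational:
  fixes x :: real assumes "1 \<le> x"
  shows "2 / (x + 3/2) - 1 / x + 1 / (x + 1)\<^sup>2 + (1/2) / (x + 3/2)\<^sup>2 - 1 / (x + 5/2) - 1 / (x + 5/2)\<^sup>2 \<le> 0"
proof -
  define y where "y = x - 1"
  have y: "0 \<le> y" "x = 1 + y" using assms by (auto simp: y_def)
  show ?thesis unfolding y(2) using y(1)
    by (simp add: divide_simps add_pos_nonneg add_nonneg_eq_0_iff) (simp add: power2_eq_square algebra_simps)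
qed

lemma step_diagonal_rational:
  fixes x :: real assumes "1 \<le> x"
  shows "0 \<le> 1 / (x + 1)\<^sup>2 + 1 / (x + 3/2) - 1 / (x + 1/2) + (1/2) / (x + 3/2)\<^sup>2 - 1 / (x + 1/2)\<^sup>2
    + (1/2) / x\<^sup>2 - 4 / (2 * x + 3/2) + 4 / (2 * x + 1/2) - 4 / (2 * x + 3/2)\<^sup>2"
proof -
  define y where "y = x - 1"
  have y: "0 \<le> y" "x = 1 + y" using assms by (auto simp: y_def)
  show ?thesis unfolding y(2) using y(1)
    by (simp add: divide_simps add_pos_nonneg add_nonneg_eq_0_iff) (simp add: power2_eq_square algebra_simps)
qed

lemma central_step_rational:
  fixes x :: real assumes "1 \<le> x"
  shows "(1/2) / (x + 4) - 1 / (x + 3) + 1 / (x + 1) - (1/2) / x + (1/2) / (x + 4)\<^sup>2 - 2 / (x + 2)\<^sup>2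
    + 2 / (x + 1)\<^sup>2 - (1/2) / x\<^sup>2 \<le> 0"
proof -
  define y where "y = x - 1"
  have y: "0 \<le> y" "x = 1 + y" using assms by (auto simp: y_def)
  show ?thesis unfolding y(2) using y(1)
    by (simp add: divide_simps add_pos_nonneg add_nonneg_eq_0_iff) (simp add: power2_eq_square algebra_simps)
qed

lemma step_slope_nonneg:
  fixes x :: real assumes "1 \<le> x"
  shows "0 \<le> 2 * ln (x + 3/2) - ln x - 1 / (x + 1) - (1/2) / (x + 3/2) - ln (x + 5/2) + 1 / (x + 5/2)"
    (is "0 \<le> ?f x")
proof (rule nonneg_if_decreasing_to_0[where f = ?f, OF _ step_slope_rational _ assms])
  fix x :: real assume x: "1 \<le> x"
  show "(?f has_real_derivative 2 / (x + 3/2) - 1 / x + 1 / (x + 1)\<^sup>2 + (1/2) / (x + 3/2)\<^sup>2 - 1 / (x + 5/2) - 1 / (x + 5/2)\<^sup>2) (at x)"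
    using x by (auto intro!: derivative_eq_intros simp: power2_eq_square) ((simp add: divide_simps)?, (simp add: algebra_simps)?)
next
  show "(?f \<longlongrightarrow> 0) at_top" by real_asymp
qed

lemma step_diagonal_nonneg:
  fixes x :: real assumes "1 \<le> x"
  shows "0 \<le> (x + 1) * ln (x + 3/2) - ln (x + 1) - (1/2) * ln x - (x - 1/2) * ln (x + 1/2)
      - (2 * x + 1/2) * (ln (2 * x + 3/2) - ln (2 * x + 1/2))" (is "0 \<le> ?g x")
proof -
  let ?g' = "\<lambda>x::real. ln (x + 3/2) - ln (x + 1/2) - 1 / (x + 1) - (1/2) / (x + 3/2) + 1 / (x + 1/2) - (1/2) / x
     - 2 * ln (2 * x + 3/2) + 2 * ln (2 * x + 1/2) + 2 / (2 * x + 3/2)"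
  have g': "?g' x \<le> 0" if x: "1 \<le> x" for x :: real
  proof -
    have "0 \<le> - ?g' x"
    proof (rule nonneg_if_decreasing_to_0[where f = "\<lambda>x. - ?g' x", OF _ _ _ x])
      fix x :: real assume x: "1 \<le> x"
      let ?g'' = "1 / (x + 1)\<^sup>2 + 1 / (x + 3/2) - 1 / (x + 1/2) + (1/2) / (x + 3/2)\<^sup>2 - 1 / (x + 1/2)\<^sup>2
        + (1/2) / x\<^sup>2 - 4 / (2 * x + 3/2) + 4 / (2 * x + 1/2) - 4 / (2 * x + 3/2)\<^sup>2"
      show "((\<lambda>x. - ?g' x) has_real_derivative - ?g'') (at x)"
        using x by (auto intro!: derivative_eq_intros simp: power2_eq_square) ((simp add: divide_simps)?, (simp add: algebra_simps)?)
      show "- ?g'' \<le> 0" using step_diagonal_rational[OF x] by simp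
    next
      show "((\<lambda>x. - ?g' x) \<longlongrightarrow> 0) at_top" by real_asymp
    qed
    then show ?thesis by simp
  qed
  show ?thesis
  proof (rule nonneg_if_decreasing_to_0[where f = ?g, OF _ g' _ assms])
    fix x :: real assume x: "1 \<le> x"
    show "(?g has_real_derivative ?g' x) (at x)"
      using x by (auto intro!: derivative_eq_intros simp: divide_simps) (simp add: algebra_simps)?
  next
    show "(?g \<longlongrightarrow> 0) at_top" by real_asymp
  qed
qed

lemma central_step_nonpos:
  fixes x :: real assumes "1 \<le> x"
  shows "(x + 3) / 2 * ln (x + 4) - (x + 3) * ln (x + 3) + 2 * ln (x + 2) + (x - 1) * ln (x + 1) - (x - 1) / 2 * ln x \<le> 0"
    (is "?g x \<le> 0")
proof -
  let ?g' = "\<lambda>x::real. (1/2) * ln (x + 4) - ln (x + 3) + ln (x + 1) - (1/2) * ln x - (1/2) / (x + 4) + 2 / (x + 2) - 2 / (x + 1) + (1/2) / x"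
  have g': "0 \<le> ?g' x" if x: "1 \<le> x" for x :: real
  proof (rule nonneg_if_decreasing_to_0[where f = ?g', OF _ central_step_rational _ x])
    fix x :: real assume x: "1 \<le> x"
    show "(?g' has_real_derivative (1/2) / (x + 4) - 1 / (x + 3) + 1 / (x + 1) - (1/2) / x + (1/2) / (x + 4)\<^sup>2 - 2 / (x + 2)\<^sup>2
       + 2 / (x + 1)\<^sup>2 - (1/2) / x\<^sup>2) (at x)"
      using x by (auto intro!: derivative_eq_intros simp: power2_eq_square) ((simp add: divide_simps)?, (simp add: algebra_simps)?)
  next
    show "(?g' \<longlongrightarrow> 0) at_top" by real_asymp
  qed
  have "0 \<le> - ?g x"
  proof (rule nonneg_if_decreasing_to_0[where f = "\<lambda>x. - ?g x", OF _ _ _ assms])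
    fix x :: real assume x: "1 \<le> x"
    show "((\<lambda>x. - ?g x) has_real_derivative - ?g' x) (at x)"
      using x by (auto intro!: derivative_eq_intros simp: divide_simps) (simp add: algebra_simps)?
    show "- ?g' x \<le> 0" using g'[OF x] by simp
  next
    show "((\<lambda>x. - ?g x) \<longlongrightarrow> 0) at_top" by real_asymp
  qed
  then show ?thesis by simp
qed

text \<open>This is the logarithm of the comparison made in \<open>equi_value_step\<close>. For fixed \<open>\<beta>\<close> the expression increases
with \<open>\<alpha>\<close>: in its slope the terms with \<open>\<alpha> + \<beta>\<close> are monotone in \<open>\<beta>\<close>, which reduces the slope to the case
\<open>\<beta> = 3/2\<close>, treated in \<open>step_slope_nonneg\<close>. On the boundary line \<open>\<beta> = \<alpha> + 1/2\<close> it is the expression of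
\<open>step_diagonal_nonneg\<close>.\<close>

lemma step_log_inequality:
  fixes \<alpha> \<beta> :: real
  assumes "3/2 \<le> \<beta>" "\<beta> \<le> \<alpha> + 1/2"
  shows "0 \<le> ln \<beta> - ln (\<alpha> + 1) + (\<alpha> + 1) * (ln (\<alpha> + 3/2) - ln (\<alpha> + \<beta> + 1)) + (\<beta> - 1) * (ln (\<beta> - 1/2) - ln (\<alpha> + \<beta> + 1))
     - \<alpha> * (ln \<alpha> - ln (\<alpha> + \<beta>)) - \<beta> * (ln \<beta> - ln (\<alpha> + \<beta>))" (is "0 \<le> ?F \<alpha>")
proof -
  have "?F (\<beta> - 1/2) \<le> ?F \<alpha>"
  proof (rule DERIV_nonneg_imp_nondecreasing[where f = ?F])
    fix x assume x: "\<beta> - 1/2 \<le> x" "x \<le> \<alpha>"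
    let ?F' = "ln (x + 3/2) - ln x - 1 / (x + 1) + (x + 1) / (x + 3/2) - (ln (x + \<beta> + 1) - ln (x + \<beta>)) - (x + \<beta>) / (x + \<beta> + 1)"
    have p: "x \<ge> 1" "\<beta> > 0" "\<beta> - 1/2 > 0" using x assms by auto
    have "(?F has_real_derivative - 1 / (x + 1) + ((ln (x + 3/2) - ln (x + \<beta> + 1)) + (x + 1) * (1 / (x + 3/2) - 1 / (x + \<beta> + 1)))
      + (\<beta> - 1) * (- 1 / (x + \<beta> + 1)) - ((ln x - ln (x + \<beta>)) + x * (1 / x - 1 / (x + \<beta>))) - \<beta> * (- 1 / (x + \<beta>))) (at x)"
      using p by (auto intro!: derivative_eq_intros)
    note dF = this
    let ?n = "x + \<beta>"
    have e1: "x * (1 / x) = 1" "x * (1 / ?n) + \<beta> * (1 / ?n) = 1"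
      using p by (simp_all flip: add_divide_distrib)
    have e2: "(x + 1) * (1 / (?n + 1)) + (\<beta> - 1) * (1 / (?n + 1)) = ?n / (?n + 1)"
      by (simp flip: add_divide_distrib)
    have "- 1 / (x + 1) + ((ln (x + 3/2) - ln (?n + 1)) + (x + 1) * (1 / (x + 3/2) - 1 / (?n + 1)))
      + (\<beta> - 1) * (- 1 / (?n + 1)) - ((ln x - ln ?n) + x * (1 / x - 1 / ?n)) - \<beta> * (- 1 / ?n)
      = - 1 / (x + 1) + (ln (x + 3/2) - ln (?n + 1)) + (x + 1) / (x + 3/2)
        - ((x + 1) * (1 / (?n + 1)) + (\<beta> - 1) * (1 / (?n + 1))) - (ln x - ln ?n)
        - x * (1 / x) + (x * (1 / ?n) + \<beta> * (1 / ?n))"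
      by (simp only: right_diff_distrib) simp
    also have "\<dots> = ?F'" unfolding e1 e2 by simp
    finally have dF': "(?F has_real_derivative ?F') (at x)" by (rule DERIV_cong[OF dF])
    define e where "e = (\<lambda>m::real. ln (m + 1) - ln m - 1 / (m + 1))"
    have "e ?n \<le> e (x + 3/2)"
    proof (rule DERIV_nonpos_imp_nonincreasing[where f = e])
      fix m assume "x + 3/2 \<le> m" "m \<le> ?n"
      then have m: "0 < m" using p by simp
      have "(e has_real_derivative 1 / (m + 1) - 1 / m + 1 / (m + 1)\<^sup>2) (at m)"
        unfolding e_def using m by (auto intro!: derivative_eq_intros simp: power2_eq_square)
      moreover have "1 / (m + 1) - 1 / m + 1 / (m + 1)\<^sup>2 \<le> 0"
        using m by (simp add: divide_simps) (simp add: power2_eq_square algebra_simps)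
      ultimately show "\<exists>y. (e has_real_derivative y) (at m) \<and> y \<le> 0" by blast
    qed (use assms in auto)
    moreover have "0 \<le> ln (x + 3/2) - ln x - 1 / (x + 1) - (1/2) / (x + 3/2) - e (x + 3/2)"
      using step_slope_nonneg[OF p(1)] by (simp add: e_def algebra_simps)
    moreover have "?F' = ln (x + 3/2) - ln x - 1 / (x + 1) - (1/2) / (x + 3/2) - e ?n"
    proof -
      have "(x + 1) / (x + 3/2) = 1 - (1/2) / (x + 3/2)" "?n / (?n + 1) = 1 - 1 / (?n + 1)"
        using p by (simp_all add: field_simps)
      then show ?thesis unfolding e_def by simp
    qed
    ultimately have "0 \<le> ?F'" by linarith
    with dF' show "\<exists>y. (?F has_real_derivative y) (at x) \<and> 0 \<le> y" by blast
  qed (use assms in auto)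
  moreover have "0 \<le> ?F (\<beta> - 1/2)"
    using step_diagonal_nonneg[of "\<beta> - 1/2"] assms by (simp add: algebra_simps)
  ultimately show ?thesis by linarith
qed

section \<open>Comparison of equipoint values\<close>

lemma Gamma_plus1_pos: "x > 0 \<Longrightarrow> Gamma (x + 1) = x * Gamma (x::real)"
  by (intro Gamma_plus1) (auto dest: nonpos_Ints_nonpos)

text \<open>The left hand side is at most the weight at its mode \<open>\<alpha> / (\<alpha> + \<beta>)\<close>, the right hand side at least the weight
at the mean of the corresponding density. The Gamma factors of both weights differ by the factor
\<open>\<beta> / (\<alpha> + 1)\<close> only, because the parameters move by whole units; what remains is elementary.\<close>

lemma equi_value_step:
  assumes "3/2 \<le> \<beta>" "\<beta> \<le> \<alpha> + 1/2"
  shows "equi_value \<alpha> \<beta> \<le> equi_value (\<alpha> + 1) (\<beta> - 1)"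
proof -
  define n where "n = \<alpha> + \<beta>"
  have pos: "\<alpha> > 0" "\<beta> > 0" "n > 0" "\<beta> - 1 > 0" using assms by (auto simp: n_def)
  have G: "Gamma (\<beta> + 1) = \<beta> * Gamma \<beta>" "Gamma (\<alpha> + 1 + 1) = (\<alpha> + 1) * Gamma (\<alpha> + 1)"
    using pos Gamma_plus1_pos[of \<beta>] Gamma_plus1_pos[of "\<alpha> + 1"] by simp_all
  have G0: "Gamma \<beta> > 0" "Gamma (\<alpha> + 1) > 0" using pos by (auto intro!: Gamma_real_pos)
  have gb: "gen_binomial (\<alpha> + 1) (\<beta> - 1) = gen_binomial \<alpha> \<beta> * (\<beta> / (\<alpha> + 1))"
  proof -
    have "gen_binomial (\<alpha> + 1) (\<beta> - 1) = Gamma (\<alpha> + \<beta> + 1) / (Gamma (\<alpha> + 1 + 1) * Gamma \<beta>)"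
      by (simp add: gen_binomial_def add_ac)
    then show ?thesis using pos G0 unfolding gen_binomial_def G by simp
  qed
  let ?m = "(\<alpha> + 3/2) / (n + 1)"
  have q: "1 - \<alpha> / n = \<beta> / n" "1 - ?m = (\<beta> - 1/2) / (n + 1)"
    using pos by (auto simp: n_def field_simps)
  have "equi_value \<alpha> \<beta> \<le> binomial_weight \<alpha> \<beta> (\<alpha> / n)"
    using equi_value_le[OF pos(1,2)] by (simp add: n_def)
  also have "\<dots> = gen_binomial \<alpha> \<beta> * exp (\<alpha> * (ln \<alpha> - ln n) + \<beta> * (ln \<beta> - ln n))"
    unfolding binomial_weight_def q using pos by (simp add: powr_def exp_add ln_div)
  also have "\<dots> \<le> gen_binomial \<alpha> \<beta> * exp (ln \<beta> - ln (\<alpha> + 1) + (\<alpha> + 1) * (ln (\<alpha> + 3/2) - ln (n + 1)) + (\<beta> - 1) * (ln (\<beta> - 1/2) - ln (n + 1)))"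
    using step_log_inequality[OF assms] gen_binomial_pos[OF pos(1,2)]
    by (intro mult_left_mono) (simp_all add: n_def)
  also have "\<dots> = gen_binomial \<alpha> \<beta> * (\<beta> / (\<alpha> + 1)) * (?m powr (\<alpha> + 1) * ((\<beta> - 1/2) / (n + 1)) powr (\<beta> - 1))"
  proof -
    have "?m powr (\<alpha> + 1) = exp ((\<alpha> + 1) * (ln (\<alpha> + 3/2) - ln (n + 1)))"
      "((\<beta> - 1/2) / (n + 1)) powr (\<beta> - 1) = exp ((\<beta> - 1) * (ln (\<beta> - 1/2) - ln (n + 1)))"
      using pos assms by (simp_all add: powr_def ln_div)
    moreover have "\<beta> / (\<alpha> + 1) = exp (ln \<beta> - ln (\<alpha> + 1))"
      using pos by (simp add: exp_diff)
    ultimately show ?thesis by (simp only: exp_add mult.assoc)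
  qed
  also have "\<dots> = binomial_weight (\<alpha> + 1) (\<beta> - 1) ((\<alpha> + 1 + 1/2) / (\<alpha> + 1 + (\<beta> - 1) + 1))"
    unfolding gb[symmetric] q(2)[symmetric] by (simp add: binomial_weight_def n_def add_ac)
  also have "\<dots> \<le> equi_value (\<alpha> + 1) (\<beta> - 1)"
    using assms by (intro equi_value_ge) auto
  finally show ?thesis .
qed

lemma Gamma_midpoint:
  assumes "x > (0::real)"
  shows "(Gamma (x + 1/2))\<^sup>2 \<le> Gamma x * Gamma (x + 1)"
proof -
  have "(ln \<circ> Gamma) ((1 - 1/2) *\<^sub>R x + (1/2) *\<^sub>R (x + 1)) \<le> (1 - 1/2) * (ln \<circ> Gamma) x + (1/2) * (ln \<circ> Gamma) (x + 1)"
    using assms by (intro convex_onD[OF log_convex_Gamma_real]) auto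
  moreover have "(1 - 1/2) *\<^sub>R x + (1/2) *\<^sub>R (x + 1) = x + 1/2" by (simp add: field_simps)
  ultimately have "2 * ln (Gamma (x + 1/2)) \<le> ln (Gamma x) + ln (Gamma (x + 1))" by simp
  moreover have pos: "Gamma x > 0" "Gamma (x + 1) > 0" "Gamma (x + 1/2) > 0"
    using assms by (auto intro!: Gamma_real_pos)
  ultimately have "ln ((Gamma (x + 1/2))\<^sup>2) \<le> ln (Gamma x * Gamma (x + 1))"
    by (simp add: ln_mult ln_realpow)
  then show ?thesis using pos by simp
qed

lemma equi_value_same:
  assumes "\<alpha> > 0"
  shows "equi_value \<alpha> \<alpha> = gen_binomial \<alpha> \<alpha> * (1/2) powr (2 * \<alpha>)"
  using assms by (simp add: equi_value_def equipoint_same binomial_weight_def flip: powr_add)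

text \<open>Here the parameters move by \<open>1/2\<close>, and the quotient of the Gamma factors is no longer rational. Let \<open>M n\<close> be
the logarithm of the quotient of the lower bound \<open>equi_value_ge\<close> for the right hand side and the left hand
side. Along \<open>n\<close>, \<open>n + 2\<close>, \<open>n + 4\<close>, \<dots> the change of \<open>M\<close> is elementary, since the Gamma quotient changes by a
rational factor, and it is never positive by \<open>central_step_nonpos\<close>. Log-convexity of Gamma bounds \<open>M\<close> from
below by a function that tends to \<open>0\<close>. Hence \<open>0 \<le> M n\<close>.\<close>

lemma equi_value_central_step:
  assumes n: "2 \<le> n"
  shows "equi_value (n/2) (n/2) \<le> equi_value (n/2 + 1/2) (n/2 - 1/2)"
proof -
  define M where "M = (\<lambda>n::real. 2 * ln (Gamma (n/2 + 1)) - ln (Gamma (n/2 + 3/2)) - ln (Gamma (n/2 + 1/2))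
     + (n + 1) / 2 * (ln (n + 2) - ln (n + 1)) + (n - 1) / 2 * (ln n - ln (n + 1)))"
  have dec: "M (m + 2) \<le> M m" if m: "1 \<le> m" for m :: real
  proof -
    have 1: "Gamma ((m + 2)/2 + 1) = (m/2 + 1) * Gamma (m/2 + 1)"
      "Gamma ((m + 2)/2 + 3/2) = (m/2 + 3/2) * Gamma (m/2 + 3/2)"
      "Gamma ((m + 2)/2 + 1/2) = (m/2 + 1/2) * Gamma (m/2 + 1/2)"
      using m Gamma_plus1_pos[of "m/2 + 1"] Gamma_plus1_pos[of "m/2 + 3/2"] Gamma_plus1_pos[of "m/2 + 1/2"]
      by (simp_all add: add_divide_distrib add_ac)
    have 2: "m/2 + 1 = (m + 2) / 2" "m/2 + 3/2 = (m + 3) / 2" "m/2 + 1/2 = (m + 1) / 2" by (auto simp: field_simps)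
    have pos: "Gamma (m/2 + 1) > 0" "Gamma (m/2 + 3/2) > 0" "Gamma (m/2 + 1/2) > 0"
      using m by (auto intro!: Gamma_real_pos)
    have l: "ln (m/2 + 1) = ln (m + 2) - ln 2" "ln (m/2 + 3/2) = ln (m + 3) - ln 2" "ln (m/2 + 1/2) = ln (m + 1) - ln 2"
      unfolding 2 using m by (simp_all add: ln_div)
    have "ln (Gamma ((m + 2)/2 + 1)) = ln (m/2 + 1) + ln (Gamma (m/2 + 1))"
      "ln (Gamma ((m + 2)/2 + 3/2)) = ln (m/2 + 3/2) + ln (Gamma (m/2 + 3/2))"
      "ln (Gamma ((m + 2)/2 + 1/2)) = ln (m/2 + 1/2) + ln (Gamma (m/2 + 1/2))"
      unfolding 1 using m pos by (intro ln_mult_pos; simp)+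
    note this[unfolded l]
    then show ?thesis using central_step_nonpos[OF m]
      unfolding M_def by (simp add: add_ac) (simp add: field_simps)
  qed
  have M_le: "M (n + 2 * real k) \<le> M n" for k
  proof (induction k)
    case (Suc k)
    have "M (n + 2 * real k + 2) \<le> M (n + 2 * real k)" using n by (intro dec) auto
    with Suc show ?case by (simp add: algebra_simps)
  qed simp
  define Lo where "Lo = (\<lambda>m::real. ln ((m + 1) / (m + 2)) + (m + 1) / 2 * (ln (m + 2) - ln (m + 1)) + (m - 1) / 2 * (ln m - ln (m + 1)))"
  have lower: "Lo m \<le> M m"
    if m: "1 \<le> m" for m :: real
  proof -
    have pos: "Gamma (m/2 + 1) > 0" "Gamma (m/2 + 3/2) > 0" "Gamma (m/2 + 1/2) > 0"
      using m by (auto intro!: Gamma_real_pos)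
    have 1: "Gamma (m/2 + 3/2) = (m/2 + 1/2) * Gamma (m/2 + 1/2)" "Gamma (m/2 + 2) = (m/2 + 1) * Gamma (m/2 + 1)"
      using m Gamma_plus1_pos[of "m/2 + 1/2"] Gamma_plus1_pos[of "m/2 + 1"] by (simp_all add: add_ac)
    have "(Gamma (m/2 + 3/2))\<^sup>2 \<le> (m/2 + 1) * (Gamma (m/2 + 1))\<^sup>2"
    proof -
      have "m/2 + 1 + 1/2 = m/2 + 3/2" "m/2 + 1 + 1 = m/2 + 2" by simp_all
      then show ?thesis using Gamma_midpoint[of "m/2 + 1"] m by (simp only: 1(2)) (simp only: power2_eq_square mult_ac)
    qed
    with zero_less_power[OF pos(2), of 2]
    have "ln ((Gamma (m/2 + 3/2))\<^sup>2) \<le> ln ((m/2 + 1) * (Gamma (m/2 + 1))\<^sup>2)"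
      by (intro ln_mono)
    moreover
    have p2: "0 < m/2 + 1" "0 < m/2 + 1/2" using m by linarith+
    moreover note ln_mult_pos[OF p2(1) zero_less_power[OF pos(1), of 2]]
    moreover have "ln ((Gamma (m/2 + 1))\<^sup>2) = 2 * ln (Gamma (m/2 + 1))" "ln ((Gamma (m/2 + 3/2))\<^sup>2) = 2 * ln (Gamma (m/2 + 3/2))"
      by (simp_all add: ln_realpow)
    ultimately have g1: "2 * ln (Gamma (m/2 + 3/2)) \<le> ln (m/2 + 1) + 2 * ln (Gamma (m/2 + 1))" by linarith
    have g2: "ln (Gamma (m/2 + 3/2)) = ln (m/2 + 1/2) + ln (Gamma (m/2 + 1/2))"
      unfolding 1(1) by (rule ln_mult_pos[OF p2(2) pos(3)])
    have "(m + 1) / (m + 2) = (m/2 + 1/2) / (m/2 + 1)" using m by (simp add: field_simps)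
    then have g3: "ln ((m + 1) / (m + 2)) = ln (m/2 + 1/2) - ln (m/2 + 1)"
      by (simp only: ln_divide_pos[OF p2(2,1)])
    show ?thesis unfolding M_def Lo_def g3 using g1 g2 by linarith
  qed
  have "Lo m \<le> M n"
    if "m = n + 2 * real k" for m k
  proof -
    have "1 \<le> m" using n that by (intro order.trans[of 1 n m]) auto
    from lower[OF this] M_le[of k] that show ?thesis by simp
  qed
  then have ev: "\<forall>\<^sub>F k in sequentially. Lo (n + 2 * real k) \<le> M n"
    by simp
  have "(Lo \<longlongrightarrow> 0) at_top"
    unfolding Lo_def by real_asymp
  moreover have "filterlim (\<lambda>k. n + 2 * real k) at_top sequentially" by real_asymp
  ultimately have "((\<lambda>k. Lo (n + 2 * real k)) \<longlongrightarrow> 0) sequentially"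
    by (rule filterlim_compose)
  from tendsto_upperbound[OF this ev] have "0 \<le> M n" by simp
  define g where "g = Gamma (n + 1)"
  have pos: "Gamma (n/2 + 1) > 0" "Gamma (n/2 + 3/2) > 0" "Gamma (n/2 + 1/2) > 0" "g > 0"
    using n by (auto intro!: Gamma_real_pos simp: g_def)
  have "equi_value (n/2) (n/2) = g * exp (- 2 * ln (Gamma (n/2 + 1)) - n * ln 2)"
    using n pos by (simp add: equi_value_same gen_binomial_def powr_def ln_div exp_diff exp_minus field_simps g_def flip: exp_of_nat_mult)
      (simp add: exp_double power2_eq_square)
  also have "\<dots> \<le> g * exp (M n - 2 * ln (Gamma (n/2 + 1)) - n * ln 2)"
    using \<open>0 \<le> M n\<close> pos by simp
  also have "\<dots> = binomial_weight (n/2 + 1/2) (n/2 - 1/2) ((n/2 + 1/2 + 1/2) / (n/2 + 1/2 + (n/2 - 1/2) + 1))"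
  proof -
    let ?\<alpha> = "n/2 + 1/2" and ?\<beta> = "n/2 - 1/2"
    have a: "(?\<alpha> + 1/2) / (?\<alpha> + ?\<beta> + 1) = (n + 2) / (2 * (n + 1))" using n by (simp add: field_simps)
    have b: "1 - (n + 2) / (2 * (n + 1)) = n / (2 * (n + 1))" using n by (simp add: field_simps)
    have c: "gen_binomial ?\<alpha> ?\<beta> = g * exp (- ln (Gamma (n/2 + 3/2)) - ln (Gamma (n/2 + 1/2)))"
      using pos by (simp add: gen_binomial_def exp_diff exp_minus g_def add_ac field_simps)
    have "binomial_weight ?\<alpha> ?\<beta> ((n + 2) / (2 * (n + 1)))
      = g * exp (- ln (Gamma (n/2 + 3/2)) - ln (Gamma (n/2 + 1/2)))
       * (exp (?\<alpha> * (ln (n + 2) - (ln 2 + ln (n + 1)))) * exp (?\<beta> * (ln n - (ln 2 + ln (n + 1)))))"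
    proof -
      have "ln ((n + 2) / (2 * (n + 1))) = ln (n + 2) - (ln 2 + ln (n + 1))"
        "ln (n / (2 * (n + 1))) = ln n - (ln 2 + ln (n + 1))"
        using n ln_divide_pos[of "n + 2" "2 * (n + 1)"] ln_divide_pos[of n "2 * (n + 1)"] ln_mult_pos[of 2 "n + 1"]
        by simp_all
      then have "((n + 2) / (2 * (n + 1))) powr ?\<alpha> = exp (?\<alpha> * (ln (n + 2) - (ln 2 + ln (n + 1))))"
        "(n / (2 * (n + 1))) powr ?\<beta> = exp (?\<beta> * (ln n - (ln 2 + ln (n + 1))))"
        using n by (simp_all add: powr_def)
      then show ?thesis unfolding binomial_weight_def b c by (simp only:)
    qed
    also have "\<dots> = g * exp (M n - 2 * ln (Gamma (n/2 + 1)) - n * ln 2)"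
    proof -
      have "(n/2 + 1/2) * (A - (l + C)) + (n/2 - 1/2) * (N - (l + C)) = (n + 1) / 2 * (A - C) + (n - 1) / 2 * (N - C) - n * l"
        for A C N l :: real
        by (simp add: field_simps)
      then show ?thesis unfolding M_def mult.assoc exp_add[symmetric] by simp
    qed
    finally show ?thesis unfolding a by simp
  qed
  also have "\<dots> \<le> equi_value (n/2 + 1/2) (n/2 - 1/2)"
    using n by (intro equi_value_ge) auto
  finally show ?thesis .
qed

text \<open>The value at the parameters \<open>s / 2\<close> and \<open>t / 2\<close> for the most balanced splitting \<open>d = s + t\<close>.\<close>

definition central_value :: "nat \<Rightarrow> real" where
  "central_value d = (if even d then equi_value (real d / 4) (real d / 4)
     else equi_value ((real d + 1) / 4) ((real d - 1) / 4))"

text \<open>Read with \<open>\<alpha> = s / 2 - 1\<close>, the step lemma says that passing from \<open>(s, t)\<close> to \<open>(s - 2, t + 2)\<close> does not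
increase the value, provided that \<open>s - t \<ge> 3\<close>. When the new difference is \<open>- 1\<close>, the symmetry in the two
parameters makes it \<open>1\<close>. The induction ends at a difference of \<open>0\<close> or \<open>1\<close>, which is the balanced splitting,
or at \<open>2\<close>, where the half step \<open>equi_value_central_step\<close> applies.\<close>

lemma central_value_le_of_le:
  assumes "1 \<le> t" "t \<le> s"
  shows "central_value (s + t) \<le> equi_value (real s / 2) (real t / 2)"
  using assms
proof (induction "s - t" arbitrary: s t rule: less_induct)
  case less
  consider "s = t" | "s = t + 1" | "s = t + 2" | "s \<ge> t + 3" using less.prems by linarith
  then show ?case
  proof cases
    case 1
    then show ?thesis by (simp add: central_value_def)
  next
    case 2
    then have "odd (s + t)" "(real (s + t) + 1) / 4 = real s / 2" "(real (s + t) - 1) / 4 = real t / 2"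
      by (simp_all add: field_simps)
    then show ?thesis unfolding central_value_def by (simp only: if_False order_refl)
  next
    case 3
    have "equi_value ((real t + 1) / 2) ((real t + 1) / 2) \<le> equi_value ((real t + 1) / 2 + 1/2) ((real t + 1) / 2 - 1/2)"
      using less.prems by (intro equi_value_central_step) auto
    moreover have "even (s + t)" "real (s + t) / 4 = (real t + 1) / 2"
      "(real t + 1) / 2 + 1/2 = real s / 2" "(real t + 1) / 2 - 1/2 = real t / 2"
      using 3 by (simp_all add: field_simps)
    ultimately show ?thesis unfolding central_value_def by (simp only: if_True)
  next
    case 4
    have "central_value (s + t) \<le> equi_value (real (s - 2) / 2) (real (t + 2) / 2)"
    proof (cases "t + 2 \<le> s - 2")
      case True
      have "central_value ((s - 2) + (t + 2)) \<le> equi_value (real (s - 2) / 2) (real (t + 2) / 2)"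
        using True 4 less.prems by (intro less.hyps) auto
      also have "(s - 2) + (t + 2) = s + t" using 4 by simp
      finally show ?thesis .
    next
      case False
      have "central_value ((t + 2) + (s - 2)) \<le> equi_value (real (t + 2) / 2) (real (s - 2) / 2)"
        using False 4 less.prems by (intro less.hyps) auto
      also have "(t + 2) + (s - 2) = s + t" using 4 by simp
      also have "equi_value (real (t + 2) / 2) (real (s - 2) / 2) = equi_value (real (s - 2) / 2) (real (t + 2) / 2)"
        using 4 by (intro equi_value_commute) auto
      finally show ?thesis .
    qed
    also have "\<dots> \<le> equi_value (real (s - 2) / 2 + 1) (real (t + 2) / 2 - 1)"
      using 4 less.prems by (intro equi_value_step) (auto simp: of_nat_diff)
    also have "\<dots> = equi_value (real s / 2) (real t / 2)"
      using 4 by (simp add: of_nat_diff add_divide_distrib diff_divide_distrib)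
    finally show ?thesis .
  qed
qed

lemma central_value_le:
  assumes "1 \<le> t" "1 \<le> s"
  shows "central_value (s + t) \<le> equi_value (real s / 2) (real t / 2)"
proof (cases "t \<le> s")
  case False
  then show ?thesis
    using central_value_le_of_le[of s t] equi_value_commute[of "real s / 2" "real t / 2"] assms by (simp add: add.commute)
qed (use central_value_le_of_le assms in simp)

lemma central_value_le_1: "2 \<le> d \<Longrightarrow> central_value d \<le> 1"
  unfolding central_value_def by (auto intro!: equi_value_le_1)

text \<open>The real instance of the duplication formula, needed for the closed form of the value at \<open>\<alpha> = \<beta>\<close>.\<close>

lemma Gamma_legendre_duplication_real:
  assumes "x > (0::real)"
  shows "Gamma x * Gamma (x + 1/2) = exp ((1 - 2 * x) * ln 2) * sqrt pi * Gamma (2 * x)"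
proof -
  have "complex_of_real x \<notin> \<int>\<^sub>\<le>\<^sub>0" "complex_of_real x + 1/2 \<notin> \<int>\<^sub>\<le>\<^sub>0"
    using assms of_real_in_nonpos_Ints_iff[of x, where ?'a = complex] of_real_in_nonpos_Ints_iff[of "x + 1/2", where ?'a = complex]
    by (auto dest: nonpos_Ints_nonpos)
  from Gamma_legendre_duplication[OF this]
  have "complex_of_real (Gamma x * Gamma (x + 1/2)) = complex_of_real (exp ((1 - 2 * x) * ln 2) * sqrt pi * Gamma (2 * x))"
    by (simp add: Gamma_complex_of_real[symmetric] exp_of_real[symmetric] del: Gamma_complex_of_real)
  then show ?thesis by (simp only: of_real_eq_iff)
qed

lemma equi_value_same_Gamma:
  assumes "\<alpha> > 0"
  shows "equi_value \<alpha> \<alpha> = Gamma (1/2 + \<alpha>) / (sqrt pi * Gamma (1 + \<alpha>))"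
proof -
  have pos: "Gamma (\<alpha> + 1) > 0" using assms by (intro Gamma_real_pos) auto
  have "Gamma (\<alpha> + 1/2) * Gamma (\<alpha> + 1) = exp (- (2 * \<alpha> * ln 2)) * sqrt pi * Gamma (2 * \<alpha> + 1)"
    using Gamma_legendre_duplication_real[of "\<alpha> + 1/2"] assms by (simp add: add_ac algebra_simps)
  moreover have "(1/2) powr (2 * \<alpha>) = exp (- (2 * \<alpha> * ln 2))"
    by (simp add: powr_def ln_div)
  ultimately have *: "Gamma (\<alpha> + 1/2) * Gamma (\<alpha> + 1) = (1/2) powr (2 * \<alpha>) * sqrt pi * Gamma (2 * \<alpha> + 1)"
    by simp
  have "Gamma (1/2 + \<alpha>) / (sqrt pi * Gamma (1 + \<alpha>))
      = (Gamma (\<alpha> + 1/2) * Gamma (\<alpha> + 1)) / (sqrt pi * (Gamma (\<alpha> + 1) * Gamma (\<alpha> + 1)))"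
    using pos by (simp add: add.commute)
  also have "\<dots> = gen_binomial \<alpha> \<alpha> * (1/2) powr (2 * \<alpha>)"
  proof -
    have "\<alpha> + \<alpha> + 1 = 2 * \<alpha> + 1" by simp
    then show ?thesis unfolding * gen_binomial_def by (simp only:) simp
  qed
  finally show ?thesis using equi_value_same[OF assms] by simp
qed

section \<open>Gamma integrals over a cone\<close>

definition gamma_density :: "real \<Rightarrow> real \<Rightarrow> real" where
  "gamma_density \<alpha> u = indicator {0..} u * u powr (\<alpha> - 1) / exp u"

lemma gamma_density_nonneg [simp]: "0 \<le> gamma_density \<alpha> u"
  by (simp add: gamma_density_def)

lemma gamma_density_measurable [measurable]: "gamma_density \<alpha> \<in> borel_measurable borel"
  unfolding gamma_density_def by measurable

lemma nn_integral_gamma_density: "\<alpha> > 0 \<Longrightarrow> (\<integral>\<^sup>+u. gamma_density \<alpha> u \<partial>lborel) = Gamma \<alpha>"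
  by (simp add: gamma_density_def Gamma_conv_nn_integral_real)

lemma nn_integral_gamma_scaled:
  assumes "\<alpha> > 0" "c > 0"
  shows "(\<integral>\<^sup>+w. ennreal (indicator {0..} w * w powr (\<alpha> - 1) * exp (- (w / c))) \<partial>lborel) = ennreal (Gamma \<alpha> * c powr \<alpha>)"
proof -
  have "(\<integral>\<^sup>+w. ennreal (indicator {0..} w * w powr (\<alpha> - 1) * exp (- (w / c))) \<partial>lborel)
     = ennreal \<bar>c\<bar> * (\<integral>\<^sup>+w. ennreal (indicator {0..} (0 + c * w) * (0 + c * w) powr (\<alpha> - 1) * exp (- ((0 + c * w) / c))) \<partial>lborel)"
    using assms by (intro nn_integral_real_affine) auto
  also have "(\<integral>\<^sup>+w. ennreal (indicator {0..} (0 + c * w) * (0 + c * w) powr (\<alpha> - 1) * exp (- ((0 + c * w) / c))) \<partial>lborel)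
      = (\<integral>\<^sup>+w. ennreal (c powr (\<alpha> - 1)) * ennreal (gamma_density \<alpha> w) \<partial>lborel)"
    using assms by (intro nn_integral_cong)
      (auto simp: gamma_density_def indicator_def powr_mult exp_minus field_simps zero_le_mult_iff simp flip: ennreal_mult)
  also have "\<dots> = ennreal (c powr (\<alpha> - 1)) * ennreal (Gamma \<alpha>)"
    using assms by (subst nn_integral_cmult) (auto simp: nn_integral_gamma_density)
  also have "ennreal \<bar>c\<bar> * \<dots> = ennreal (Gamma \<alpha> * c powr \<alpha>)"
    using assms Gamma_real_pos[of \<alpha>] by (simp add: powr_diff field_simps flip: ennreal_mult)
  finally show ?thesis .
qed

text \<open>This is the fact that \<open>u / (u + w)\<close> has a beta distribution when \<open>u\<close> and \<open>w\<close> are independent gamma variables.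
For fixed \<open>w\<close> the substitution \<open>u = w * x / (1 - x)\<close> maps the range \<open>x \<le> p\<close> to the cone; integrating over \<open>w\<close>
first then produces a Gamma function. The case \<open>p = 1\<close>, where the substitution is singular, is the product
of two Gamma integrals.\<close>

lemma nn_integral_gamma_cone:
  assumes \<alpha>: "\<alpha> > 0" and \<beta>: "\<beta> > 0" and p: "0 \<le> p" "p \<le> 1"
  shows "(\<integral>\<^sup>+w. \<integral>\<^sup>+u. ennreal (gamma_density \<beta> w * gamma_density \<alpha> u * indicator {..p * (u + w)} u) \<partial>lborel \<partial>lborel)
     = ennreal (Gamma (\<alpha> + \<beta>) * incomplete_Beta p \<alpha> \<beta>)" (is "?L = _")
proof (cases "p = 1")
  case True
  have "?L = (\<integral>\<^sup>+w. \<integral>\<^sup>+u. ennreal (gamma_density \<beta> w) * ennreal (gamma_density \<alpha> u) \<partial>lborel \<partial>lborel)"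
    using True by (intro nn_integral_cong) (auto simp: gamma_density_def indicator_def simp flip: ennreal_mult)
  also have "\<dots> = ennreal (Gamma \<beta>) * ennreal (Gamma \<alpha>)"
    using \<alpha> \<beta> by (simp add: nn_integral_cmult nn_integral_multc nn_integral_gamma_density)
  also have "\<dots> = ennreal (Gamma (\<alpha> + \<beta>) * incomplete_Beta p \<alpha> \<beta>)"
  proof -
    have ne: "Gamma (\<alpha> + \<beta>) \<noteq> 0" "Gamma \<alpha> \<ge> 0" "Gamma \<beta> \<ge> 0"
      using \<alpha> \<beta> Gamma_real_pos[of "\<alpha> + \<beta>"] Gamma_real_pos[of \<alpha>] Gamma_real_pos[of \<beta>] by linarith+
    show ?thesis
      using True \<alpha> \<beta> ne by (simp add: incomplete_Beta_1 Beta_def ne mult.commute flip: ennreal_mult)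
  qed
  finally show ?thesis .
next
  case False
  with p have p1: "p < 1" by simp
  define G where "G = (\<lambda>w x. ennreal (indicator {0..} w * w powr (\<alpha> + \<beta> - 1) * exp (- (w / (1 - x))))
     * ennreal (indicator {0..p} x * (x powr (\<alpha> - 1) * (1 - x) powr (- \<alpha> - 1))))"
  have inner: "(\<integral>\<^sup>+u. ennreal (gamma_density \<beta> w * gamma_density \<alpha> u * indicator {..p * (u + w)} u) \<partial>lborel)
      = (\<integral>\<^sup>+x. G w x \<partial>lborel)" for w
  proof (cases "w > 0")
    case w: True
    let ?g = "\<lambda>x. w * x / (1 - x)"
    have iff: "u \<le> p * (u + w) \<longleftrightarrow> u \<le> ?g p" for u using p1 by (simp add: field_simps)
    have "(\<integral>\<^sup>+u. ennreal (gamma_density \<beta> w * gamma_density \<alpha> u * indicator {..p * (u + w)} u) \<partial>lborel)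
      = (\<integral>\<^sup>+u. ennreal (gamma_density \<beta> w * u powr (\<alpha> - 1) / exp u * indicator {?g 0..?g p} u) \<partial>lborel)"
      by (intro nn_integral_cong) (auto simp: gamma_density_def iff indicator_def)
    also have "\<dots> = (\<integral>\<^sup>+x. ennreal (gamma_density \<beta> w * ?g x powr (\<alpha> - 1) / exp (?g x) * (w / (1 - x)\<^sup>2) * indicator {0..p} x) \<partial>lborel)"
    proof (rule nn_integral_substitution)
      show "continuous_on {0..p} (\<lambda>x. w / (1 - x)\<^sup>2)"
        using p1 by (intro continuous_intros) auto
      show "set_borel_measurable borel {?g 0..?g p} (\<lambda>u. gamma_density \<beta> w * u powr (\<alpha> - 1) / exp u)"
        unfolding set_borel_measurable_def by measurable
      show "(?g has_real_derivative w / (1 - x)\<^sup>2) (at x)" if "x \<in> {0..p}" for x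
        using that p1 by (auto intro!: derivative_eq_intros simp: power2_eq_square field_simps)
    qed (use w p in auto)
    also have "\<dots> = (\<integral>\<^sup>+x. G w x \<partial>lborel)"
    proof (intro nn_integral_cong)
      fix x
      show "ennreal (gamma_density \<beta> w * ?g x powr (\<alpha> - 1) / exp (?g x) * (w / (1 - x)\<^sup>2) * indicator {0..p} x) = G w x"
      proof (cases "x \<in> {0..p}")
        case True
        then have x: "0 \<le> x" "x < 1" using p1 by auto
        have e: "exp (- (w / (1 - x))) = 1 / (exp w * exp (?g x))"
        proof -
          have "w / (1 - x) = w + ?g x" using x by (simp add: field_simps)
          then have "exp (w / (1 - x)) = exp w * exp (?g x)" by (simp only: exp_add)
          moreover have "exp (- (w / (1 - x))) = 1 / exp (w / (1 - x))" by (simp add: exp_minus divide_inverse)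
          ultimately show ?thesis by (simp only:)
        qed
        have "?g x powr (\<alpha> - 1) = w powr (\<alpha> - 1) * x powr (\<alpha> - 1) / (1 - x) powr (\<alpha> - 1)"
          using x w by (simp add: powr_mult powr_divide)
        moreover have "w powr (\<alpha> + \<beta> - 1) = w powr (\<beta> - 1) * w powr (\<alpha> - 1) * w"
          using w by (simp add: powr_diff powr_add field_simps)
        moreover have "(1 - x) powr (- \<alpha> - 1) = 1 / ((1 - x) powr (\<alpha> - 1) * (1 - x)\<^sup>2)"
        proof -
          have "(1 - x) powr (\<alpha> - 1) * (1 - x)\<^sup>2 = (1 - x) powr (\<alpha> + 1)"
            using x powr_add[of "1 - x" "\<alpha> - 1" 2] by (simp add: add.commute)
          then show ?thesis using powr_minus_divide[of "1 - x" "\<alpha> + 1"] by simp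
        qed
        moreover have "a / c * (b * d / e) / f * (w / h) = a * b * w * (1 / (c * f)) * (d * (1 / (e * h)))"
          for a b c d e f h :: real
          by (simp add: divide_inverse mult_ac)
        ultimately have "w powr (\<beta> - 1) / exp w * ?g x powr (\<alpha> - 1) / exp (?g x) * (w / (1 - x)\<^sup>2)
          = w powr (\<alpha> + \<beta> - 1) * exp (- (w / (1 - x))) * (x powr (\<alpha> - 1) * (1 - x) powr (- \<alpha> - 1))"
          unfolding e by (simp only:)
        moreover have "G w x = ennreal (w powr (\<alpha> + \<beta> - 1) * exp (- (w / (1 - x))) * (x powr (\<alpha> - 1) * (1 - x) powr (- \<alpha> - 1)))"
          using True w x by (subst ennreal_mult) (auto simp: G_def)
        ultimately show ?thesis using True w by (simp add: gamma_density_def)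
      qed (simp add: G_def)
    qed
    finally show ?thesis .
  next
    case False
    then show ?thesis by (cases "w = 0") (auto simp: G_def gamma_density_def)
  qed
  have "?L = (\<integral>\<^sup>+w. \<integral>\<^sup>+x. G w x \<partial>lborel \<partial>lborel)"
    unfolding inner ..
  also have "\<dots> = (\<integral>\<^sup>+x. \<integral>\<^sup>+w. G w x \<partial>lborel \<partial>lborel)"
    unfolding G_def by (intro lborel_pair.Fubini') measurable
  also have "\<dots> = (\<integral>\<^sup>+x. ennreal (Gamma (\<alpha> + \<beta>)) * ennreal (indicator {0..p} x * (x powr (\<alpha> - 1) * (1 - x) powr (\<beta> - 1))) \<partial>lborel)"
  proof (intro nn_integral_cong)
    fix x
    show "(\<integral>\<^sup>+w. G w x \<partial>lborel) = ennreal (Gamma (\<alpha> + \<beta>)) * ennreal (indicator {0..p} x * (x powr (\<alpha> - 1) * (1 - x) powr (\<beta> - 1)))"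
    proof (cases "x \<in> {0..p}")
      case True
      then have x: "0 \<le> x" "x < 1" using p1 by auto
      have "(\<integral>\<^sup>+w. G w x \<partial>lborel) = ennreal (Gamma (\<alpha> + \<beta>) * (1 - x) powr (\<alpha> + \<beta>)) * ennreal (indicator {0..p} x * (x powr (\<alpha> - 1) * (1 - x) powr (- \<alpha> - 1)))"
        unfolding G_def using \<alpha> \<beta> x by (subst nn_integral_multc) (auto simp: nn_integral_gamma_scaled)
      also have "\<dots> = ennreal (Gamma (\<alpha> + \<beta>)) * ennreal (indicator {0..p} x * (x powr (\<alpha> - 1) * ((1 - x) powr (\<alpha> + \<beta>) * (1 - x) powr (- \<alpha> - 1))))"
        using \<alpha> \<beta> Gamma_real_pos[of "\<alpha> + \<beta>"] by (simp add: mult_ac flip: ennreal_mult)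
      also have "(1 - x) powr (\<alpha> + \<beta>) * (1 - x) powr (- \<alpha> - 1) = (1 - x) powr (\<beta> - 1)"
        by (simp flip: powr_add)
      finally show ?thesis .
    qed (simp add: G_def)
  qed
  also have "\<dots> = ennreal (Gamma (\<alpha> + \<beta>)) * ennreal (incomplete_Beta p \<alpha> \<beta>)"
  proof -
    have "((\<lambda>x. x powr (\<alpha> - 1) * (1 - x) powr (\<beta> - 1)) has_integral incomplete_Beta p \<alpha> \<beta>) {0..p}"
      unfolding incomplete_Beta_def
      by (intro integrable_integral integrable_subinterval_real[OF Beta_integrand_integrable[OF \<alpha> \<beta>]]) (use p in auto)
    from nn_integral_has_integral_lebesgue[OF _ this]
    show ?thesis by (subst nn_integral_cmult) auto
  qed
  also have "\<dots> = ennreal (Gamma (\<alpha> + \<beta>) * incomplete_Beta p \<alpha> \<beta>)"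
    using \<alpha> \<beta> Gamma_real_pos[of "\<alpha> + \<beta>"] by (simp add: incomplete_Beta_nonneg flip: ennreal_mult)
  finally show ?thesis .
qed

section \<open>Sums of squares of coordinates under Lebesgue measure\<close>

text \<open>The image of Lebesgue measure under the squared norm: the set where it is at most \<open>r\<close> is a ball, and the
density is the derivative of the volume of that ball with respect to \<open>r\<close>.\<close>

lemma distr_sum_squares:
  fixes A :: "'i set"
  assumes A: "finite A" "A \<noteq> {}"
  shows "distr (Pi\<^sub>M A (\<lambda>_. lborel)) borel (\<lambda>f. \<Sum>i\<in>A. (f i)\<^sup>2)
     = density lborel (\<lambda>u. ennreal (indicator {0..} u * (unit_ball_vol (real (card A)) * (real (card A) / 2) * u powr (real (card A) / 2 - 1))))"
    (is "?M = ?N")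
proof (rule measure_eqI_generator_eq[where E = "range (\<lambda>r::real. {..r})" and \<Omega> = UNIV and A = "\<lambda>n. {..real n}"])
  define k where "k = real (card A) / 2"
  define v where "v = unit_ball_vol (real (card A))"
  have k: "k > 0" using A by (simp add: k_def card_gt_0_iff)
  have v: "v > 0" unfolding v_def by simp
  have N: "emeasure ?N {..r} = ennreal (v * max 0 r powr k)" for r
  proof (cases "r < 0")
    case True
    have "emeasure ?N {..r} = (\<integral>\<^sup>+(u::real). 0 \<partial>lborel)"
    proof (subst emeasure_density)
      show "(\<integral>\<^sup>+u. ennreal (indicator {0..} u * (unit_ball_vol (real (card A)) * (real (card A) / 2) * u powr (real (card A) / 2 - 1))) * indicator {..r} u \<partial>lborel) = (\<integral>\<^sup>+(u::real). 0 \<partial>lborel)"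
        using True by (intro nn_integral_cong) (auto simp: indicator_def)
    qed auto
    then show ?thesis using True k by simp
  next
    case False
    have "((\<lambda>u. v * k * u powr (k - 1)) has_integral (v * k * (r powr (k - 1 + 1) / (k - 1 + 1)))) {0..r}"
      using k False by (intro has_integral_mult_right has_integral_powr_from_0) auto
    from nn_integral_has_integral_lebesgue[OF _ this]
    have "(\<integral>\<^sup>+u. ennreal (indicator {0..r} u * (v * k * u powr (k - 1))) \<partial>lborel) = ennreal (v * r powr k)"
      using k v by simp
    moreover have "emeasure ?N {..r} = (\<integral>\<^sup>+u. ennreal (indicator {0..r} u * (v * k * u powr (k - 1))) \<partial>lborel)"
      by (subst emeasure_density) (auto intro!: nn_integral_cong simp: indicator_def v_def k_def)
    ultimately show ?thesis using False by simp
  qed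
  have meas: "(\<lambda>f. \<Sum>i\<in>A. (f i :: real)\<^sup>2) \<in> borel_measurable (Pi\<^sub>M A (\<lambda>_. lborel))"
  proof (intro borel_measurable_sum borel_measurable_power)
    fix i assume "i \<in> A"
    from measurable_component_singleton[OF this, of "\<lambda>_. lborel :: real measure"]
    show "(\<lambda>f. f i) \<in> borel_measurable (Pi\<^sub>M A (\<lambda>_. lborel :: real measure))" by simp
  qed
  have Mpos: "emeasure ?M {..r} = ennreal (v * r powr k)" if r: "r > 0" for r
  proof -
    have "emeasure ?M {..r} = emeasure (Pi\<^sub>M A (\<lambda>_. lborel)) ((\<lambda>f. \<Sum>i\<in>A. (f i)\<^sup>2) -` {..r} \<inter> space (Pi\<^sub>M A (\<lambda>_. lborel)))"
      by (rule emeasure_distr[OF meas]) simp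
    also have "(\<lambda>f. \<Sum>i\<in>A. (f i)\<^sup>2) -` {..r} = {f. sqrt (\<Sum>i\<in>A. (f i)\<^sup>2) \<le> sqrt r}"
      by auto
    also have "emeasure (Pi\<^sub>M A (\<lambda>_. lborel)) (\<dots> \<inter> space (Pi\<^sub>M A (\<lambda>_. lborel))) = ennreal (v * sqrt r ^ card A)"
      unfolding v_def using r A by (intro emeasure_cball_aux) auto
    also have "sqrt r ^ card A = r powr k"
      using r by (simp add: k_def powr_half_sqrt[symmetric] powr_powr flip: powr_realpow)
    finally show ?thesis .
  qed
  have M: "emeasure ?M {..r} = ennreal (v * max 0 r powr k)" for r
  proof (cases "r > 0")
    case False
    have "\<forall>\<^sub>F e in at_right (0::real). 0 \<le> e"
      by (rule eventually_mono[OF eventually_at_right_less]) simp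
    then have "((\<lambda>e. ennreal (v * e powr k)) \<longlongrightarrow> ennreal (v * 0 powr k)) (at_right 0)"
      using k v by (intro tendsto_ennrealI tendsto_intros tendsto_powr') auto
    moreover have "\<forall>\<^sub>F e in at_right 0. emeasure ?M {..r} \<le> ennreal (v * e powr k)"
      using False Mpos by (auto simp: eventually_at_right_field intro!: exI[of _ 1] simp flip: Mpos intro!: emeasure_mono)
    ultimately have "emeasure ?M {..r} \<le> ennreal (v * 0 powr k)"
      by (intro tendsto_lowerbound) auto
    then show ?thesis using False k by simp
  qed (simp add: Mpos)
  show "emeasure ?M X = emeasure ?N X" if "X \<in> range (\<lambda>r::real. {..r})" for X
    using that M N by auto
  show "emeasure ?M {..real i} \<noteq> \<infinity>" for i unfolding M by simp
  have b: "sets (borel :: real measure) = sigma_sets UNIV (range (\<lambda>r::real. {..r}))"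
    unfolding borel_eq_atMost by (rule sets_measure_of) simp
  show "sets ?M = sigma_sets UNIV (range (\<lambda>r::real. {..r}))" "sets ?N = sigma_sets UNIV (range (\<lambda>r::real. {..r}))"
    using b by simp_all
  show "Int_stable (range (\<lambda>r::real. {..r}))"
    by (auto simp: Int_stable_def)
  show "(\<Union>i. {..real i}) = UNIV"
    by (auto simp: real_arch_simple)
qed auto

section \<open>The rotation invariant measure as the image of a Gaussian weight\<close>

lemma distr_lborel_orthogonal:
  fixes f :: "real^'n::{finite,wellorder} \<Rightarrow> real^'n::_"
  assumes f: "orthogonal_transformation f"
  shows "distr lborel borel f = lborel"
proof (rule lborel_eqI[symmetric])
  fix l u :: "real^'n::_" assume lu: "\<And>b. b \<in> Basis \<Longrightarrow> l \<bullet> b \<le> u \<bullet> b"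
  have fm: "f \<in> borel_measurable borel" by (rule orthogonal_transformation_measurable[OF f])
  have bij: "bij f" by (rule orthogonal_transformation_bij[OF f])
  have g: "orthogonal_transformation (inv f)" by (rule orthogonal_transformation_inv[OF f])
  have im: "f -` box l u = inv f ` box l u" using bij by (simp add: bij_vimage_eq_inv_image)
  have "box l u \<in> lmeasurable" by simp
  then have m: "measure lebesgue (inv f ` box l u) = measure lebesgue (box l u)"
    by (rule measure_orthogonal_image[OF g])
  have meas: "f -` box l u \<in> sets borel" using measurable_sets[OF fm, of "box l u"] by simp
  have "bounded (inv f ` box l u)"
    using g bounded_box[of l u] orthogonal_transformation_linear[OF g]
    by (intro bounded_linear_image) (auto simp: linear_conv_bounded_linear)
  then have "emeasure lborel (f -` box l u) \<noteq> \<infinity>"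
    unfolding im[symmetric] using emeasure_bounded_finite by (auto simp: less_top)
  moreover have "emeasure lborel (box l u) \<noteq> \<infinity>"
    using emeasure_bounded_finite[OF bounded_box, of l u] by (auto simp: less_top)
  ultimately have "emeasure lborel (f -` box l u) = emeasure lborel (box l u)"
    using m meas unfolding im[symmetric] by (simp add: emeasure_eq_ennreal_measure)
  then show "emeasure (distr lborel borel f) (box l u) = (\<Prod>b\<in>Basis. (u - l) \<bullet> b)"
    using lu fm by (subst emeasure_distr) (auto simp: emeasure_lborel_box)
qed simp

text \<open>Any rotation invariant finite weight would represent the sphere measure. The factor \<open>(norm x)\<^sup>2\<close> is
chosen because it cancels against the normalization in quadratic forms of \<open>sgn x\<close>: their sphere integrals
become plain Gaussian integrals, and direction and length need not be separated.\<close>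

definition radial_weight :: "'a::euclidean_space \<Rightarrow> ennreal" where
  "radial_weight x = ennreal ((norm x)\<^sup>2 * exp (- (norm x)\<^sup>2))"

lemma radial_weight_measurable [measurable]: "radial_weight \<in> borel_measurable borel"
  unfolding radial_weight_def by measurable

lemma rotation_invariant_sphere_measure:
  "rotation_invariant_sphere (sphere_measure :: (real^'n::{finite,wellorder}) measure)"
  by (simp add: rotation_invariant_sphere_iff)

text \<open>Lebesgue measure and the weight are invariant under orthogonal maps, and \<open>sgn\<close> commutes with them. So the
image of the normalized weight under \<open>sgn\<close> is a rotation invariant probability measure on the sphere, and
there is only one.\<close>

lemma nn_integral_sphere_measure:
  fixes h :: "real^'n::{finite,wellorder} \<Rightarrow> ennreal"
  assumes h[measurable]: "h \<in> borel_measurable borel"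
    and Z: "(\<integral>\<^sup>+x. radial_weight (x :: real^'n::_) \<partial>lborel) = Z" "Z \<noteq> 0" "Z \<noteq> \<infinity>"
  shows "(\<integral>\<^sup>+\<xi>. h \<xi> \<partial>sphere_measure) = (\<integral>\<^sup>+x. h (sgn x) * radial_weight x \<partial>lborel) / Z"
proof -
  define e where "e = (axis undefined 1 :: real^'n::_)"
  \<comment> \<open>\<open>sgn 0\<close> does not lie on the sphere; the origin has measure zero and may go to any point of it.\<close>
  define sg where "sg = (\<lambda>x. if x = 0 then e else sgn (x :: real^'n::_))"
  define S where "S = restrict_space borel (sphere (0::real^'n::_) 1)"
  define \<nu> where "\<nu> = density lborel (\<lambda>x. radial_weight (x :: real^'n::_) / Z)"
  define N where "N = distr \<nu> S sg"
  have sgb: "sg \<in> borel_measurable borel" unfolding sg_def by measurable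
  have "sg \<in> measurable borel S"
    unfolding S_def using sgb by (intro measurable_restrict_space2) (auto simp: sg_def e_def norm_sgn)
  then have sg: "sg \<in> measurable \<nu> S" by (simp add: \<nu>_def)
  have sets\<nu>: "sets \<nu> = sets borel" "space \<nu> = UNIV" by (auto simp: \<nu>_def)
  have "rotation_invariant_sphere N"
    unfolding rotation_invariant_sphere_def
  proof (intro conjI allI impI)
    have "emeasure \<nu> UNIV = 1"
      unfolding \<nu>_def using Z by (simp add: emeasure_density nn_integral_divide ennreal_divide_self less_top)
    then have "prob_space \<nu>" by (intro prob_spaceI) (simp add: sets\<nu>)
    then show "prob_space N" unfolding N_def by (rule prob_space.prob_space_distr[OF _ sg])
    show "sets N = sets (restrict_space borel (sphere 0 1))" by (simp add: N_def S_def)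
    fix f :: "real^'n::_ \<Rightarrow> real^'n::_" assume f: "orthogonal_transformation f"
    have fb: "f \<in> borel_measurable borel" by (rule orthogonal_transformation_measurable[OF f])
    have fS: "f \<in> measurable S S" unfolding S_def by (rule orthogonal_transformation_measurable_sphere[OF f])
    have lin: "linear f" and nf: "\<And>x. norm (f x) = norm x"
      using f by (auto simp: orthogonal_transformation)
    have "density (distr lborel borel f) (\<lambda>x. radial_weight x / Z) = distr (density lborel (\<lambda>x. radial_weight (f x) / Z)) borel f"
      using fb by (intro density_distr) measurable
    then have inv: "distr \<nu> borel f = \<nu>"
      by (simp add: \<nu>_def distr_lborel_orthogonal[OF f] radial_weight_def nf)
    have "distr N N f = distr N S f" by (rule distr_cong) (auto simp: N_def)
    also have "\<dots> = distr \<nu> S (f \<circ> sg)"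
      unfolding N_def by (rule distr_distr[OF fS sg])
    also have "\<dots> = distr \<nu> S (sg \<circ> f)"
    proof (rule distr_cong_AE)
      have "AE x in lborel. x \<noteq> (0::real^'n::_)" by (rule AE_lborel_singleton)
      then show "AE x in \<nu>. (f \<circ> sg) x = (sg \<circ> f) x"
        unfolding \<nu>_def
      proof (subst AE_density, measurable, eventually_elim)
        case (elim x)
        then have "f x \<noteq> 0" using nf[of x] by (metis norm_eq_zero)
        then show ?case using elim lin by (auto simp: sg_def sgn_div_norm nf linear_scale)
      qed
      show "f \<circ> sg \<in> measurable \<nu> S" using sg fS by (rule measurable_comp)
      have "f \<in> measurable \<nu> \<nu>" using fb by (simp add: measurable_cong_sets[OF sets\<nu>(1) sets\<nu>(1)])
      then show "sg \<circ> f \<in> measurable \<nu> S" using sg by (rule measurable_comp)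
    qed auto
    also have "\<dots> = distr (distr \<nu> borel f) S sg"
      using fb sg by (subst distr_distr) (auto simp: measurable_cong_sets[OF sets\<nu>(1) refl])
    also have "\<dots> = N" unfolding inv N_def ..
    finally show "distr N N f = N" .
  qed
  then have N: "sphere_measure = N" by (simp add: rotation_invariant_sphere_iff)
  have "(\<integral>\<^sup>+\<xi>. h \<xi> \<partial>sphere_measure) = (\<integral>\<^sup>+x. h (sg x) \<partial>\<nu>)"
    unfolding N N_def
    by (rule nn_integral_distr[OF sg]) (simp add: S_def measurable_restrict_space1)
  also have "\<dots> = (\<integral>\<^sup>+x. radial_weight x / Z * h (sg x) \<partial>lborel)"
    unfolding \<nu>_def using sgb by (subst nn_integral_density) (auto intro!: measurable_compose[OF _ h])
  also have "\<dots> = (\<integral>\<^sup>+x. h (sgn x) * radial_weight x / Z \<partial>lborel)"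
    by (intro nn_integral_cong) (auto simp: sg_def radial_weight_def divide_ennreal_def mult_ac)
  also have "\<dots> = (\<integral>\<^sup>+x. h (sgn x) * radial_weight x \<partial>lborel) / Z"
    by (intro nn_integral_divide) measurable
  finally show ?thesis .
qed

section \<open>Moments of cones in the sphere\<close>

definition square_sum :: "'n set \<Rightarrow> real^'n::finite \<Rightarrow> real" where
  "square_sum A x = (\<Sum>i\<in>A. (x $ i)\<^sup>2)"

definition square_sum_density :: "nat \<Rightarrow> real \<Rightarrow> ennreal" where
  "square_sum_density k u = ennreal (indicator {0..} u * (unit_ball_vol (real k) * (real k / 2) * u powr (real k / 2 - 1)))"

lemma square_sum_density_measurable [measurable]: "square_sum_density k \<in> borel_measurable borel"
  unfolding square_sum_density_def by measurable

text \<open>Lebesgue measure is a product measure, so the coordinates in \<open>S\<close> and those in \<open>- S\<close> can be integrated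
separately, and each group enters only through its sum of squares.\<close>

lemma nn_integral_square_sums:
  fixes S :: "'n::finite set" and h :: "real \<Rightarrow> real \<Rightarrow> ennreal"
  assumes S: "S \<noteq> {}" "- S \<noteq> {}" and h[measurable]: "case_prod h \<in> borel_measurable (borel \<Otimes>\<^sub>M borel)"
  shows "(\<integral>\<^sup>+x. h (square_sum S x) (square_sum (- S) x) \<partial>lborel)
     = (\<integral>\<^sup>+w. \<integral>\<^sup>+u. h u w * square_sum_density (card S) u * square_sum_density (card (- S)) w \<partial>lborel \<partial>lborel)"
proof -
  define B where "B = (\<lambda>A. (\<lambda>i. axis i (1::real) :: real^'n) ` A)"
  have inj: "inj_on (\<lambda>i. axis i (1::real) :: real^'n) A" for A by (auto simp: inj_on_def axis_eq_axis)
  have Basis: "(Basis :: (real^'n) set) = B (- S) \<union> B S" by (auto simp: Basis_vec_def B_def)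
  have disj: "B (- S) \<inter> B S = {}" by (auto simp: B_def axis_eq_axis)
  have card: "card (B A) = card A" "finite (B A)" for A by (auto simp: B_def card_image[OF inj])
  let ?P = "\<lambda>A. Pi\<^sub>M (B A) (\<lambda>_. lborel :: real measure)"
  interpret product_sigma_finite "\<lambda>_ :: real^'n. lborel :: real measure" by standard
  define q where "q = (\<lambda>A f. \<Sum>b\<in>B A. (f b :: real)\<^sup>2)"
  have qm: "q A \<in> borel_measurable (Pi\<^sub>M C (\<lambda>_. lborel))" if "B A \<subseteq> C" for A C
    unfolding q_def
  proof (intro borel_measurable_sum borel_measurable_power)
    fix i assume "i \<in> B A"
    with that have "i \<in> C" by auto
    from measurable_component_singleton[OF this, of "\<lambda>_. lborel :: real measure"]
    show "(\<lambda>f. f i) \<in> borel_measurable (Pi\<^sub>M C (\<lambda>_. lborel :: real measure))" by simp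
  qed
  have law: "distr (?P A) borel (q A) = density lborel (square_sum_density (card A))"
    if "A \<noteq> {}" for A
  proof -
    have "B A \<noteq> {}" using that by (simp add: B_def)
    from distr_sum_squares[OF card(2) this] show ?thesis
      unfolding card(1) by (simp add: q_def[abs_def] square_sum_density_def[abs_def])
  qed
  have sq: "square_sum A (\<Sum>b\<in>Basis. f b *\<^sub>R b) = q A f" for A f
  proof -
    have "(\<Sum>b\<in>Basis. f b *\<^sub>R b) $ i = f (axis i 1)" for i :: 'n
    proof -
      have "(\<Sum>b\<in>Basis. f b *\<^sub>R b) $ i = (\<Sum>b\<in>Basis. f b *\<^sub>R b) \<bullet> axis i 1"
        by (simp add: inner_axis)
      also have "\<dots> = f (axis i 1)" by (subst inner_sum_left_Basis) (auto simp: Basis_vec_def)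
      finally show ?thesis .
    qed
    then show ?thesis by (simp add: square_sum_def q_def B_def sum.reindex[OF inj])
  qed
  have hq: "(\<lambda>f. h (q S f) (q (- S) f)) \<in> borel_measurable (Pi\<^sub>M Basis (\<lambda>_. lborel))"
  proof -
    have "B S \<subseteq> Basis" "B (- S) \<subseteq> Basis" by (auto simp: Basis)
    from measurable_compose[OF measurable_Pair[OF qm[OF this(1)] qm[OF this(2)]] h]
    show ?thesis by simp
  qed
  have sqm: "square_sum A \<in> borel_measurable borel" for A :: "'n set"
    unfolding square_sum_def by measurable
  have "(\<integral>\<^sup>+x. h (square_sum S x) (square_sum (- S) x) \<partial>lborel)
      = (\<integral>\<^sup>+f. h (q S f) (q (- S) f) \<partial>Pi\<^sub>M Basis (\<lambda>_. lborel))"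
    by (subst lborel_eq, subst nn_integral_distr)
      (auto simp: sq intro!: measurable_compose[OF measurable_Pair[OF sqm sqm] h, simplified])
  also have "\<dots> = (\<integral>\<^sup>+y. \<integral>\<^sup>+x. h (q S (merge (B (- S)) (B S) (y, x))) (q (- S) (merge (B (- S)) (B S) (y, x)))
       \<partial>?P S \<partial>?P (- S))"
    unfolding Basis using hq card unfolding Basis by (intro product_nn_integral_fold[OF disj]) auto
  also have "\<dots> = (\<integral>\<^sup>+y. \<integral>\<^sup>+x. h (q S x) (q (- S) y) \<partial>?P S \<partial>?P (- S))"
  proof (intro nn_integral_cong)
    fix x y :: "real^'n \<Rightarrow> real"
    have "q S (merge (B (- S)) (B S) (y, x)) = q S x"
      unfolding q_def using disj by (intro sum.cong) (auto simp: merge_def)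
    moreover have "q (- S) (merge (B (- S)) (B S) (y, x)) = q (- S) y"
      unfolding q_def by (intro sum.cong) (auto simp: merge_def)
    ultimately show "h (q S (merge (B (- S)) (B S) (y, x))) (q (- S) (merge (B (- S)) (B S) (y, x))) = h (q S x) (q (- S) y)"
      by simp
  qed
  also have "\<dots> = (\<integral>\<^sup>+y. (\<lambda>w. \<integral>\<^sup>+u. h u w \<partial>distr (?P S) borel (q S)) (q (- S) y) \<partial>?P (- S))"
    by (intro nn_integral_cong) (simp add: nn_integral_distr[OF qm])
  also have "\<dots> = (\<integral>\<^sup>+y. (\<integral>\<^sup>+u. h u (q (- S) y) * square_sum_density (card S) u \<partial>lborel) \<partial>?P (- S))"
    unfolding law[OF S(1)] by (intro nn_integral_cong) (simp add: nn_integral_density mult.commute)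
  also have "\<dots> = (\<integral>\<^sup>+w. (\<integral>\<^sup>+u. h u w * square_sum_density (card S) u \<partial>lborel) \<partial>distr (?P (- S)) borel (q (- S)))"
    by (subst nn_integral_distr[OF qm]) auto
  also have "\<dots> = (\<integral>\<^sup>+w. square_sum_density (card (- S)) w * (\<integral>\<^sup>+u. h u w * square_sum_density (card S) u \<partial>lborel) \<partial>lborel)"
    unfolding law[OF S(2)] by (simp add: nn_integral_density)
  also have "\<dots> = (\<integral>\<^sup>+w. \<integral>\<^sup>+u. h u w * square_sum_density (card S) u * square_sum_density (card (- S)) w \<partial>lborel \<partial>lborel)"
    by (intro nn_integral_cong, subst nn_integral_multc) (auto simp: mult.commute)
  finally show ?thesis .
qed

lemma square_sum_measurable [measurable]: "square_sum A \<in> borel_measurable borel"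
  unfolding square_sum_def[abs_def] by measurable

lemma square_sum_nonneg [simp]: "0 \<le> square_sum A x"
  by (simp add: square_sum_def sum_nonneg)

lemma square_sum_Compl: "square_sum A x + square_sum (- A) x = (norm x)\<^sup>2"
proof -
  have "square_sum A x + square_sum (- A) x = square_sum UNIV x"
    unfolding square_sum_def by (subst sum.union_disjoint[symmetric]) auto
  then show ?thesis
    by (simp add: square_sum_def norm_vec_def L2_set_def sum_nonneg)
qed

lemma square_sum_sgn: "x \<noteq> 0 \<Longrightarrow> square_sum A (sgn x) = square_sum A x / (norm x)\<^sup>2"
  by (simp add: square_sum_def sgn_div_norm power_mult_distrib sum_divide_distrib divide_inverse
      mult.commute power_inverse sum_distrib_left)

text \<open>An extra factor \<open>w\<close> or \<open>u\<close> in a gamma integral raises the corresponding exponent by one. Both moments are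
therefore instances of the same cone integral with shifted parameters.\<close>

lemma gaussian_cone_moments:
  fixes S :: "'n::finite set"
  defines "\<alpha> \<equiv> real (card S) / 2" and "\<beta> \<equiv> real (card (- S)) / 2"
  defines "K \<equiv> unit_ball_vol (real (card S)) * \<alpha> * (unit_ball_vol (real (card (- S))) * \<beta>)"
  assumes S: "S \<noteq> {}" "- S \<noteq> {}" and p: "0 \<le> p" "p \<le> 1"
  shows "(\<integral>\<^sup>+x. ennreal (if square_sum S x \<le> p * (norm x)\<^sup>2 then square_sum (- S) x * exp (- (norm x)\<^sup>2) else 0) \<partial>lborel)
           = ennreal (K * (Gamma (\<alpha> + \<beta> + 1) * incomplete_Beta p \<alpha> (\<beta> + 1)))" (is ?T)
    and "(\<integral>\<^sup>+x. ennreal (if square_sum S x \<le> p * (norm x)\<^sup>2 then square_sum S x * exp (- (norm x)\<^sup>2) else 0) \<partial>lborel)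
           = ennreal (K * (Gamma (\<alpha> + \<beta> + 1) * incomplete_Beta p (\<alpha> + 1) \<beta>))" (is ?S)
proof -
  have pos: "\<alpha> > 0" "\<beta> > 0" using S by (auto simp: \<alpha>_def \<beta>_def card_gt_0_iff)
  have K: "K \<ge> 0" using pos by (simp add: K_def)
  have g: "Gamma (\<alpha> + \<beta> + 1) \<ge> 0" using pos by (intro less_imp_le Gamma_real_pos) auto
  have dens: "square_sum_density (card S) u * square_sum_density (card (- S)) w = ennreal (K * (indicator {0..} u * u powr (\<alpha> - 1) * (indicator {0..} w * w powr (\<beta> - 1))))" for u w
    unfolding square_sum_density_def using pos
    by (subst ennreal_mult[symmetric]) (auto simp: \<alpha>_def \<beta>_def K_def)
  have e: "exp (- (u + w)) = 1 / (exp u * exp w)" for u w :: real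
    unfolding exp_minus exp_add by (simp add: divide_inverse)
  have main: "(\<integral>\<^sup>+x. ennreal (if square_sum S x \<le> p * (norm x)\<^sup>2 then g (square_sum S x) (square_sum (- S) x) * exp (- (norm x)\<^sup>2) else 0) \<partial>lborel)
       = ennreal (K * (Gamma (\<alpha>' + \<beta>') * incomplete_Beta p \<alpha>' \<beta>'))"
    if [measurable]: "case_prod g \<in> borel_measurable (borel \<Otimes>\<^sub>M borel)" and ab: "\<alpha>' > 0" "\<beta>' > 0"
      and g: "\<And>u w. 0 \<le> u \<Longrightarrow> 0 \<le> w \<Longrightarrow> g u w * (u powr (\<alpha> - 1) * w powr (\<beta> - 1)) = u powr (\<alpha>' - 1) * w powr (\<beta>' - 1) \<and> 0 \<le> g u w"
    for g :: "real \<Rightarrow> real \<Rightarrow> real" and \<alpha>' \<beta>'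
  proof -
    have G0: "Gamma (\<alpha>' + \<beta>') \<ge> 0" using ab by (intro less_imp_le Gamma_real_pos) auto
    let ?F = "\<lambda>w u. ennreal (gamma_density \<beta>' w * gamma_density \<alpha>' u * indicator {..p * (u + w)} u)"
    define h where "h = (\<lambda>u w. ennreal (if u \<le> p * (u + w) then g u w * exp (- (u + w)) else 0))"
    have "case_prod h \<in> borel_measurable (borel \<Otimes>\<^sub>M borel)" unfolding h_def by measurable
    from nn_integral_square_sums[OF S this]
    have "(\<integral>\<^sup>+x. h (square_sum S x) (square_sum (- S) x) \<partial>lborel)
       = (\<integral>\<^sup>+w. \<integral>\<^sup>+u. ennreal K * ?F w u \<partial>lborel \<partial>lborel)"
    proof (rule trans, intro nn_integral_cong)
      fix u w :: real
      show "h u w * square_sum_density (card S) u * square_sum_density (card (- S)) w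
         = ennreal K * ?F w u"
      proof (cases "0 \<le> u \<and> 0 \<le> w")
        case True
        then have gg: "g u w * (u powr (\<alpha> - 1) * w powr (\<beta> - 1)) = u powr (\<alpha>' - 1) * w powr (\<beta>' - 1)" "0 \<le> g u w"
          using g[of u w] by auto
        have "h u w * (square_sum_density (card S) u * square_sum_density (card (- S)) w)
          = ennreal (K * ((g u w * (u powr (\<alpha> - 1) * w powr (\<beta> - 1))) * (1 / (exp u * exp w)) * indicator {..p * (u + w)} u))"
          unfolding dens h_def e using K True gg(2)
          by (subst ennreal_mult[symmetric]) (auto simp: indicator_def)
        also have "\<dots> = ennreal (K * (gamma_density \<beta>' w * gamma_density \<alpha>' u * indicator {..p * (u + w)} u))"
          unfolding gg(1) using True by (simp add: gamma_density_def mult_ac)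
        finally show ?thesis using K by (simp add: mult.assoc ennreal_mult)
      next
        case False
        then have "square_sum_density (card S) u * square_sum_density (card (- S)) w = 0"
          unfolding dens by auto
        moreover have "gamma_density \<beta>' w * gamma_density \<alpha>' u = 0" using False by (auto simp: gamma_density_def)
        ultimately show ?thesis by (auto simp: mult.assoc)
      qed
    qed
    also have "\<dots> = ennreal K * (\<integral>\<^sup>+w. \<integral>\<^sup>+u. ?F w u \<partial>lborel \<partial>lborel)"
    proof -
      have ind: "indicator {..p * (u + w)} u = (if u \<le> p * (u + w) then 1 else 0 :: real)" for u w by simp
      have m1: "(\<lambda>u. ?F w u) \<in> borel_measurable lborel" for w
        unfolding ind by measurable
      have m2: "(\<lambda>w. \<integral>\<^sup>+u. ?F w u \<partial>lborel) \<in> borel_measurable lborel"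
        unfolding ind by measurable
      show ?thesis unfolding nn_integral_cmult[OF m1] nn_integral_cmult[OF m2] ..
    qed
    also have "\<dots> = ennreal (K * (Gamma (\<alpha>' + \<beta>') * incomplete_Beta p \<alpha>' \<beta>'))"
      unfolding nn_integral_gamma_cone[OF ab p] using K G0 by (simp add: ennreal_mult incomplete_Beta_nonneg)
    finally show ?thesis unfolding h_def square_sum_Compl .
  qed
  have "(\<integral>\<^sup>+x. ennreal (if square_sum S x \<le> p * (norm x)\<^sup>2 then (\<lambda>u w. w) (square_sum S x) (square_sum (- S) x) * exp (- (norm x)\<^sup>2) else 0) \<partial>lborel)
       = ennreal (K * (Gamma (\<alpha> + (\<beta> + 1)) * incomplete_Beta p \<alpha> (\<beta> + 1)))"
    by (rule main) (use pos in \<open>auto simp: powr_mult_base\<close>)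
  then show ?T by (simp add: add.assoc)
  have "(\<integral>\<^sup>+x. ennreal (if square_sum S x \<le> p * (norm x)\<^sup>2 then (\<lambda>u w. u) (square_sum S x) (square_sum (- S) x) * exp (- (norm x)\<^sup>2) else 0) \<partial>lborel)
       = ennreal (K * (Gamma ((\<alpha> + 1) + \<beta>) * incomplete_Beta p (\<alpha> + 1) \<beta>))"
    by (rule main) (use pos in \<open>auto simp: powr_mult_base simp flip: mult.assoc\<close>)
  then show ?S by (simp add: add_ac)
qed

text \<open>The quotient of the Gaussian moment and the total weight. The total weight is the sum of both moments at
\<open>p = 1\<close>; the Gamma factor and the ball volumes cancel.\<close>

lemma sphere_cone_moments:
  fixes S :: "'n::{finite,wellorder} set"
  defines "\<alpha> \<equiv> real (card S) / 2" and "\<beta> \<equiv> real (card (- S)) / 2"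
  assumes S: "S \<noteq> {}" "- S \<noteq> {}" and p: "0 \<le> p" "p \<le> 1"
  shows "(\<integral>\<^sup>+\<xi>. ennreal (if square_sum S \<xi> \<le> p then square_sum (- S) \<xi> else 0) \<partial>sphere_measure)
           = ennreal (\<beta> / (\<alpha> + \<beta>) * regularized_Beta p \<alpha> (\<beta> + 1))" (is ?T)
    and "(\<integral>\<^sup>+\<xi>. ennreal (if square_sum S \<xi> \<le> p then square_sum S \<xi> else 0) \<partial>sphere_measure)
           = ennreal (\<alpha> / (\<alpha> + \<beta>) * regularized_Beta p (\<alpha> + 1) \<beta>)" (is ?S)
proof -
  have pos: "\<alpha> > 0" "\<beta> > 0" using S by (auto simp: \<alpha>_def \<beta>_def card_gt_0_iff)
  define K where "K = unit_ball_vol (real (card S)) * \<alpha> * (unit_ball_vol (real (card (- S))) * \<beta>) * Gamma (\<alpha> + \<beta> + 1)"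
  have K: "K > 0" unfolding K_def using pos by (intro mult_pos_pos Gamma_real_pos) auto
  define B where "B = Beta \<alpha> \<beta>"
  have B: "B > 0" unfolding B_def using pos by (rule Beta_real_pos)
  note mom = gaussian_cone_moments[OF S, folded \<alpha>_def \<beta>_def, folded mult.assoc[of _ "Gamma _"], folded K_def]
  have sum1: "square_sum S x \<le> 1 * (norm x)\<^sup>2" for x :: "real^'n::_"
    using square_sum_Compl[of S x] square_sum_nonneg[of "- S" x] by linarith
  have "(\<integral>\<^sup>+x. radial_weight (x :: real^'n::_) \<partial>lborel)
     = (\<integral>\<^sup>+x. ennreal (if square_sum S x \<le> 1 * (norm x)\<^sup>2 then square_sum (- S) x * exp (- (norm x)\<^sup>2) else 0) +
        ennreal (if square_sum S x \<le> 1 * (norm x)\<^sup>2 then square_sum S x * exp (- (norm x)\<^sup>2) else 0) \<partial>lborel)"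
    using sum1 by (intro nn_integral_cong)
      (auto simp: radial_weight_def distrib_right[symmetric] add.commute square_sum_Compl[of S, symmetric] simp flip: ennreal_plus)
  also have "\<dots> = ennreal (K * incomplete_Beta 1 \<alpha> (\<beta> + 1)) + ennreal (K * incomplete_Beta 1 (\<alpha> + 1) \<beta>)"
    using mom[of 1] by (subst nn_integral_add) (auto simp: mult.assoc)
  also have "\<dots> = ennreal (K * B)"
    using incomplete_Beta_add[of \<alpha> \<beta> 1] pos K
    by (subst ennreal_plus[symmetric]) (auto simp: incomplete_Beta_1 B_def distrib_left[symmetric] less_imp_le[OF Beta_real_pos])
  finally have Z: "(\<integral>\<^sup>+x. radial_weight (x :: real^'n::_) \<partial>lborel) = ennreal (K * B)" .
  have Z0: "ennreal (K * B) \<noteq> 0" "ennreal (K * B) \<noteq> \<infinity>" using K B by auto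
  let ?h = "\<lambda>A (x :: real^'n::_). ennreal (if square_sum S x \<le> p * (norm x)\<^sup>2 then square_sum A x * exp (- (norm x)\<^sup>2) else 0)"
  have red: "(\<integral>\<^sup>+\<xi>. ennreal (if square_sum S \<xi> \<le> p then square_sum A \<xi> else 0) \<partial>sphere_measure) = ennreal (I / B)"
    if A: "(\<integral>\<^sup>+(x::real^'n::_). ?h A x \<partial>lborel) = ennreal (K * I)"
      and I: "0 \<le> I" for A I
  proof -
    have "(\<integral>\<^sup>+\<xi>. ennreal (if square_sum S \<xi> \<le> p then square_sum A \<xi> else 0) \<partial>sphere_measure)
       = (\<integral>\<^sup>+(x::real^'n::_). ennreal (if square_sum S (sgn x) \<le> p then square_sum A (sgn x) else 0) * radial_weight x \<partial>lborel) / ennreal (K * B)"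
      by (rule nn_integral_sphere_measure[OF _ Z Z0]) measurable
    also have "(\<integral>\<^sup>+(x::real^'n::_). ennreal (if square_sum S (sgn x) \<le> p then square_sum A (sgn x) else 0) * radial_weight x \<partial>lborel)
       = (\<integral>\<^sup>+(x::real^'n::_). ?h A x \<partial>lborel)"
    proof (intro nn_integral_cong)
      fix x :: "real^'n::_"
      show "ennreal (if square_sum S (sgn x) \<le> p then square_sum A (sgn x) else 0) * radial_weight x
         = ?h A x"
      proof (cases "x = 0")
        case True
        have "square_sum A (0 :: real^'n::_) = 0" by (simp add: square_sum_def)
        with True show ?thesis by (simp add: radial_weight_def)
      next
        case False
        then show ?thesis
          by (simp add: radial_weight_def square_sum_sgn pos_divide_le_eq flip: ennreal_mult)
      qed
    qed
    also have "\<dots> / ennreal (K * B) = ennreal (I / B)"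
      unfolding A using K B I by (simp add: divide_ennreal)
    finally show ?thesis .
  qed
  have GB: "Gamma (\<alpha> + 1) = \<alpha> * Gamma \<alpha>" "Gamma (\<beta> + 1) = \<beta> * Gamma \<beta>" "Gamma (\<alpha> + \<beta> + 1) = (\<alpha> + \<beta>) * Gamma (\<alpha> + \<beta>)"
    using pos by (auto intro!: Gamma_plus1_pos)
  have sums: "\<alpha> + (\<beta> + 1) = \<alpha> + \<beta> + 1" "\<alpha> + 1 + \<beta> = \<alpha> + \<beta> + 1" by simp_all
  have "Beta \<alpha> (\<beta> + 1) = \<beta> / (\<alpha> + \<beta>) * B" "Beta (\<alpha> + 1) \<beta> = \<alpha> / (\<alpha> + \<beta>) * B"
    unfolding Beta_def B_def sums GB by simp_all
  then have r: "incomplete_Beta p \<alpha> (\<beta> + 1) / B = \<beta> / (\<alpha> + \<beta>) * regularized_Beta p \<alpha> (\<beta> + 1)"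
      "incomplete_Beta p (\<alpha> + 1) \<beta> / B = \<alpha> / (\<alpha> + \<beta>) * regularized_Beta p (\<alpha> + 1) \<beta>"
    using pos B by (auto simp: regularized_Beta_def incomplete_Beta_1 field_simps)
  show ?T unfolding r(1)[symmetric] using mom(1)[OF p] by (intro red) (auto simp: incomplete_Beta_nonneg mult.assoc)
  show ?S unfolding r(2)[symmetric] using mom(2)[OF p] by (intro red) (auto simp: incomplete_Beta_nonneg mult.assoc)
qed

lemma
  shows prob_space_sphere_measure: "prob_space (sphere_measure :: (real^'n::{finite,wellorder}) measure)"
    and space_sphere_measure: "space (sphere_measure :: (real^'n::{finite,wellorder}) measure) = sphere 0 1"
    and sets_sphere_measure: "sets (sphere_measure :: (real^'n::{finite,wellorder}) measure) = sets (restrict_space borel (sphere 0 1))"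
  using rotation_invariant_sphereD[OF rotation_invariant_sphere_measure] by auto

lemma borel_measurable_sphere_measure:
  "f \<in> measurable borel N \<Longrightarrow> f \<in> measurable (sphere_measure :: (real^'n::{finite,wellorder}) measure) N"
  by (simp add: measurable_cong_sets[OF sets_sphere_measure refl] measurable_restrict_space1)

lemma
  fixes f :: "real^'n::{finite,wellorder} \<Rightarrow> real^'n::_"
  assumes f: "orthogonal_transformation f"
  shows nn_integral_sphere_orthogonal: "h \<in> borel_measurable borel \<Longrightarrow> (\<integral>\<^sup>+\<xi>. h (f \<xi>) \<partial>sphere_measure) = (\<integral>\<^sup>+\<xi>. h \<xi> \<partial>sphere_measure)"
    and integral_sphere_orthogonal: "k \<in> borel_measurable borel \<Longrightarrow> (\<integral>\<xi>. k (f \<xi>) \<partial>sphere_measure) = (\<integral>\<xi>. (k \<xi> :: real) \<partial>sphere_measure)"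
proof -
  have d: "distr sphere_measure sphere_measure f = sphere_measure"
    using rotation_invariant_sphereD(4)[OF rotation_invariant_sphere_measure f] .
  have m: "f \<in> measurable sphere_measure sphere_measure"
    using orthogonal_transformation_measurable_sphere[OF f]
    by (simp add: measurable_cong_sets[OF sets_sphere_measure sets_sphere_measure])
  show "(\<integral>\<^sup>+\<xi>. h (f \<xi>) \<partial>sphere_measure) = (\<integral>\<^sup>+\<xi>. h \<xi> \<partial>sphere_measure)" if "h \<in> borel_measurable borel"
    using nn_integral_distr[OF m, of h] that by (simp add: d borel_measurable_sphere_measure)
  show "(\<integral>\<xi>. k (f \<xi>) \<partial>sphere_measure) = (\<integral>\<xi>. k \<xi> \<partial>sphere_measure)" if "k \<in> borel_measurable borel"
    using integral_distr[OF m borel_measurable_sphere_measure[OF that]] unfolding d by simp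
qed

lemma orthogonal_transformation_permute:
  fixes \<pi> :: "'n::finite \<Rightarrow> 'n"
  assumes "bij \<pi>"
  shows "orthogonal_transformation (\<lambda>x :: real^'n. \<chi> i. x $ \<pi> i)"
proof -
  have "linear (\<lambda>x :: real^'n. \<chi> i. x $ \<pi> i)"
    by (rule linearI) (auto simp: vec_eq_iff)
  moreover have "norm (\<chi> i. x $ \<pi> i) = norm x" for x :: "real^'n"
    unfolding norm_vec_def L2_set_def using sum.reindex_bij_betw[OF assms, of "\<lambda>i. (norm (x $ i))\<^sup>2"] by simp
  ultimately show ?thesis by (simp add: orthogonal_transformation)
qed

text \<open>Exchanging two coordinates that both lie in \<open>A\<close> is an orthogonal map that preserves the cone
\<open>square_sum S \<xi> \<le> p\<close>. So all coordinates in \<open>A\<close> contribute the same amount to the moment of \<open>square_sum A\<close>.\<close>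

lemma sphere_coordinate_moment:
  fixes S :: "'n::{finite,wellorder} set"
  assumes A: "A = S \<or> A = - S" and i: "i \<in> A" and r: "0 \<le> r"
    and m: "(\<integral>\<^sup>+\<xi>. ennreal (if square_sum S \<xi> \<le> p then square_sum A \<xi> else 0) \<partial>sphere_measure) = ennreal (real (card A) * r)"
  shows "(\<integral>\<xi>. (if square_sum S \<xi> \<le> p then (\<xi> $ i)\<^sup>2 else 0) \<partial>sphere_measure) = r"
proof -
  define c where "c = (\<lambda>j. \<integral>\<^sup>+(\<xi> :: real^'n::_). ennreal (if square_sum S \<xi> \<le> p then (\<xi> $ j)\<^sup>2 else 0) \<partial>sphere_measure)"
  have "c j = c i" if "j \<in> A" for j
  proof -
    let ?\<pi> = "Transposition.transpose i j"
    let ?f = "\<lambda>x :: real^'n::_. \<chi> k. x $ ?\<pi> k"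
    have f: "orthogonal_transformation ?f" by (rule orthogonal_transformation_permute) simp
    have inv: "square_sum S (?f x) = square_sum S x" for x
    proof -
      have "bij_betw ?\<pi> S S" using A i that
        by (intro bij_betwI[where g = ?\<pi>]) (auto simp: Transposition.transpose_def)
      from sum.reindex_bij_betw[OF this, of "\<lambda>k. (x $ k)\<^sup>2"] show ?thesis by (simp add: square_sum_def)
    qed
    have "c i = (\<integral>\<^sup>+(\<xi> :: real^'n::_). ennreal (if square_sum S (?f \<xi>) \<le> p then (?f \<xi> $ i)\<^sup>2 else 0) \<partial>sphere_measure)"
      unfolding c_def by (rule nn_integral_sphere_orthogonal[OF f, symmetric]) measurable
    also have "\<dots> = c j"
    proof -
      have "?f \<xi> $ i = \<xi> $ j" for \<xi> :: "real^'n::_"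
        by (simp only: vec_lambda_beta Transposition.transpose_apply_first)
      then show ?thesis unfolding inv c_def by (simp only:)
    qed
    finally show ?thesis by simp
  qed
  moreover have "ennreal (real (card A) * r) = (\<Sum>j\<in>A. c j)"
  proof -
    have "ennreal (real (card A) * r) = (\<integral>\<^sup>+(\<xi> :: real^'n::_). (\<Sum>j\<in>A. ennreal (if square_sum S \<xi> \<le> p then (\<xi> $ j)\<^sup>2 else 0)) \<partial>sphere_measure)"
      unfolding m[symmetric] by (intro nn_integral_cong) (auto simp: square_sum_def)
    also have "\<dots> = (\<Sum>j\<in>A. c j)"
      unfolding c_def by (intro nn_integral_sum borel_measurable_sphere_measure) measurable
    finally show ?thesis .
  qed
  ultimately have "ennreal (real (card A) * r) = of_nat (card A) * c i" by simp
  moreover have "card A > 0" using i by (auto simp: card_gt_0_iff)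
  ultimately have "c i = ennreal r"
    using r by (auto simp: ennreal_mult ennreal_mult_cancel_left ennreal_of_nat_eq_real_of_nat)
  moreover have "(\<integral>(\<xi> :: real^'n::_). (if square_sum S \<xi> \<le> p then (\<xi> $ i)\<^sup>2 else 0) \<partial>sphere_measure) = enn2real (c i)"
    unfolding c_def by (intro integral_eq_nn_integral borel_measurable_sphere_measure) auto
  ultimately show ?thesis using r by simp
qed

lemma integrable_sphere_coordinate:
  fixes g :: "real^'n::{finite,wellorder} \<Rightarrow> real"
  assumes g: "g \<in> borel_measurable borel" "\<And>\<xi>. \<bar>g \<xi>\<bar> \<le> 1"
  shows "integrable sphere_measure (\<lambda>\<xi>. g \<xi> * (\<xi> $ i)\<^sup>2)"
proof -
  interpret prob_space "sphere_measure :: (real^'n::_) measure" by (rule prob_space_sphere_measure)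
  show ?thesis
  proof (rule integrable_const_bound[where B = 1])
    show "AE \<xi> in sphere_measure. norm (g \<xi> * (\<xi> $ i)\<^sup>2) \<le> 1"
    proof (rule AE_I2)
      fix \<xi> :: "real^'n::_" assume "\<xi> \<in> space sphere_measure"
      then have "norm \<xi> = 1" by (simp add: space_sphere_measure)
      then have "\<bar>\<xi> $ i\<bar> \<le> 1" using component_le_norm_cart[of \<xi> i] by simp
      then have "\<bar>g \<xi>\<bar> * (\<xi> $ i)\<^sup>2 \<le> 1 * 1"
        by (intro mult_mono g) (auto simp: power_le_one abs_square_le_1)
      then show "norm (g \<xi> * (\<xi> $ i)\<^sup>2) \<le> 1" by (simp add: abs_mult)
    qed
    show "(\<lambda>\<xi>. g \<xi> * (\<xi> $ i)\<^sup>2) \<in> borel_measurable sphere_measure"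
    proof (intro borel_measurable_sphere_measure borel_measurable_times g(1))
      show "(\<lambda>\<xi> :: real^'n::_. (\<xi> $ i)\<^sup>2) \<in> borel_measurable borel"
        by (intro borel_measurable_continuous_onI continuous_intros)
    qed
  qed
qed

text \<open>On the unit sphere this is the sign, up to null sets, of the quadratic form with coefficient \<open>1 - p\<close> on \<open>S\<close>
and \<open>- p\<close> off \<open>S\<close>. It serves as the test function in \<open>diag_mean_ge\<close>.\<close>

definition cone_sign :: "'n set \<Rightarrow> real \<Rightarrow> real^'n::finite \<Rightarrow> real" where
  "cone_sign S p \<xi> = (if square_sum S \<xi> \<le> p then - 1 else 1)"

lemma cone_sign_measurable [measurable]: "cone_sign S p \<in> borel_measurable borel"
  unfolding cone_sign_def[abs_def] by measurable

lemma
  fixes S :: "'n::{finite,wellorder} set" and i :: 'n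
  defines "\<alpha> \<equiv> real (card S) / 2" and "\<beta> \<equiv> real (card (- S)) / 2"
  assumes S: "S \<noteq> {}" "- S \<noteq> {}" and p: "0 \<le> p" "p \<le> 1"
  shows integral_sphere_coordinate: "(\<integral>\<xi>. (\<xi> $ i)\<^sup>2 \<partial>sphere_measure) = 1 / real CARD('n)"
    and integral_cone_sign_in: "i \<in> S \<Longrightarrow> (\<integral>\<xi>. cone_sign S p \<xi> * (\<xi> $ i)\<^sup>2 \<partial>sphere_measure)
         = (1 - 2 * regularized_Beta p (\<alpha> + 1) \<beta>) / real CARD('n)"
    and integral_cone_sign_out: "i \<notin> S \<Longrightarrow> (\<integral>\<xi>. cone_sign S p \<xi> * (\<xi> $ i)\<^sup>2 \<partial>sphere_measure)
         = (1 - 2 * regularized_Beta p \<alpha> (\<beta> + 1)) / real CARD('n)"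
proof -
  let ?m = "\<lambda>i. \<integral>\<xi>. cone_sign S p \<xi> * (\<xi> $ i)\<^sup>2 \<partial>sphere_measure"
  let ?low = "\<lambda>q i. \<integral>\<xi>. (if square_sum S \<xi> \<le> q then (\<xi> $ i)\<^sup>2 else 0) \<partial>sphere_measure"
  let ?ind = "\<lambda>\<xi>. if square_sum S \<xi> \<le> p then 1 else 0 :: real"
  define d where "d = real CARD('n)"
  have pos: "\<alpha> > 0" "\<beta> > 0" using S by (auto simp: \<alpha>_def \<beta>_def card_gt_0_iff)
  have "card S + card (- S) = CARD('n)"
    using card_Un_disjoint[of S "- S"] by simp
  then have "real (card S) + real (card (- S)) = d" unfolding d_def of_nat_add[symmetric] by simp
  then have d: "\<alpha> + \<beta> = d / 2" "d > 0" by (auto simp: \<alpha>_def \<beta>_def d_def)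
  have rS: "\<alpha> / (\<alpha> + \<beta>) * r = real (card S) * (r / d)" and rT: "\<beta> / (\<alpha> + \<beta>) * r = real (card (- S)) * (r / d)" for r
    unfolding d(1) by (auto simp: \<alpha>_def \<beta>_def)
  have low_in: "?low q i = regularized_Beta q (\<alpha> + 1) \<beta> / d"
    if "i \<in> S" "0 \<le> q" "q \<le> 1" for i q
    using sphere_cone_moments(2)[OF S that(2,3), folded \<alpha>_def \<beta>_def, unfolded rS] that(1) d
    by (intro sphere_coordinate_moment[where A = S]) (auto simp: regularized_Beta_nonneg)
  have low_out: "?low q i = regularized_Beta q \<alpha> (\<beta> + 1) / d"
    if "i \<notin> S" "0 \<le> q" "q \<le> 1" for i q
    using sphere_cone_moments(1)[OF S that(2,3), folded \<alpha>_def \<beta>_def, unfolded rT] that(1) d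
    by (intro sphere_coordinate_moment[where A = "- S"]) (auto simp: regularized_Beta_nonneg)
  have le1: "square_sum S \<xi> \<le> 1" if "\<xi> \<in> space sphere_measure" for \<xi> :: "real^'n::_"
  proof -
    have "(norm \<xi>)\<^sup>2 = 1" using that by (simp add: space_sphere_measure)
    then show ?thesis using square_sum_Compl[of S \<xi>] square_sum_nonneg[of "- S" \<xi>] by linarith
  qed
  have all: "(\<integral>\<xi>. (\<xi> $ i)\<^sup>2 \<partial>sphere_measure) = 1 / d" for i :: 'n
  proof -
    have "(\<integral>\<xi>. (\<xi> $ i)\<^sup>2 \<partial>sphere_measure) = ?low 1 i"
      using le1 by (intro Bochner_Integration.integral_cong) auto
    also have "\<dots> = 1 / d" using low_in[of i 1] low_out[of i 1] pos by (cases "i \<in> S") (auto simp: regularized_Beta_1)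
    finally show ?thesis .
  qed
  then show "(\<integral>\<xi>. (\<xi> $ i)\<^sup>2 \<partial>sphere_measure) = 1 / real CARD('n)" by (simp add: d_def)
  have cs: "?m i
     = 1 / d - 2 * ?low p i" for i :: 'n
  proof -
    have i1: "integrable sphere_measure (\<lambda>\<xi> :: real^'n::_. 1 * (\<xi> $ i)\<^sup>2)"
      by (rule integrable_sphere_coordinate) auto
    have i2: "integrable sphere_measure (\<lambda>\<xi> :: real^'n::_. ?ind \<xi> * (\<xi> $ i)\<^sup>2)"
      by (rule integrable_sphere_coordinate) auto
    have "?m i
       = (\<integral>\<xi>. 1 * (\<xi> $ i)\<^sup>2 - 2 * (?ind \<xi> * (\<xi> $ i)\<^sup>2) \<partial>sphere_measure)"
      by (intro Bochner_Integration.integral_cong) (auto simp: cone_sign_def)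
    also have "\<dots> = (\<integral>\<xi>. 1 * (\<xi> $ i)\<^sup>2 \<partial>sphere_measure) - (\<integral>\<xi>. 2 * (?ind \<xi> * (\<xi> $ i)\<^sup>2) \<partial>sphere_measure)"
      by (rule Bochner_Integration.integral_diff[OF i1 integrable_mult_right[OF i2]])
    also have "(\<integral>\<xi>. 2 * (?ind \<xi> * (\<xi> $ i)\<^sup>2) \<partial>sphere_measure) = 2 * ?low p i"
      by (subst integral_mult_right_zero) (auto intro!: Bochner_Integration.integral_cong)
    finally show ?thesis using all by simp
  qed
  show "?m i = (1 - 2 * regularized_Beta p (\<alpha> + 1) \<beta>) / real CARD('n)" if "i \<in> S"
    unfolding cs low_in[OF that p] by (simp add: d_def diff_divide_distrib)
  show "?m i = (1 - 2 * regularized_Beta p \<alpha> (\<beta> + 1)) / real CARD('n)" if "i \<notin> S"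
    unfolding cs low_out[OF that p] by (simp add: d_def diff_divide_distrib)
qed

section \<open>Diagonal quadratic forms\<close>

definition diag_mean :: "('n::{finite,wellorder} \<Rightarrow> real) \<Rightarrow> real" where
  "diag_mean c = (\<integral>\<xi>. \<bar>\<Sum>i\<in>UNIV. c i * (\<xi> $ i)\<^sup>2\<bar> \<partial>(sphere_measure :: (real^'n::_) measure))"

lemma integral_sphere_weighted_sum:
  fixes c :: "'n::{finite,wellorder} \<Rightarrow> real" and g :: "real^'n::_ \<Rightarrow> real"
  assumes g: "g \<in> borel_measurable borel" "\<And>\<xi>. \<bar>g \<xi>\<bar> \<le> 1"
  shows "(\<integral>\<xi>. g \<xi> * (\<Sum>i\<in>UNIV. c i * (\<xi> $ i)\<^sup>2) \<partial>sphere_measure) = (\<Sum>i\<in>UNIV. c i * (\<integral>\<xi>. g \<xi> * (\<xi> $ i)\<^sup>2 \<partial>sphere_measure))"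
    and "integrable sphere_measure (\<lambda>\<xi>. g \<xi> * (\<Sum>i\<in>UNIV. c i * (\<xi> $ i)\<^sup>2))"
proof -
  have e: "g \<xi> * (\<Sum>i\<in>UNIV. c i * (\<xi> $ i)\<^sup>2) = (\<Sum>i\<in>UNIV. c i * (g \<xi> * (\<xi> $ i)\<^sup>2))" for \<xi>
    by (simp add: sum_distrib_left mult_ac)
  have i: "integrable sphere_measure (\<lambda>\<xi>. c i * (g \<xi> * (\<xi> $ i)\<^sup>2))" for i
    by (intro integrable_mult_right integrable_sphere_coordinate g)
  show "integrable sphere_measure (\<lambda>\<xi>. g \<xi> * (\<Sum>i\<in>UNIV. c i * (\<xi> $ i)\<^sup>2))"
    unfolding e by (intro Bochner_Integration.integrable_sum i)
  show "(\<integral>\<xi>. g \<xi> * (\<Sum>i\<in>UNIV. c i * (\<xi> $ i)\<^sup>2) \<partial>sphere_measure) = (\<Sum>i\<in>UNIV. c i * (\<integral>\<xi>. g \<xi> * (\<xi> $ i)\<^sup>2 \<partial>sphere_measure))"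
    unfolding e by (subst Bochner_Integration.integral_sum[OF i]) (simp add: integral_mult_right_zero)
qed

text \<open>The duality that all lower bounds rest on: the absolute value of a quadratic form \<open>q\<close> dominates \<open>g * q\<close>
whenever \<open>g\<close> is bounded by \<open>1\<close>.\<close>

lemma diag_mean_ge:
  fixes c :: "'n::{finite,wellorder} \<Rightarrow> real"
  assumes g: "g \<in> borel_measurable borel" "\<And>\<xi>. \<bar>g \<xi>\<bar> \<le> 1"
  shows "(\<Sum>i\<in>UNIV. c i * (\<integral>\<xi>. g \<xi> * (\<xi> $ i)\<^sup>2 \<partial>sphere_measure)) \<le> diag_mean c"
proof -
  have "integrable sphere_measure (\<lambda>\<xi> :: real^'n::_. \<bar>1 * (\<Sum>i\<in>UNIV. c i * (\<xi> $ i)\<^sup>2)\<bar>)"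
    by (intro integrable_abs integral_sphere_weighted_sum) auto
  then have "(\<integral>\<xi>. g \<xi> * (\<Sum>i\<in>UNIV. c i * (\<xi> $ i)\<^sup>2) \<partial>sphere_measure) \<le> diag_mean c"
    unfolding diag_mean_def
  proof (intro integral_mono integral_sphere_weighted_sum g, simp)
    fix \<xi> :: "real^'n::_"
    let ?q = "\<Sum>i\<in>UNIV. c i * (\<xi> $ i)\<^sup>2"
    have "g \<xi> * ?q \<le> \<bar>g \<xi>\<bar> * \<bar>?q\<bar>" by (simp flip: abs_mult)
    also have "\<dots> \<le> 1 * \<bar>?q\<bar>" by (intro mult_right_mono g) auto
    finally show "g \<xi> * ?q \<le> \<bar>?q\<bar>" by simp
  qed
  then show ?thesis unfolding integral_sphere_weighted_sum(1)[OF g] .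
qed

lemma diag_mean_uminus: "diag_mean (\<lambda>i. - c i) = diag_mean c"
  by (simp add: diag_mean_def sum_negf)

text \<open>At the equipoint the moments of \<open>cone_sign\<close> have the same absolute value for all coordinates, and their signs
agree with those of the coefficients. So testing against \<open>cone_sign\<close> produces a multiple of the sum of the
\<open>\<bar>c i\<bar>\<close>, whatever their distribution over \<open>S\<close> and \<open>- S\<close> is.\<close>

lemma diag_mean_ge_mixed:
  fixes c :: "'n::{finite,wellorder} \<Rightarrow> real"
  defines "S \<equiv> {i. 0 \<le> c i}"
  assumes S: "S \<noteq> {}" "- S \<noteq> {}"
  shows "equi_value (real (card S) / 2) (real (card (- S)) / 2) * (\<Sum>i\<in>UNIV. \<bar>c i\<bar>) / real CARD('n) \<le> diag_mean c"
proof -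
  define \<alpha> where "\<alpha> = real (card S) / 2"
  define \<beta> where "\<beta> = real (card (- S)) / 2"
  define p where "p = equipoint \<alpha> \<beta>"
  let ?m = "\<lambda>i. \<integral>\<xi>. cone_sign S p \<xi> * (\<xi> $ i)\<^sup>2 \<partial>sphere_measure"
  have pos: "\<alpha> > 0" "\<beta> > 0" using S by (auto simp: \<alpha>_def \<beta>_def card_gt_0_iff)
  have p: "0 \<le> p" "p \<le> 1" using equipoint_in[OF pos] by (auto simp: p_def)
  have "c i * ?m i = \<bar>c i\<bar> * (equi_value \<alpha> \<beta> / real CARD('n))" for i
  proof (cases "i \<in> S")
    case True
    have "?m i = equi_value \<alpha> \<beta> / real CARD('n)"
      using integral_cone_sign_in[OF S p True] equi_value_left[OF pos] by (simp add: \<alpha>_def \<beta>_def p_def)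
    then show ?thesis using True by (simp add: S_def)
  next
    case False
    have "?m i = - equi_value \<alpha> \<beta> / real CARD('n)"
      using integral_cone_sign_out[OF S p False] equi_value_right[OF pos, symmetric] by (simp add: \<alpha>_def \<beta>_def p_def)
    then show ?thesis using False by (simp add: S_def)
  qed
  then have "(\<Sum>i\<in>UNIV. c i * ?m i) = (\<Sum>i\<in>UNIV. \<bar>c i\<bar>) * (equi_value \<alpha> \<beta> / real CARD('n))"
    by (simp only: sum_distrib_right)
  moreover have "(\<Sum>i\<in>UNIV. c i * ?m i) \<le> diag_mean c"
    by (rule diag_mean_ge) (auto simp: cone_sign_def)
  ultimately show ?thesis by (simp add: \<alpha>_def \<beta>_def mult.commute)
qed

text \<open>On the unit sphere \<open>a * square_sum S \<xi> - b * square_sum (- S) \<xi> = (a + b) * (square_sum S \<xi> - p)\<close> for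
\<open>p = b / (a + b)\<close>. Hence \<open>cone_sign S p\<close> is the sign of the form, and the duality estimate is an equality.\<close>

lemma diag_mean_two_values:
  fixes S :: "'n::{finite,wellorder} set"
  defines "\<alpha> \<equiv> real (card S) / 2" and "\<beta> \<equiv> real (card (- S)) / 2"
  assumes S: "S \<noteq> {}" "- S \<noteq> {}" and ab: "0 \<le> a" "0 \<le> b" "0 < a + b"
  defines "p \<equiv> b / (a + b)"
  shows "diag_mean (\<lambda>i. if i \<in> S then a else - b)
    = (a * real (card S) * (1 - 2 * regularized_Beta p (\<alpha> + 1) \<beta>)
      + b * real (card (- S)) * (2 * regularized_Beta p \<alpha> (\<beta> + 1) - 1)) / real CARD('n)"
proof -
  let ?m = "\<lambda>i. \<integral>\<xi>. cone_sign S p \<xi> * (\<xi> $ i)\<^sup>2 \<partial>sphere_measure"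
  define c where "c = (\<lambda>i. if i \<in> S then a else - b)"
  have p: "0 \<le> p" "p \<le> 1" using ab by (auto simp: p_def field_simps)
  have eq: "\<bar>\<Sum>i\<in>UNIV. c i * (\<xi> $ i)\<^sup>2\<bar> = cone_sign S p \<xi> * (\<Sum>i\<in>UNIV. c i * (\<xi> $ i)\<^sup>2)"
    if "\<xi> \<in> space sphere_measure" for \<xi> :: "real^'n::_"
  proof -
    let ?X = "square_sum S \<xi>"
    have "(\<Sum>i\<in>UNIV. c i * (\<xi> $ i)\<^sup>2) = (\<Sum>i\<in>S. c i * (\<xi> $ i)\<^sup>2) + (\<Sum>i\<in>- S. c i * (\<xi> $ i)\<^sup>2)"
      by (subst sum.union_disjoint[symmetric]) auto
    also have "\<dots> = a * ?X - b * square_sum (- S) \<xi>"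
      by (simp add: c_def square_sum_def sum_distrib_left sum_negf)
    also have "square_sum (- S) \<xi> = 1 - ?X"
      using square_sum_Compl[of S \<xi>] that by (simp add: space_sphere_measure)
    also have "a * ?X - b * (1 - ?X) = (a + b) * (?X - p)"
      using ab by (simp add: p_def field_simps)
    finally show ?thesis using ab by (auto simp: cone_sign_def abs_mult zero_le_mult_iff mult_le_0_iff)
  qed
  have "diag_mean c = (\<integral>\<xi>. cone_sign S p \<xi> * (\<Sum>i\<in>UNIV. c i * (\<xi> $ i)\<^sup>2) \<partial>sphere_measure)"
    unfolding diag_mean_def by (intro Bochner_Integration.integral_cong eq) auto
  also have "\<dots> = (\<Sum>i\<in>UNIV. c i * ?m i)"
    by (rule integral_sphere_weighted_sum) (auto simp: cone_sign_def)
  also have "\<dots> = (\<Sum>i\<in>S. c i * ?m i)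
       + (\<Sum>i\<in>- S. c i * ?m i)"
    by (subst sum.union_disjoint[symmetric]) auto
  also have "(\<Sum>i\<in>S. c i * ?m i)
      = real (card S) * (a * ((1 - 2 * regularized_Beta p (\<alpha> + 1) \<beta>) / real CARD('n)))"
    using integral_cone_sign_in[OF S p] by (simp add: c_def \<alpha>_def \<beta>_def)
  also have "(\<Sum>i\<in>- S. c i * ?m i)
      = real (card (- S)) * (- b * ((1 - 2 * regularized_Beta p \<alpha> (\<beta> + 1)) / real CARD('n)))"
    using integral_cone_sign_out[OF S p] by (simp add: c_def \<alpha>_def \<beta>_def)
  finally show ?thesis unfolding c_def by (simp add: add_divide_distrib[symmetric] diff_divide_distrib[symmetric] algebra_simps)
qed

section \<open>Spectral decomposition and absolute value of symmetric matrices\<close>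

lemma symmetric_matrix_inner:
  fixes B :: "real^'n^'n"
  assumes "transpose B = B"
  shows "(B *v x) \<bullet> y = x \<bullet> (B *v y)"
  using dot_lmul_matrix[of x "B" y] assms by (metis transpose_matrix_vector)

text \<open>The orthogonal complement \<open>W\<close> of the given eigenvectors is invariant under \<open>B\<close>. A maximizer \<open>x\<close> of the
quadratic form on the unit sphere of \<open>W\<close> is an eigenvector: with the maximum \<open>l\<close>, the form
\<open>q y = l * (y \<bullet> y) - y \<bullet> (B *v y)\<close> is nonnegative on \<open>W\<close> and vanishes at \<open>x\<close>, so its first variation at \<open>x\<close> in the
direction \<open>l *\<^sub>R x - B *v x\<close> must vanish.\<close>

lemma eigenvector_in_orthogonal_complement:
  fixes B :: "real^'n^'n"
  assumes B: "transpose B = B" and A: "finite A" "card A < CARD('n)"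
    and v: "\<And>j. j \<in> A \<Longrightarrow> B *v v j = c j *\<^sub>R v j"
  obtains x l where "norm x = 1" "B *v x = l *\<^sub>R x" "\<And>j. j \<in> A \<Longrightarrow> x \<bullet> v j = 0"
proof -
  define W where "W = {x. \<forall>j\<in>A. x \<bullet> v j = 0}"
  have W_sub: "subspace W" by (auto simp: W_def subspace_def inner_add_left)
  have W_inv: "B *v x \<in> W" if "x \<in> W" for x
    using that v by (auto simp: W_def symmetric_matrix_inner[OF B])
  have "dim (v ` A) < DIM(real^'n)"
  proof -
    have "dim (v ` A) \<le> card (v ` A)" using A by (intro dim_le_card') auto
    also have "\<dots> \<le> card A" using A by (intro card_image_le)
    finally show ?thesis using A by simp
  qed
  then obtain z where z: "z \<noteq> 0" "\<And>y. y \<in> span (v ` A) \<Longrightarrow> orthogonal z y"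
    using orthogonal_to_subspace_exists by blast
  have "z \<in> W" using z(2) span_base[of _ "v ` A"] by (auto simp: W_def orthogonal_def)
  then have "(1 / norm z) *\<^sub>R z \<in> W \<inter> sphere 0 1"
    using z(1) subspace_scale[OF W_sub] by auto
  then have "W \<inter> sphere 0 1 \<noteq> {}" by blast
  moreover have "compact (W \<inter> sphere 0 1)"
    by (intro closed_Int_compact closed_subspace W_sub) simp
  moreover have "continuous_on (W \<inter> sphere 0 1) (\<lambda>x. x \<bullet> (B *v x))"
    by (intro continuous_intros linear_continuous_on) (simp add: matrix_vector_mul_bounded_linear)
  ultimately obtain x where x: "x \<in> W" "norm x = 1"
    and max: "\<And>y. y \<in> W \<Longrightarrow> norm y = 1 \<Longrightarrow> y \<bullet> (B *v y) \<le> x \<bullet> (B *v x)"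
    using continuous_attains_sup[of "W \<inter> sphere 0 1" "\<lambda>x. x \<bullet> (B *v x)"] by fastforce
  define l where "l = x \<bullet> (B *v x)"
  define q where "q = (\<lambda>y. l * (y \<bullet> y) - y \<bullet> (B *v y))"
  have q: "0 \<le> q y" if "y \<in> W" for y
  proof (cases "y = 0")
    case False
    define u where "u = (1 / norm y) *\<^sub>R y"
    have "u \<in> W" "norm u = 1" using that False by (auto simp: u_def subspace_scale[OF W_sub])
    then have "u \<bullet> (B *v u) \<le> l" unfolding l_def by (rule max)
    moreover have "y = norm y *\<^sub>R u" using False by (simp add: u_def)
    then have "y \<bullet> (B *v y) = (norm y)\<^sup>2 * (u \<bullet> (B *v u))"
      by (metis (no_types, lifting) inner_scaleR_left inner_scaleR_right matrix_vector_mult_scaleR mult.assoc power2_eq_square)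
    ultimately show ?thesis
      unfolding q_def dot_square_norm using mult_left_mono[of "u \<bullet> (B *v u)" l "(norm y)\<^sup>2"] by (simp add: mult.commute)
  qed (simp add: q_def)
  define y where "y = l *\<^sub>R x - B *v x"
  have yW: "y \<in> W" unfolding y_def using x W_inv by (intro subspace_diff[OF W_sub] subspace_scale[OF W_sub])
  have "y \<bullet> y = 0"
  proof (rule ccontr)
    assume "y \<bullet> y \<noteq> 0"
    define e where "e = y \<bullet> y"
    have e: "e > 0" using \<open>y \<bullet> y \<noteq> 0\<close> inner_ge_zero[of y] unfolding e_def by linarith
    have expand: "q (x + t *\<^sub>R y) = 2 * t * e + t\<^sup>2 * q y" for t
    proof -
      have "q x = 0" using x(2) by (simp add: q_def l_def dot_square_norm)
      moreover have "l * (x \<bullet> y) - x \<bullet> (B *v y) = e"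
        unfolding e_def symmetric_matrix_inner[OF B, symmetric] by (simp add: y_def inner_diff_left)
      moreover have "q (x + t *\<^sub>R y) = q x + 2 * t * (l * (x \<bullet> y) - x \<bullet> (B *v y)) + t\<^sup>2 * q y"
        using symmetric_matrix_inner[OF B, of x y]
        by (simp add: q_def inner_add_left inner_add_right matrix_vector_right_distrib matrix_vector_mult_scaleR
            inner_commute[of y x] inner_commute[of "B *v x" y] power2_eq_square algebra_simps)
      ultimately show ?thesis by simp
    qed
    \<comment> \<open>A step small enough for the linear term to dominate the quadratic one.\<close>
    define t where "t = - (e / (q y + 1))"
    have qy: "0 \<le> q y" by (rule q[OF yW])
    have "0 \<le> q (x + t *\<^sub>R y)" using x yW by (intro q subspace_add[OF W_sub] subspace_scale[OF W_sub])
    also have "\<dots> = - ((e / (q y + 1))\<^sup>2 * (q y + 2))"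
    proof -
      define r where "r = e / (q y + 1)"
      have "e = r * (q y + 1)" using qy by (simp add: r_def)
      then have "2 * (- r) * e + (- r)\<^sup>2 * q y = - (r\<^sup>2 * (q y + 2))"
        by (simp add: power2_eq_square algebra_simps)
      then show ?thesis unfolding expand t_def r_def .
    qed
    also have "\<dots> < 0" using e qy by simp
    finally show False by simp
  qed
  then have "B *v x = l *\<^sub>R x" by (simp add: y_def)
  then show ?thesis using that[of x l] x by (auto simp: W_def)
qed

lemma symmetric_matrix_eigenbasis:
  fixes B :: "real^'n^'n"
  assumes B: "transpose B = B"
  obtains v c where "\<And>i j :: 'n. v i \<bullet> v j = (if i = j then 1 else 0)" "\<And>i. B *v v i = c i *\<^sub>R v i"
proof -
  have "\<exists>v c. (\<forall>i\<in>A. \<forall>j\<in>A. v i \<bullet> v j = (if i = j then 1 else 0)) \<and> (\<forall>i\<in>A. B *v v i = c i *\<^sub>R v i)" for A :: "'n set"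
    using finite[of A]
  proof (induction A rule: finite_induct)
    case (insert a A)
    then obtain v c where v: "\<forall>i\<in>A. \<forall>j\<in>A. v i \<bullet> v j = (if i = j then 1 else 0)" "\<forall>i\<in>A. B *v v i = c i *\<^sub>R v i"
      by blast
    have "card A < CARD('n)" using insert.hyps by (intro psubset_card_mono) auto
    then obtain x l where x: "norm x = 1" "B *v x = l *\<^sub>R x" "\<And>j. j \<in> A \<Longrightarrow> x \<bullet> v j = 0"
      using eigenvector_in_orthogonal_complement[OF B, of A v c] v by auto
    have "x \<bullet> x = 1" using x(1) by (simp add: dot_square_norm)
    then show ?case using v x insert.hyps
      by (intro exI[of _ "v(a := x)"] exI[of _ "c(a := l)"]) (auto simp: inner_commute)
  qed auto
  from this[of UNIV] show ?thesis using that by auto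
qed

lemma orthonormal_family_expand:
  fixes v :: "'n \<Rightarrow> real^'n"
  assumes v: "\<And>i j. v i \<bullet> v j = (if i = j then 1 else 0)"
  shows "x = (\<Sum>i\<in>UNIV. (v i \<bullet> x) *\<^sub>R v i)"
proof -
  have inj: "inj v"
    using v by (metis (mono_tags, lifting) injI zero_neq_one)
  have "v i \<noteq> 0" for i using v[of i i] by auto
  then have "0 \<notin> range v" by (metis rangeE)
  then have indep: "independent (range v)"
    by (intro pairwise_orthogonal_independent) (auto simp: pairwise_def orthogonal_def v)
  have "card (range v) = DIM(real^'n)" using inj by (simp add: card_image)
  then have span: "UNIV \<subseteq> span (range v)"
    using indep by (intro card_ge_dim_independent) auto
  define y where "y = x - (\<Sum>i\<in>UNIV. (v i \<bullet> x) *\<^sub>R v i)"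
  have yv: "orthogonal y w" if w: "w \<in> range v" for w
  proof -
    obtain k where k: "w = v k" using w by blast
    have "(\<Sum>i\<in>UNIV. (v i \<bullet> x) *\<^sub>R v i) \<bullet> v k = v k \<bullet> x"
      by (simp add: inner_sum_left v if_distrib cong: if_cong)
    then have "y \<bullet> v k = x \<bullet> v k - v k \<bullet> x" by (simp only: y_def inner_diff_left)
    then show ?thesis by (simp add: k orthogonal_def inner_commute)
  qed
  have "y \<in> span (range v)" using span by auto
  then have "orthogonal y y" using yv by (rule orthogonal_to_span)
  then show ?thesis by (simp add: y_def orthogonal_self)
qed

context
  fixes B :: "real^'n^'n" and v :: "'n \<Rightarrow> real^'n" and c :: "'n \<Rightarrow> real"
  assumes B: "transpose B = B"
    and v: "\<And>i j. v i \<bullet> v j = (if i = j then 1 else 0)"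
    and eig: "\<And>i. B *v v i = c i *\<^sub>R v i"
begin

lemma eigenbasis_eqI:
  fixes P Q :: "real^'n^'n"
  assumes "\<And>i. P *v v i = Q *v v i"
  shows "P = Q"
proof -
  have "P *v x = Q *v x" for x
    by (subst (1 2) orthonormal_family_expand[OF v, of x])
      (simp add: linear_sum[OF matrix_vector_mul_linear] matrix_vector_mult_scaleR assms)
  then show ?thesis by (simp add: matrix_eq)
qed

text \<open>The matrix \<open>P\<close> with eigenvalues \<open>\<bar>c i\<bar>\<close> is a positive semidefinite root of \<open>transpose B ** B\<close>. It is the only
one: if \<open>Q\<close> is another, the vector \<open>w = Q *v v i - \<bar>c i\<bar> *\<^sub>R v i\<close> satisfies \<open>Q *v w = - \<bar>c i\<bar> *\<^sub>R w\<close>, which is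
compatible with \<open>Q\<close> being positive semidefinite only if \<open>w = 0\<close> or \<open>c i = 0\<close>; and in the latter case \<open>Q *v v i\<close> has norm \<open>0\<close>.\<close>

lemma matrix_abs_eigenbasis: "trace (matrix_abs B) = (\<Sum>i\<in>UNIV. \<bar>c i\<bar>)"
proof -
  define P where "P = (\<chi> a b. \<Sum>i\<in>UNIV. \<bar>c i\<bar> * v i $ a * v i $ b)"
  have Pv: "P *v x = (\<Sum>i\<in>UNIV. (\<bar>c i\<bar> * (v i \<bullet> x)) *\<^sub>R v i)" for x
    by (simp add: vec_eq_iff P_def matrix_vector_mult_def inner_vec_def sum_distrib_left sum_distrib_right mult_ac)
      (auto intro: sum.swap)
  have Pvi: "P *v v i = \<bar>c i\<bar> *\<^sub>R v i" for i
    by (simp add: Pv v if_distrib if_distribR sum.delta cong: if_cong)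
  have "pos_semidef P"
    unfolding pos_semidef_def
  proof (intro conjI allI)
    show "transpose P = P" by (simp add: P_def transpose_def vec_eq_iff mult_ac)
    fix x
    have "x \<bullet> (P *v x) = (\<Sum>i\<in>UNIV. \<bar>c i\<bar> * (v i \<bullet> x)\<^sup>2)"
      by (simp add: Pv inner_sum_right power2_eq_square inner_commute mult_ac)
    then show "0 \<le> x \<bullet> (P *v x)" by (simp add: sum_nonneg)
  qed
  moreover have "P ** P = transpose B ** B"
    by (rule eigenbasis_eqI) (simp add: B Pvi eig matrix_vector_mult_scaleR flip: matrix_vector_mul_assoc)
  moreover have "Q = P" if Q: "pos_semidef Q" "Q ** Q = transpose B ** B" for Q
  proof (rule eigenbasis_eqI)
    fix i
    have QQ: "Q *v (Q *v v i) = (c i)\<^sup>2 *\<^sub>R v i"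
      using Q(2) by (simp add: matrix_vector_mul_assoc B) (simp add: eig matrix_vector_mult_scaleR power2_eq_square flip: matrix_vector_mul_assoc)
    have Qs: "transpose Q = Q" "\<And>x. 0 \<le> x \<bullet> (Q *v x)" using Q(1) by (auto simp: pos_semidef_def)
    show "Q *v v i = P *v v i"
    proof (cases "c i = 0")
      case True
      have "(Q *v v i) \<bullet> (Q *v v i) = v i \<bullet> (Q *v (Q *v v i))" by (rule symmetric_matrix_inner[OF Qs(1)])
      then show ?thesis using True QQ by (simp add: Pvi)
    next
      case False
      define w where "w = Q *v v i - \<bar>c i\<bar> *\<^sub>R v i"
      have "Q *v w = - \<bar>c i\<bar> *\<^sub>R w"
        by (simp add: w_def matrix_vector_mult_diff_distrib matrix_vector_mult_scaleR QQ scaleR_diff_right power2_eq_square)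
      then have "w \<bullet> (Q *v w) = - (\<bar>c i\<bar> * (w \<bullet> w))" by simp
      with Qs(2)[of w] False have "w \<bullet> w \<le> 0" by (simp add: mult_le_0_iff)
      then have "w = 0" by (metis inner_ge_zero inner_eq_zero_iff order_antisym)
      then show ?thesis by (simp add: w_def Pvi)
    qed
  qed
  ultimately have "matrix_abs B = P" unfolding matrix_abs_def
    by (intro the_equality conjI) blast+
  then have "trace (matrix_abs B) = (\<Sum>a\<in>UNIV. \<Sum>i\<in>UNIV. \<bar>c i\<bar> * v i $ a * v i $ a)"
    by (simp add: trace_def P_def)
  also have "\<dots> = (\<Sum>i\<in>UNIV. \<bar>c i\<bar> * (v i \<bullet> v i))"
    by (subst sum.swap) (simp add: inner_vec_def sum_distrib_left mult_ac)
  finally show ?thesis by (simp add: v)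
qed

end

text \<open>Passing to the coordinates with respect to an orthonormal eigenbasis is an orthogonal map, under which the
sphere measure is invariant.\<close>

lemma quad_mean_eigenbasis:
  fixes B :: "real^'n::{finite,wellorder}^'n::_" and v :: "'n \<Rightarrow> real^'n::_" and c :: "'n \<Rightarrow> real"
  assumes B: "transpose B = B"
    and v: "\<And>i j. v i \<bullet> v j = (if i = j then 1 else 0)"
    and eig: "\<And>i. B *v v i = c i *\<^sub>R v i"
  shows "quad_mean B = diag_mean c"
proof -
  note expand = orthonormal_family_expand[OF v]
  define f where "f = (\<lambda>x. \<chi> i. v i \<bullet> x)"
  have q: "x \<bullet> (B *v x) = (\<Sum>i\<in>UNIV. c i * (f x $ i)\<^sup>2)" for x
  proof -
    have "B *v x = (\<Sum>i\<in>UNIV. (v i \<bullet> x * c i) *\<^sub>R v i)"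
      by (subst expand[of x]) (simp add: linear_sum[OF matrix_vector_mul_linear] matrix_vector_mult_scaleR eig)
    then show ?thesis by (simp add: f_def inner_sum_right inner_commute power2_eq_square mult_ac)
  qed
  have "norm (f x) = norm x" for x
  proof -
    have "x \<bullet> x = (\<Sum>i\<in>UNIV. (v i \<bullet> x)\<^sup>2)"
      by (subst (2) expand[of x]) (simp add: inner_sum_right inner_commute power2_eq_square)
    moreover have "f x \<bullet> f x = (\<Sum>i\<in>UNIV. (v i \<bullet> x)\<^sup>2)"
      by (simp add: f_def inner_vec_def power2_eq_square)
    ultimately show ?thesis by (simp only: norm_eq_sqrt_inner)
  qed
  moreover have "linear f" by (rule linearI) (auto simp: f_def vec_eq_iff inner_add_right)
  ultimately have f: "orthogonal_transformation f" by (simp add: orthogonal_transformation)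
  have "quad_mean B = (\<integral>\<xi>. \<bar>\<Sum>i\<in>UNIV. c i * (f \<xi> $ i)\<^sup>2\<bar> \<partial>sphere_measure)"
    unfolding quad_mean_def q ..
  also have "\<dots> = diag_mean c"
    unfolding diag_mean_def
    by (rule integral_sphere_orthogonal[OF f, where k = "\<lambda>\<xi>. \<bar>\<Sum>i\<in>UNIV. c i * (\<xi> $ i)\<^sup>2\<bar>"])
      (intro borel_measurable_continuous_onI continuous_intros)
  finally show ?thesis .
qed

section \<open>The minimum\<close>

definition diag_matrix :: "('n \<Rightarrow> real) \<Rightarrow> real^'n^'n" where
  "diag_matrix c = (\<chi> i j. if i = j then c i else 0)"

lemma transpose_diag_matrix: "transpose (diag_matrix c) = diag_matrix c"
  by (simp add: diag_matrix_def transpose_def vec_eq_iff)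

lemma diag_matrix_axis: "diag_matrix c *v axis i 1 = c i *\<^sub>R axis i 1"
  unfolding matrix_vector_mult_basis by (simp add: column_def diag_matrix_def vec_eq_iff axis_def)

lemma inner_axis_axis_one: "(axis i 1 :: real^'n) \<bullet> axis j 1 = (if i = j then 1 else 0)"
  by (simp add: inner_axis_axis)

lemma admissible_diag_matrix:
  "admissible (diag_matrix c :: real^'n^'n) \<longleftrightarrow> (\<Sum>i\<in>UNIV. \<bar>c i\<bar>) = real CARD('n)"
  unfolding admissible_def
  using matrix_abs_eigenbasis[OF transpose_diag_matrix inner_axis_axis_one diag_matrix_axis, of c]
  by (simp add: transpose_diag_matrix)

lemma quad_mean_diag_matrix:
  "quad_mean (diag_matrix c :: real^'n::{finite,wellorder}^'n::_) = diag_mean c"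
  by (rule quad_mean_eigenbasis[OF transpose_diag_matrix inner_axis_axis_one diag_matrix_axis])

text \<open>If the coefficients have mixed signs, the equipoint estimate applies and the value is compared with the
balanced one. Otherwise the form is semidefinite and its mean is \<open>1\<close>, which no equipoint value exceeds.\<close>

lemma diag_mean_ge_central_value:
  fixes c :: "'n::{finite,wellorder} \<Rightarrow> real"
  assumes d: "2 \<le> CARD('n)" and c: "(\<Sum>i\<in>UNIV. \<bar>c i\<bar>) = real CARD('n)"
  shows "central_value CARD('n) \<le> diag_mean c"
proof -
  have one_sign: "central_value CARD('n) \<le> diag_mean c'"
    if "\<And>i. 0 \<le> c' i" "(\<Sum>i\<in>UNIV. c' i) = real CARD('n)" for c' :: "'n \<Rightarrow> real"
  proof -
    fix j :: 'n
    have "- {j} \<noteq> {}"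
    proof
      assume "- {j} = {}"
      then have "UNIV = {j}" by blast
      then have "card (UNIV :: 'n set) = card {j}" by (rule arg_cong)
      then show False using d by simp
    qed
    then have m: "(\<integral>\<xi>. 1 * (\<xi> $ i)\<^sup>2 \<partial>sphere_measure) = 1 / real CARD('n)" for i :: 'n
      using integral_sphere_coordinate[of "{j}" 0 i] by simp
    have "(\<Sum>i\<in>UNIV. c' i * (\<integral>\<xi>. 1 * (\<xi> $ i)\<^sup>2 \<partial>sphere_measure)) \<le> diag_mean c'"
      by (rule diag_mean_ge) auto
    then have "1 \<le> diag_mean c'"
      unfolding m using that(2) by (simp flip: sum_divide_distrib)
    then show ?thesis using central_value_le_1[OF d] by simp
  qed
  define S where "S = {i. 0 \<le> c i}"
  consider "S = UNIV" | "S = {}" | "S \<noteq> {}" "- S \<noteq> {}" by blast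
  then show ?thesis
  proof cases
    case 1
    then have "\<And>i. 0 \<le> c i" by (auto simp: S_def)
    then show ?thesis using c by (intro one_sign) auto
  next
    case 2
    then have "\<And>i. c i \<le> 0" by (auto simp: S_def not_le less_imp_le)
    then have "central_value CARD('n) \<le> diag_mean (\<lambda>i. - c i)" using c by (intro one_sign) auto
    then show ?thesis by (simp add: diag_mean_uminus)
  next
    case 3
    have "card S + card (- S) = CARD('n)"
      using card_Un_disjoint[of S "- S"] by simp
    moreover have "1 \<le> card S" "1 \<le> card (- S)" using 3 by (simp_all add: Suc_le_eq card_gt_0_iff)
    ultimately have "central_value CARD('n) \<le> equi_value (real (card S) / 2) (real (card (- S)) / 2)"
      using central_value_le[of "card (- S)" "card S"] by simp
    also have "\<dots> \<le> diag_mean c"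
      using diag_mean_ge_mixed[of c] 3 c d by (simp add: S_def)
    finally show ?thesis .
  qed
qed

lemma quad_mean_ge_central_value:
  fixes B :: "real^'n::{finite,wellorder}^'n::_"
  assumes d: "2 \<le> CARD('n)" and B: "admissible B"
  shows "central_value CARD('n) \<le> quad_mean B"
proof -
  have sym: "transpose B = B" using B by (simp add: admissible_def)
  obtain v :: "'n \<Rightarrow> real^'n::_" and c where
    v: "\<And>i j. v i \<bullet> v j = (if i = j then 1 else 0)" and eig: "\<And>i. B *v v i = c i *\<^sub>R v i"
    using symmetric_matrix_eigenbasis[OF sym] by blast
  have "(\<Sum>i\<in>UNIV. \<bar>c i\<bar>) = real CARD('n)"
    using B matrix_abs_eigenbasis[OF sym v eig] by (simp add: admissible_def)
  then show ?thesis
    unfolding quad_mean_eigenbasis[OF sym v eig] using d by (intro diag_mean_ge_central_value)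
qed

text \<open>The number of smaller indices is the position of an index in the linear order, which is how \<open>J_matrix\<close>
numbers its rows.\<close>

lemma position_bij: "bij_betw (\<lambda>i. card {k. k < i}) (UNIV :: 'n::{finite,linorder} set) {..<CARD('n)}"
proof -
  have mono: "card {k. k < i} < card {k. k < j}" if "i < j" for i j :: 'n
    using that by (intro psubset_card_mono) auto
  have inj: "inj (\<lambda>i :: 'n. card {k. k < i})"
    by (rule linorder_injI) (use mono in force)
  have "card {k. k < i} < CARD('n)" for i :: 'n
    by (intro psubset_card_mono) auto
  then have "range (\<lambda>i :: 'n. card {k. k < i}) \<subseteq> {..<CARD('n)}" by auto
  moreover have "card (range (\<lambda>i :: 'n. card {k. k < i})) = card {..<CARD('n)}"
    using inj by (simp add: card_image)
  ultimately have "range (\<lambda>i :: 'n. card {k. k < i}) = {..<CARD('n)}"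
    by (intro card_subset_eq) auto
  with inj show ?thesis by (simp add: bij_betw_def)
qed

lemma J_matrix_diag:
  assumes "s + t = CARD('n::{finite,linorder})"
  defines "S \<equiv> {i :: 'n. card {k. k < i} < s}"
  shows "(J_matrix s t a b :: real^'n::_^'n::_) = diag_matrix (\<lambda>i. if i \<in> S then a else - b)"
    and "card S = s" "card (- S) = t"
proof -
  have pos: "card {k. k < i} < s + t" for i :: 'n
    using bij_betwE[OF position_bij[where 'n = 'n]] assms by auto
  show "(J_matrix s t a b :: real^'n::_^'n::_) = diag_matrix (\<lambda>i. if i \<in> S then a else - b)"
    by (auto simp: J_matrix_def diag_matrix_def vec_eq_iff S_def pos)
  have "bij_betw (\<lambda>i. card {k. k < i}) S {..<s}"
  proof (rule bij_betw_subset[OF position_bij])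
    have "{..<s} \<subseteq> range (\<lambda>i :: 'n. card {k. k < i})"
      using position_bij[where 'n = 'n] assms(1) by (auto simp: bij_betw_def)
    then show "(\<lambda>i. card {k. k < i}) ` S = {..<s}" by (auto simp: S_def)
  qed simp
  then show "card S = s" using bij_betw_same_card by fastforce
  then show "card (- S) = t" using assms(1) card_Un_disjoint[of S "- S"] by simp
qed

lemma
  fixes a b :: real
  assumes st: "s + t = CARD('n::{finite,wellorder})" "1 \<le> s" "1 \<le> t" and ab: "0 \<le> a" "0 \<le> b"
    and norm: "a * real s + b * real t = real CARD('n)"
  shows admissible_J_matrix: "admissible (J_matrix s t a b :: real^'n::_^'n::_)"
    and quad_mean_J_matrix: "b / (a + b) = equipoint (real s / 2) (real t / 2) \<Longrightarrow>
      quad_mean (J_matrix s t a b :: real^'n::_^'n::_) = equi_value (real s / 2) (real t / 2)"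
proof -
  define S where "S = {i :: 'n. card {k. k < i} < s}"
  note J = J_matrix_diag[OF st(1), folded S_def]
  have S: "S \<noteq> {}" "- S \<noteq> {}" using J(2,3) st(2,3) by force+
  have "(\<Sum>i\<in>UNIV. \<bar>if i \<in> S then a else - b\<bar>) = (\<Sum>i\<in>S. \<bar>if i \<in> S then a else - b\<bar>) + (\<Sum>i\<in>- S. \<bar>if i \<in> S then a else - b\<bar>)"
    by (subst sum.union_disjoint[symmetric]) auto
  also have "\<dots> = real CARD('n)" using ab norm J(2,3) by (simp add: mult.commute)
  finally show "admissible (J_matrix s t a b :: real^'n::_^'n::_)"
    unfolding J(1) admissible_diag_matrix .
  assume p: "b / (a + b) = equipoint (real s / 2) (real t / 2)"
  have pos: "real s / 2 > 0" "real t / 2 > 0" using st by auto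
  have "0 < a + b"
    using equipoint_in[OF pos] ab unfolding p[symmetric] by (cases "a + b = 0") auto
  then have "diag_mean (\<lambda>i. if i \<in> S then a else - b)
    = (a * real s * equi_value (real s / 2) (real t / 2) + b * real t * equi_value (real s / 2) (real t / 2)) / real CARD('n)"
    using diag_mean_two_values[OF S ab] equi_value_left[OF pos] equi_value_right[OF pos] by (simp add: J(2,3) p)
  also have "\<dots> = equi_value (real s / 2) (real t / 2)"
    using norm by (simp flip: distrib_right)
  finally show "quad_mean (J_matrix s t a b :: real^'n::_^'n::_) = equi_value (real s / 2) (real t / 2)"
    unfolding J(1) quad_mean_diag_matrix .
qed

lemma vartheta_eqI:
  fixes B :: "real^'n::{finite,wellorder}^'n::_"
  assumes "2 \<le> CARD('n)" "admissible B" "quad_mean B = central_value CARD('n)"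
  shows "1 / vartheta TYPE('n) = central_value CARD('n)" and "is_arg_min quad_mean admissible B"
proof -
  have "(LEAST r. \<exists>B :: real^'n::_^'n::_. admissible B \<and> r = quad_mean B) = central_value CARD('n)"
    using assms quad_mean_ge_central_value[OF assms(1)] by (intro Least_equality) (auto intro!: exI[of _ B])
  then show "1 / vartheta TYPE('n) = central_value CARD('n)" by (simp add: vartheta_def)
  show "is_arg_min quad_mean admissible B"
    using assms quad_mean_ge_central_value[OF assms(1)] by (auto simp: is_arg_min_def not_less)
qed

text \<open>The ratio and the normalization are two independent linear equations for \<open>a\<close> and \<open>b\<close>; this gives both the
existence and the uniqueness of the pair in odd dimension.\<close>

lemma normalized_pair_iff:
  fixes a b p s t d :: real
  assumes st: "0 < s" "0 < t" and p: "0 < p" "p < 1" and d: "0 < d"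
    and ab: "0 \<le> a" "0 \<le> b"
  shows "a * s + b * t = d \<and> b / (a + b) = p \<longleftrightarrow> a = d * (1 - p) / (s * (1 - p) + t * p) \<and> b = d * p / (s * (1 - p) + t * p)"
proof -
  define D where "D = s * (1 - p) + t * p"
  have D: "D > 0" unfolding D_def using st p by (intro add_pos_pos mult_pos_pos) auto
  show ?thesis unfolding D_def[symmetric]
  proof (intro iffI; elim conjE)
    assume *: "a * s + b * t = d" "b / (a + b) = p"
    have "a + b \<noteq> 0" using * p by auto
    define m where "m = a + b"
    have b: "b = p * m" using *(2) \<open>a + b \<noteq> 0\<close> by (simp add: m_def field_simps)
    then have a: "a = (1 - p) * m" by (simp add: m_def left_diff_distrib)
    have "d = m * D" unfolding *(1)[symmetric] a b D_def by (simp add: algebra_simps)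
    then have "m = d / D" using D by simp
    with a b show "a = d * (1 - p) / D \<and> b = d * p / D" by (simp add: mult.commute)
  next
    assume *: "a = d * (1 - p) / D" "b = d * p / D"
    have "a + b = d / D" unfolding * by (simp add: add_divide_distrib[symmetric] algebra_simps)
    then have "b / (a + b) = p" using * D d by simp
    moreover have "a * s + b * t = d * D / D" unfolding * by (simp add: D_def add_divide_distrib[symmetric] algebra_simps)
    ultimately show "a * s + b * t = d \<and> b / (a + b) = p" using D by simp
  qed
qed

theorem theorem1p2:
  fixes d :: nat
  assumes "d = CARD('n::{finite,wellorder})"
  shows
    "(even d \<longrightarrow>
        1 / vartheta TYPE('n) = quad_mean (J_matrix (d div 2) (d div 2) 1 1 :: real^'n::_^'n::_) \<and>
        quad_mean (J_matrix (d div 2) (d div 2) 1 1 :: real^'n::_^'n::_)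
          = 2 * regularized_Beta (1/2) (real d / 4) (real d / 4 + 1) - 1 \<and>
        2 * regularized_Beta (1/2) (real d / 4) (real d / 4 + 1) - 1
          = Gamma (1/2 + real d / 4) / (sqrt pi * Gamma (1 + real d / 4)) \<and>
        is_arg_min quad_mean admissible (J_matrix (d div 2) (d div 2) 1 1 :: real^'n::_^'n::_)) \<and>
     (odd d \<and> d \<ge> 3 \<longrightarrow>
        (\<exists>a b. a \<ge> 0 \<and> b \<ge> 0 \<and>
          1 / vartheta TYPE('n)
            = quad_mean (J_matrix ((d + 1) div 2) ((d - 1) div 2) a b :: real^'n::_^'n::_) \<and>
          1 / vartheta TYPE('n)
            = 2 * regularized_Beta (a / (a + b)) ((real d - 1) / 4) ((real d + 1) / 4 + 1) - 1 \<and>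
          2 * regularized_Beta (a / (a + b)) ((real d - 1) / 4) ((real d + 1) / 4 + 1) - 1
            = 2 * regularized_Beta (b / (a + b)) ((real d + 1) / 4) ((real d - 1) / 4 + 1) - 1 \<and>
          a * ((real d + 1) / 2) + b * ((real d - 1) / 2) = real d \<and>
          (\<forall>a' b'. a' \<ge> 0 \<and> b' \<ge> 0 \<and>
            1 / vartheta TYPE('n)
              = 2 * regularized_Beta (a' / (a' + b')) ((real d - 1) / 4) ((real d + 1) / 4 + 1) - 1 \<and>
            2 * regularized_Beta (a' / (a' + b')) ((real d - 1) / 4) ((real d + 1) / 4 + 1) - 1
              = 2 * regularized_Beta (b' / (a' + b')) ((real d + 1) / 4) ((real d - 1) / 4 + 1) - 1 \<and>
            a' * ((real d + 1) / 2) + b' * ((real d - 1) / 2) = real d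
            \<longrightarrow> a' = a \<and> b' = b) \<and>
          is_arg_min quad_mean admissible
            (J_matrix ((d + 1) div 2) ((d - 1) div 2) a b :: real^'n::_^'n::_)))"
proof (intro conjI impI, goal_cases)
  have dpos: "0 < d" using assms by simp
  {
    assume even: "even d"
    define J where "J = (J_matrix (d div 2) (d div 2) 1 1 :: real^'n::_^'n::_)"
    have half: "real (d div 2) / 2 = real d / 4" "real (d div 2) = real d / 2" using even by auto
    have pos: "real d / 4 > 0" using dpos by simp
    have d2: "2 \<le> d" using even dpos by (auto elim: evenE)
    have st: "d div 2 + d div 2 = CARD('n)" "1 \<le> d div 2" using even d2 assms by auto
    have "admissible J"
      unfolding J_def by (rule admissible_J_matrix[OF st(1,2,2)]) (use half assms in simp_all)
    moreover have qJ: "quad_mean J = equi_value (real d / 4) (real d / 4)"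
      unfolding J_def half(1)[symmetric]
    proof (rule quad_mean_J_matrix[OF st(1,2,2)])
      show "1 * real (d div 2) + 1 * real (d div 2) = real CARD('n)" using half(2) assms by simp
      show "1 / (1 + 1) = equipoint (real (d div 2) / 2) (real (d div 2) / 2)"
        unfolding half(1) equipoint_same[OF pos] by simp
    qed simp_all
    moreover have "central_value CARD('n) = equi_value (real d / 4) (real d / 4)"
      using even assms by (simp add: central_value_def)
    ultimately have th: "1 / vartheta TYPE('n) = equi_value (real d / 4) (real d / 4)" "is_arg_min quad_mean admissible J"
      using vartheta_eqI[of J] d2 assms by auto
    have reg: "2 * regularized_Beta (1/2) (real d / 4) (real d / 4 + 1) - 1 = equi_value (real d / 4) (real d / 4)"
      using equi_value_right[OF pos pos] pos by (simp add: equipoint_same)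
    show "1 / vartheta TYPE('n) = quad_mean J"
      "quad_mean J = 2 * regularized_Beta (1/2) (real d / 4) (real d / 4 + 1) - 1"
      "2 * regularized_Beta (1/2) (real d / 4) (real d / 4 + 1) - 1
          = Gamma (1/2 + real d / 4) / (sqrt pi * Gamma (1 + real d / 4))"
      "is_arg_min quad_mean admissible J"
      using th qJ reg equi_value_same_Gamma[OF pos] by simp_all
  }
  case odd: 5
  define s where "s = (d + 1) div 2"
  define t where "t = (d - 1) div 2"
  have st: "s + t = CARD('n)" "1 \<le> s" "1 \<le> t" and rst: "real s = (real d + 1) / 2" "real t = (real d - 1) / 2"
    using odd assms by (auto simp: s_def t_def elim!: oddE)
  define \<alpha> where "\<alpha> = (real d + 1) / 4"
  define \<beta> where "\<beta> = (real d - 1) / 4"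
  have \<alpha>\<beta>: "real s / 2 = \<alpha>" "real t / 2 = \<beta>" by (simp_all add: rst \<alpha>_def \<beta>_def)
  have pos: "\<alpha> > 0" "\<beta> > 0" using odd by (auto simp: \<alpha>_def \<beta>_def)
  define p where "p = equipoint \<alpha> \<beta>"
  have p: "0 < p" "p < 1" unfolding p_def using equipoint_in[OF pos] by auto
  define D where "D = real s * (1 - p) + real t * p"
  define a where "a = real d * (1 - p) / D"
  define b where "b = real d * p / D"
  have st0: "0 < real s" "0 < real t" "0 < real d" using st dpos by auto
  have "D > 0" unfolding D_def using st0 p by (intro add_pos_pos mult_pos_pos) auto
  then have ab: "0 \<le> a" "0 \<le> b" using p by (auto simp: a_def b_def)
  have abp: "a * real s + b * real t = real d" "b / (a + b) = p"
    using normalized_pair_iff[OF st0(1,2) p st0(3) ab] by (auto simp: a_def b_def D_def)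
  have frac: "a' / (a' + b') = 1 - b' / (a' + b')" "b' / (a' + b') \<in> {0..1}"
    if "0 \<le> a'" "0 \<le> b'" "a' * real s + b' * real t = real d" for a' b'
  proof -
    have "a' + b' \<noteq> 0" using that st0 by (auto simp: add_nonneg_eq_0_iff)
    then have 1: "a' / (a' + b') + b' / (a' + b') = 1" by (simp flip: add_divide_distrib)
    have "0 \<le> a' / (a' + b')" "0 \<le> b' / (a' + b')" using that by simp_all
    with 1 show "a' / (a' + b') = 1 - b' / (a' + b')" "b' / (a' + b') \<in> {0..1}"
      unfolding atLeastAtMost_iff by linarith+
  qed
  have refl: "2 * regularized_Beta (a' / (a' + b')) \<beta> (\<alpha> + 1) - 1 = 1 - 2 * regularized_Beta (b' / (a' + b')) (\<alpha> + 1) \<beta>"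
    if "0 \<le> a'" "0 \<le> b'" "a' * real s + b' * real t = real d" for a' b'
    using regularized_Beta_reflect[OF _ pos(2) frac(2)[OF that], of "\<alpha> + 1"] pos(1)
    unfolding frac(1)[OF that] by linarith
  define J where "J = (J_matrix s t a b :: real^'n::_^'n::_)"
  have qJ: "quad_mean J = equi_value \<alpha> \<beta>"
    unfolding J_def \<alpha>\<beta>[symmetric] using abp assms
    by (intro quad_mean_J_matrix[OF st ab]) (auto simp: p_def \<alpha>\<beta>)
  have "admissible J" unfolding J_def using abp assms by (intro admissible_J_matrix[OF st ab]) simp
  moreover have "central_value CARD('n) = equi_value \<alpha> \<beta>"
    using odd assms by (simp add: central_value_def \<alpha>_def \<beta>_def)
  ultimately have th: "1 / vartheta TYPE('n) = equi_value \<alpha> \<beta>" "is_arg_min quad_mean admissible J"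
    using vartheta_eqI[of J] odd assms qJ by auto
  have val: "2 * regularized_Beta (a / (a + b)) \<beta> (\<alpha> + 1) - 1 = equi_value \<alpha> \<beta>"
    "2 * regularized_Beta (b / (a + b)) \<alpha> (\<beta> + 1) - 1 = equi_value \<alpha> \<beta>"
    using refl[OF ab abp(1)] equi_value_left[OF pos] equi_value_right[OF pos] by (simp_all add: abp p_def)
  \<comment> \<open>After a reflection, equality of the two beta expressions says that \<open>b' / (a' + b')\<close> is the
  equipoint.\<close>
  have uniq: "a' = a \<and> b' = b"
    if "0 \<le> a'" "0 \<le> b'" "a' * real s + b' * real t = real d"
      and eq: "2 * regularized_Beta (a' / (a' + b')) \<beta> (\<alpha> + 1) - 1 = 2 * regularized_Beta (b' / (a' + b')) \<alpha> (\<beta> + 1) - 1" for a' b'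
  proof -
    note frac(2)[OF that(1-3)]
    moreover have "Beta_pair \<alpha> \<beta> (b' / (a' + b')) = 1"
      using refl[OF that(1-3)] eq by (simp add: Beta_pair_def)
    ultimately have "b' / (a' + b') = p" unfolding p_def by (intro equipoint_eqI[OF pos, symmetric])
    then show ?thesis
      using normalized_pair_iff[OF st0(1,2) p st0(3) that(1,2)] that(3) by (simp add: a_def b_def D_def)
  qed
  show ?case
    unfolding \<alpha>_def[symmetric] \<beta>_def[symmetric] rst[symmetric] s_def[symmetric] t_def[symmetric]
  proof (rule exI[of _ a], rule exI[of _ b], fold J_def, intro conjI allI impI)
    show "1 / vartheta TYPE('n) = quad_mean J" using th qJ by simp
    show "1 / vartheta TYPE('n) = 2 * regularized_Beta (a / (a + b)) \<beta> (\<alpha> + 1) - 1" using th val by simp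
    show "2 * regularized_Beta (a / (a + b)) \<beta> (\<alpha> + 1) - 1 = 2 * regularized_Beta (b / (a + b)) \<alpha> (\<beta> + 1) - 1"
      using val by simp
    show "0 \<le> a" "0 \<le> b" "a * real s + b * real t = real d" "is_arg_min quad_mean admissible J"
      by (fact ab abp(1) th(2))+
    fix a' b'
    assume "0 \<le> a' \<and> 0 \<le> b' \<and>
      1 / vartheta TYPE('n) = 2 * regularized_Beta (a' / (a' + b')) \<beta> (\<alpha> + 1) - 1 \<and>
      2 * regularized_Beta (a' / (a' + b')) \<beta> (\<alpha> + 1) - 1 = 2 * regularized_Beta (b' / (a' + b')) \<alpha> (\<beta> + 1) - 1 \<and>
      a' * real s + b' * real t = real d"
    then have "a' = a \<and> b' = b" by (elim conjE) (rule uniq)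
    then show "a' = a" "b' = b" by simp_all
  qed
qed

end
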